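(* Let $k\ge 3$ be an integer, let $F$ be a graph with $\chi(F)>k$, and assume that $F$ contains a color-critical vertex. Then for all sufficiently large $n$ we have $$\mathrm{ex}_k(n,\text{Berge-}F)=\mathrm{ex}(n,K_k,F).$$
   Context: All graphs and hypergraphs are finite and simple; hyperedges of a hypergraph are distinct, and a hypergraph is $k$-uniform if each hyperedge has exactly $k$ vertices. Given a hypergraph $\mathcal{H}$ and a graph $G$ (with the vertices of $G$ being vertices of $\mathcal{H}$), $\mathcal{H}$ is a Berge-$G$ (a Berge copy of $G$) if there is a bijection between the hyperedges of $\mathcal{H}$ and the edges of $G$ such that each hyperedge contains its image. A hypergraph is Berge-$F$-free if no subhypergraph of it is a Berge-$F$. $\mathrm{ex}_k(n,\text{Berge-}F)$ denotes the largest number of hyperedges in an $n$-vertex $k$-uniform Berge-$F$-free hypergraph. A graph is $F$-free if it does not contain $F$ as a (not necessarily induced) subgraph. For graphs $H,G$, $\mathcal{N}(H,G)$ is the number of (not necessarily induced) copies of $H$ in $G$, and $\mathrm{ex}(n,H,F)=\max\{\mathcal{N}(H,G): G \text{ is an } n\text{-vertex } F\text{-free graph}\}$. $K_k$ is the complete graph on $k$ vertices and $\chi$ denotes the chromatic number. A color-critical vertex of a graph is a vertex whose deletion decreases the chromatic number. "Sufficiently large" means larger than a threshold depending only on $F$ and $k$. *)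

theory Defs
  imports Main
begin

text \<open>A (hyper)graph is a pair of a vertex set and a set of vertex sets, so hyperedges are
  distinct; a simple graph is a 2-uniform hypergraph.\<close>

type_synonym 'a hypergraph = "'a set \<times> 'a set set"

abbreviation verts :: "'a hypergraph \<Rightarrow> 'a set" where "verts \<equiv> fst"
abbreviation edges :: "'a hypergraph \<Rightarrow> 'a set set" where "edges \<equiv> snd"

definition hypergraph :: "'a hypergraph \<Rightarrow> bool" where
  "hypergraph H \<longleftrightarrow> finite (verts H) \<and> (\<forall>e\<in>edges H. e \<subseteq> verts H)"

definition uniform :: "nat \<Rightarrow> 'a hypergraph \<Rightarrow> bool" where
  "uniform k H \<longleftrightarrow> hypergraph H \<and> (\<forall>e\<in>edges H. card e = k)"

definition graph :: "'a hypergraph \<Rightarrow> bool" where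
  "graph G \<longleftrightarrow> uniform 2 G"

definition subhypergraph :: "'a hypergraph \<Rightarrow> 'a hypergraph \<Rightarrow> bool" where
  "subhypergraph S H \<longleftrightarrow> hypergraph S \<and> verts S \<subseteq> verts H \<and> edges S \<subseteq> edges H"

definition isomorphic :: "'a hypergraph \<Rightarrow> 'b hypergraph \<Rightarrow> bool" where
  "isomorphic G H \<longleftrightarrow>
     (\<exists>f. bij_betw f (verts G) (verts H) \<and> (\<lambda>e. f ` e) ` edges G = edges H)"

definition delete_vertex :: "'a hypergraph \<Rightarrow> 'a \<Rightarrow> 'a hypergraph" where
  "delete_vertex G v = (verts G - {v}, {e \<in> edges G. v \<notin> e})"

definition colorable :: "'a hypergraph \<Rightarrow> nat \<Rightarrow> bool" where
  "colorable G c \<longleftrightarrow>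
     (\<exists>f :: 'a \<Rightarrow> nat. (\<forall>v\<in>verts G. f v < c) \<and> (\<forall>u v. {u, v} \<in> edges G \<longrightarrow> f u \<noteq> f v))"

definition chromatic_number :: "'a hypergraph \<Rightarrow> nat" where
  "chromatic_number G = (LEAST c. colorable G c)"

definition color_critical_vertex :: "'a hypergraph \<Rightarrow> 'a \<Rightarrow> bool" where
  "color_critical_vertex G v \<longleftrightarrow>
     v \<in> verts G \<and> chromatic_number (delete_vertex G v) < chromatic_number G"

definition complete_graph :: "nat \<Rightarrow> nat hypergraph" where
  "complete_graph k = ({..<k}, {e. e \<subseteq> {..<k} \<and> card e = 2})"

definition copies :: "'a hypergraph \<Rightarrow> 'b hypergraph \<Rightarrow> nat" where
  "copies H G = card {S. subhypergraph S G \<and> isomorphic H S}"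

definition graph_free :: "'a hypergraph \<Rightarrow> 'b hypergraph \<Rightarrow> bool" where
  "graph_free F G \<longleftrightarrow> \<not> (\<exists>S. subhypergraph S G \<and> isomorphic F S)"

definition is_berge :: "'a hypergraph \<Rightarrow> 'a hypergraph \<Rightarrow> bool" where
  "is_berge H G \<longleftrightarrow>
     verts G \<subseteq> verts H \<and> (\<exists>\<phi>. bij_betw \<phi> (edges H) (edges G) \<and> (\<forall>h\<in>edges H. \<phi> h \<subseteq> h))"

definition berge_free :: "'a hypergraph \<Rightarrow> 'b hypergraph \<Rightarrow> bool" where
  "berge_free F H \<longleftrightarrow>
     \<not> (\<exists>S G. subhypergraph S H \<and> isomorphic F G \<and> is_berge S G)"

text \<open>Every finite hypergraph is isomorphic to one with vertices in \<^typ>\<open>nat\<close>, so it is enough to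
  maximise over those. The sets below are always finite, and they are nonempty (witnessed by an
  edgeless hypergraph) whenever the graph \<open>F\<close> has an edge.\<close>

definition ex_berge :: "nat \<Rightarrow> nat \<Rightarrow> 'a hypergraph \<Rightarrow> nat" where
  "ex_berge k n F =
     Max {card (edges H) | H :: nat hypergraph.
            uniform k H \<and> card (verts H) = n \<and> berge_free F H}"

definition ex_count :: "nat \<Rightarrow> 'b hypergraph \<Rightarrow> 'a hypergraph \<Rightarrow> nat" where
  "ex_count n H F =
     Max {copies H G | G :: nat hypergraph.
            graph G \<and> card (verts G) = n \<and> graph_free F G}"

end

theory Submission
  imports Defs "HOL-Analysis.Convex"
begin

text \<open>By Hall's theorem, a Berge-\<open>F\<close>-free hypergraph has at most as many hyperedges as some
  \<open>F\<close>-free graph with red and blue edges has blue \<open>k\<close>-cliques plus red edges. Fix such a graph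
  \<open>G\<close> on \<open>n\<close> vertices for which this weight is maximal. It suffices that every red edge lies in
  at least \<open>k * k\<close> of the \<open>k\<close>-cliques of \<open>G\<close>: then recolouring all edges blue loses nothing.

  Let \<open>r \<ge> k\<close> be one less than the chromatic number. A graph with a colour-critical vertex embeds
  into the complete multipartite graph with one part of size \<open>1\<close> and \<open>r\<close> parts of size \<open>t\<close>. The
  weight is at least that of the Turan graph, so the Moon-Moser inequalities give many
  \<open>r\<close>-cliques for which almost every vertex is adjacent to all but at most one member, and by
  Erdos's theorem these contain a complete \<open>r\<close>-partite graph with large parts. Sorting the vertices
  by the part to which they have few neighbours splits almost all of them into \<open>r\<close> classes, inside
  which degrees are bounded. Any \<open>t\<close> vertices outside the \<open>i\<close>-th class have many common
  neighbours, hence replacing an arbitrary vertex by one joined to exactly those vertices keeps the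
  graph \<open>F\<close>-free. By maximality every vertex lies in about as many blue cliques as in the
  Turan graph. Its neighbourhood has few \<open>r\<close>-cliques, so by the Moon-Moser inequalities again
  the neighbourhood must be so large that red edges extend greedily to many \<open>k\<close>-cliques.\<close>

section \<open>Cliques and the Moon-Moser inequality\<close>

text \<open>The exact structure of a maximal graph is never determined; the one fact extracted about
  it is a lower bound on all blue degrees. This suffices because \<open>k \<le> r\<close>:
  \<open>k - 1\<close> vertices, each missing about a fraction \<open>1 / r\<close> of all vertices,
  still have linearly many common neighbours. The number \<open>k * k\<close> bounds the pairs
  inside a \<open>k\<close>-clique, so double counting yields at least as many new cliques as there
  are recoloured red edges. The hypothesis \<open>k \<ge> 3\<close> makes the red edges, at most
  \<open>n ^ 2\<close> of them, negligible against \<open>n ^ k\<close>. Hence the blue graph alone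
  is dense in \<open>k\<close>-cliques, and the skeleton, the classes and the degrees all refer to
  blue edges, whereas freeness of \<open>F\<close> is known for both colours together. The obstacle
  is a vertex in few blue cliques. Its class need not be independent, so moving it into a part could
  create a copy of \<open>F\<close>. The replacement vertex is therefore judged only by the common
  neighbours of small subsets of its neighbourhood, which makes freeness immediate.\<close>

definition loopless :: "'a set set \<Rightarrow> bool" where
  "loopless E \<longleftrightarrow> (\<forall>e\<in>E. card e = 2)"

lemma loopless_ne: "loopless E \<Longrightarrow> {x, y} \<in> E \<Longrightarrow> x \<noteq> y"
  by (force simp: loopless_def)

definition cliques :: "'a set \<Rightarrow> 'a set set \<Rightarrow> nat \<Rightarrow> 'a set set" where
  "cliques V E k = {Q. Q \<subseteq> V \<and> card Q = k \<and> (\<forall>x\<in>Q. \<forall>y\<in>Q. x \<noteq> y \<longrightarrow> {x, y} \<in> E)}"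

definition extensions :: "'a set \<Rightarrow> 'a set set \<Rightarrow> 'a set \<Rightarrow> 'a set" where
  "extensions V E P = {y \<in> V. \<forall>x\<in>P. {x, y} \<in> E}"

lemma finite_cliques [simp]: "finite V \<Longrightarrow> finite (cliques V E k)"
  by (rule finite_subset[of _ "Pow V"]) (auto simp: cliques_def)

lemma finite_extensions [simp]: "finite V \<Longrightarrow> finite (extensions V E P)"
  by (simp add: extensions_def)

lemma card_extensions_le: "finite V \<Longrightarrow> card (extensions V E P) \<le> card V"
  by (rule card_mono) (auto simp: extensions_def)

lemma cliques_finite: "finite V \<Longrightarrow> Q \<in> cliques V E k \<Longrightarrow> finite Q"
  by (auto simp: cliques_def intro: finite_subset)

lemma cliques_mono: "V \<subseteq> V' \<Longrightarrow> E \<subseteq> E' \<Longrightarrow> cliques V E k \<subseteq> cliques V' E' k"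
  by (auto simp: cliques_def)

lemma cliques_0: "finite V \<Longrightarrow> cliques V E 0 = {{}}"
  by (auto simp: cliques_def dest: finite_subset)

lemma card_cliques_1: "finite V \<Longrightarrow> card (cliques V E (Suc 0)) = card V"
proof -
  have "cliques V E (Suc 0) = (\<lambda>x. {x}) ` V"
    by (auto simp: cliques_def card_Suc_eq)
  then show ?thesis by (simp add: card_image)
qed

lemma insert_cliques:
  assumes "finite V" "loopless E" "P \<in> cliques V E s" "y \<in> extensions V E P"
  shows "insert y P \<in> cliques V E (Suc s)" "y \<notin> P"
proof -
  show "y \<notin> P" using assms loopless_ne by (fastforce simp: extensions_def)
  with assms show "insert y P \<in> cliques V E (Suc s)"
    using finite_subset[of P V] by (auto simp: cliques_def extensions_def insert_commute)
qed

lemma remove_cliques: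
  assumes "finite V" "Q \<in> cliques V E (Suc s)" "x \<in> Q"
  shows "Q - {x} \<in> cliques V E s" "x \<in> extensions V E (Q - {x})"
  using assms finite_subset[of Q V] by (auto simp: cliques_def extensions_def)

text \<open>Double counting of pairs of a clique and one of its vertices: deleting the vertex leads
  to pairs of a smaller clique and an extension. The weight \<open>g\<close> is needed both as the
  constant \<open>1\<close> and as the number of extensions.\<close>

lemma sum_cliques_remove:
  fixes g :: "'a set \<Rightarrow> real"
  assumes V: "finite V" and E: "loopless E"
  shows "(\<Sum>Q\<in>cliques V E (Suc s). \<Sum>x\<in>Q. g (Q - {x})) =
    (\<Sum>P\<in>cliques V E s. real (card (extensions V E P)) * g P)"
proof -
  let ?A = "Sigma (cliques V E (Suc s)) (\<lambda>Q. Q)"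
  let ?B = "Sigma (cliques V E s) (extensions V E)"
  have "(\<Sum>Q\<in>cliques V E (Suc s). \<Sum>x\<in>Q. g (Q - {x})) = (\<Sum>(Q, x)\<in>?A. g (Q - {x}))"
    using finite_cliques[OF V] cliques_finite[OF V] by (intro sum.Sigma ballI) blast+
  also have "\<dots> = (\<Sum>(P, y)\<in>?B. g P)"
  proof (rule sum.reindex_bij_witness[of _ "\<lambda>(P, y). (insert y P, y)" "\<lambda>(Q, x). (Q - {x}, x)"])
    fix p assume "p \<in> ?A"
    then obtain Q x where p: "p = (Q, x)" "Q \<in> cliques V E (Suc s)" "x \<in> Q" by blast
    then show "(case case p of (Q, x) \<Rightarrow> (Q - {x}, x) of (P, y) \<Rightarrow> (insert y P, y)) = p"
      "(case p of (Q, x) \<Rightarrow> (Q - {x}, x)) \<in> ?B"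
      "(case case p of (Q, x) \<Rightarrow> (Q - {x}, x) of (P, y) \<Rightarrow> g P) = (case p of (Q, x) \<Rightarrow> g (Q - {x}))"
      using remove_cliques[OF V p(2,3)] by (simp_all add: insert_absorb)
  next
    fix p assume "p \<in> ?B"
    then obtain P y where p: "p = (P, y)" "P \<in> cliques V E s" "y \<in> extensions V E P" by blast
    then show "(case case p of (P, y) \<Rightarrow> (insert y P, y) of (Q, x) \<Rightarrow> (Q - {x}, x)) = p"
      "(case p of (P, y) \<Rightarrow> (insert y P, y)) \<in> ?A"
      using insert_cliques[OF V E p(2,3)] by simp_all
  qed
  also have "\<dots> = (\<Sum>P\<in>cliques V E s. \<Sum>y\<in>extensions V E P. g P)"
    by (rule sum.Sigma[symmetric]) (simp_all add: V)
  finally show ?thesis by simp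
qed

lemma sum_card_extensions:
  assumes "finite V" "loopless E"
  shows "(\<Sum>P\<in>cliques V E s. real (card (extensions V E P))) = real (Suc s) * card (cliques V E (Suc s))"
proof -
  have "(\<Sum>Q\<in>cliques V E (Suc s). \<Sum>x\<in>Q. 1 :: real) = (\<Sum>Q\<in>cliques V E (Suc s). real (Suc s))"
    by (rule sum.cong) (auto simp: cliques_def)
  then show ?thesis using sum_cliques_remove[OF assms, where s = s and g = "\<lambda>_. 1"] by (simp add: mult.commute)
qed

text \<open>The vertices adjacent to all but at most one member of the clique \<open>Q\<close>, members of \<open>Q\<close>
  included.\<close>

definition near_extensions :: "'a set \<Rightarrow> 'a set set \<Rightarrow> 'a set \<Rightarrow> 'a set" where
  "near_extensions V E Q = (\<Union>x\<in>Q. extensions V E (Q - {x}))"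

lemma finite_near_extensions [simp]: "finite V \<Longrightarrow> finite (near_extensions V E Q)"
  by (rule finite_subset[of _ V]) (auto simp: near_extensions_def extensions_def)

lemma card_near_extensions_le: "finite V \<Longrightarrow> card (near_extensions V E Q) \<le> card V"
  by (rule card_mono) (auto simp: near_extensions_def extensions_def)

text \<open>A vertex adjacent to all of \<open>Q\<close> is counted at most \<open>s + 1\<close>
  times on the left. Any other vertex is counted at most once, since being counted for two members
  of \<open>Q\<close> would make it adjacent to all of them.\<close>

lemma sum_card_extensions_remove_le:
  assumes V: "finite V" and Q: "finite Q" "card Q = Suc s"
  shows "(\<Sum>x\<in>Q. card (extensions V E (Q - {x}))) \<le> card (near_extensions V E Q) + s * card (extensions V E Q)"
proof -
  let ?U = "near_extensions V E Q"
  have fin: "finite ?U" using V by simp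
  have sub: "extensions V E Q \<subseteq> ?U"
  proof -
    obtain x where "x \<in> Q" using Q(2) by fastforce
    then show ?thesis by (auto simp: extensions_def near_extensions_def)
  qed
  have "(\<Sum>x\<in>Q. card (extensions V E (Q - {x}))) = (\<Sum>x\<in>Q. \<Sum>y\<in>?U. if y \<in> extensions V E (Q - {x}) then 1 else 0)"
  proof (rule sum.cong)
    fix x assume x: "x \<in> Q"
    have "(\<Sum>y\<in>?U. if y \<in> extensions V E (Q - {x}) then 1 else 0) = card (?U \<inter> extensions V E (Q - {x}))"
      using fin by (simp add: sum.If_cases)
    also have "?U \<inter> extensions V E (Q - {x}) = extensions V E (Q - {x})" using x by (auto simp: near_extensions_def)
    finally show "card (extensions V E (Q - {x})) = (\<Sum>y\<in>?U. if y \<in> extensions V E (Q - {x}) then 1 else 0)" by simp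
  qed simp
  also have "\<dots> = (\<Sum>y\<in>?U. \<Sum>x\<in>Q. if y \<in> extensions V E (Q - {x}) then 1 else 0)"
    by (rule sum.swap)
  also have "\<dots> \<le> (\<Sum>y\<in>?U. 1 + (if y \<in> extensions V E Q then s else 0))"
  proof (rule sum_mono)
    fix y assume y: "y \<in> ?U"
    have eq: "(\<Sum>x\<in>Q. if y \<in> extensions V E (Q - {x}) then 1 else 0) = card {x \<in> Q. y \<in> extensions V E (Q - {x})}"
      using Q by (simp add: sum.If_cases Int_def conj_commute)
    show "(\<Sum>x\<in>Q. if y \<in> extensions V E (Q - {x}) then 1 else 0) \<le> 1 + (if y \<in> extensions V E Q then s else 0)"
    proof (cases "y \<in> extensions V E Q")
      case True
      then show ?thesis unfolding eq using card_mono[of Q "{x \<in> Q. y \<in> extensions V E (Q - {x})}"] Q by auto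
    next
      case False
      then have "\<And>x x'. x \<in> Q \<Longrightarrow> x' \<in> Q \<Longrightarrow> y \<in> extensions V E (Q - {x}) \<Longrightarrow> y \<in> extensions V E (Q - {x'}) \<Longrightarrow> x = x'"
        by (auto simp: extensions_def)
      then have "card {x \<in> Q. y \<in> extensions V E (Q - {x})} \<le> Suc 0"
        using Q by (subst card_le_Suc0_iff_eq) auto
      then show ?thesis unfolding eq using False by simp
    qed
  qed
  also have "\<dots> = card ?U + s * card (extensions V E Q)"
    unfolding sum.distrib using fin sub by (simp add: sum.If_cases Int_absorb1)
  finally show ?thesis .
qed

text \<open>A square counts each extension of \<open>P\<close> with weight the number of extensions
  of \<open>P\<close>; regrouping by the enlarged clique gives a sum over its facets. The near
  extensions are kept, not yet bounded by \<open>card V\<close>, because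
  \<open>many_good_cliques\<close> reads off their average size.\<close>

lemma sum_card_extensions_sq:
  assumes V: "finite V" and E: "loopless E"
  shows "(\<Sum>P\<in>cliques V E s. (real (card (extensions V E P)))\<^sup>2) \<le>
    (\<Sum>Q\<in>cliques V E (Suc s). real (card (near_extensions V E Q))) +
      s * real (s + 2) * card (cliques V E (s + 2))"
proof -
  have "(\<Sum>P\<in>cliques V E s. (real (card (extensions V E P)))\<^sup>2)
      = (\<Sum>Q\<in>cliques V E (Suc s). \<Sum>x\<in>Q. real (card (extensions V E (Q - {x}))))"
    using sum_cliques_remove[OF V E, where s = s and g = "\<lambda>P. real (card (extensions V E P))"]
    by (simp add: power2_eq_square)
  also have "\<dots> \<le> (\<Sum>Q\<in>cliques V E (Suc s). real (card (near_extensions V E Q)) + s * real (card (extensions V E Q)))"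
  proof (rule sum_mono)
    fix Q assume Q: "Q \<in> cliques V E (Suc s)"
    then have "card Q = Suc s" by (simp add: cliques_def)
    then have "(\<Sum>x\<in>Q. card (extensions V E (Q - {x}))) \<le> card (near_extensions V E Q) + s * card (extensions V E Q)"
      by (intro sum_card_extensions_remove_le[OF V cliques_finite[OF V Q]])
    then show "(\<Sum>x\<in>Q. real (card (extensions V E (Q - {x})))) \<le> real (card (near_extensions V E Q)) + s * real (card (extensions V E Q))"
      by (metis of_nat_add of_nat_le_iff of_nat_mult of_nat_sum)
  qed
  also have "\<dots> = (\<Sum>Q\<in>cliques V E (Suc s). real (card (near_extensions V E Q))) +
      s * (real (Suc (Suc s)) * card (cliques V E (Suc (Suc s))))"
    by (simp only: sum.distrib sum_distrib_left[symmetric] sum_card_extensions[OF V E])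
  finally show ?thesis by (simp add: algebra_simps)
qed

text \<open>Counting cliques with an ordering removes the factors \<open>s\<^sup>2\<close> from the Moon-Moser inequality.\<close>

definition ordered_cliques :: "'a set \<Rightarrow> 'a set set \<Rightarrow> nat \<Rightarrow> real" where
  "ordered_cliques V E s = fact s * real (card (cliques V E s))"

lemma ordered_cliques_nonneg: "ordered_cliques V E s \<ge> 0"
  by (simp add: ordered_cliques_def)

lemma ordered_cliques_0: "finite V \<Longrightarrow> ordered_cliques V E 0 = 1"
  by (simp add: ordered_cliques_def cliques_0)

lemma ordered_cliques_Suc:
  assumes "finite V" "loopless E"
  shows "ordered_cliques V E (Suc s) = fact s * (\<Sum>P\<in>cliques V E s. real (card (extensions V E P)))"
  unfolding sum_card_extensions[OF assms] by (simp add: ordered_cliques_def algebra_simps)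

lemma ordered_cliques_Suc_le:
  assumes "finite V" "loopless E"
  shows "ordered_cliques V E (Suc s) \<le> card V * ordered_cliques V E s"
proof -
  have "(\<Sum>P\<in>cliques V E s. real (card (extensions V E P))) \<le> (\<Sum>P\<in>cliques V E s. real (card V))"
    by (rule sum_mono) (simp add: card_extensions_le assms)
  then show ?thesis unfolding ordered_cliques_Suc[OF assms] by (simp add: ordered_cliques_def algebra_simps)
qed

lemma ordered_cliques_sq_le:
  assumes V: "finite V" and E: "loopless E"
  shows "(ordered_cliques V E (Suc s))\<^sup>2 \<le> ordered_cliques V E s * (fact s * (\<Sum>P\<in>cliques V E s. (real (card (extensions V E P)))\<^sup>2))"
proof -
  have "(\<Sum>P\<in>cliques V E s. real (card (extensions V E P)))\<^sup>2 \<le>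
      real (card (cliques V E s)) * (\<Sum>P\<in>cliques V E s. (real (card (extensions V E P)))\<^sup>2)"
    using sum_squared_le_sum_of_squares[of "\<lambda>P. real (card (extensions V E P))" "cliques V E s"]
    by (cases "cliques V E s = {}") (auto simp: V field_simps mult.commute)
  then have "(fact s)\<^sup>2 * (\<Sum>P\<in>cliques V E s. real (card (extensions V E P)))\<^sup>2 \<le>
      (fact s)\<^sup>2 * (real (card (cliques V E s)) * (\<Sum>P\<in>cliques V E s. (real (card (extensions V E P)))\<^sup>2))"
    by (intro mult_left_mono) auto
  then show ?thesis unfolding ordered_cliques_Suc[OF assms]
    by (simp add: ordered_cliques_def power2_eq_square algebra_simps)
qed

text \<open>Cauchy-Schwarz bounds the sum of squared extension numbers from below, the facet count
  bounds it from above with \<open>near_extensions\<close> estimated by all of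
  \<open>V\<close>.\<close>

lemma moon_moser:
  assumes V: "finite V" and E: "loopless E"
  shows "real (Suc s) * (ordered_cliques V E (Suc s))\<^sup>2 \<le> ordered_cliques V E s * (card V * ordered_cliques V E (Suc s) + s * ordered_cliques V E (s + 2))"
proof -
  have "(\<Sum>Q\<in>cliques V E (Suc s). real (card (near_extensions V E Q))) \<le> (\<Sum>Q\<in>cliques V E (Suc s). real (card V))"
    by (rule sum_mono) (simp add: card_near_extensions_le V)
  then have "(\<Sum>P\<in>cliques V E s. (real (card (extensions V E P)))\<^sup>2) \<le>
     card V * card (cliques V E (Suc s)) + s * real (s + 2) * card (cliques V E (s + 2))"
    using sum_card_extensions_sq[OF V E, of s] by (simp add: mult.commute)
  then have "fact (Suc s) * (\<Sum>P\<in>cliques V E s. (real (card (extensions V E P)))\<^sup>2) \<le>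
     fact (Suc s) * (card V * card (cliques V E (Suc s)) + s * real (s + 2) * card (cliques V E (s + 2)))"
    by (intro mult_left_mono) auto
  also have "\<dots> = card V * ordered_cliques V E (Suc s) + s * ordered_cliques V E (s + 2)"
    by (simp add: ordered_cliques_def algebra_simps)
  finally have *: "ordered_cliques V E s * (fact (Suc s) * (\<Sum>P\<in>cliques V E s. (real (card (extensions V E P)))\<^sup>2)) \<le>
    ordered_cliques V E s * (card V * ordered_cliques V E (Suc s) + s * ordered_cliques V E (s + 2))"
    by (intro mult_left_mono) (auto simp: ordered_cliques_nonneg)
  have "real (Suc s) * (ordered_cliques V E (Suc s))\<^sup>2 \<le> 
     real (Suc s) * (ordered_cliques V E s * (fact s * (\<Sum>P\<in>cliques V E s. (real (card (extensions V E P)))\<^sup>2)))"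
    using ordered_cliques_sq_le[OF assms, of s] by (intro mult_left_mono) auto
  with * show ?thesis by (simp add: algebra_simps)
qed

text \<open>With \<open>q s\<close> the ratio of consecutive ordered clique densities, the Moon-Moser inequality says
  that \<open>(1 - q s) / s\<close> decreases in \<open>s\<close>. If the density of \<open>k\<close>-cliques is large, then
  \<open>1 - q s \<le> s * \<theta>\<close> for some \<open>s < k\<close>, hence also for all larger \<open>s\<close>.\<close>

lemma ordered_cliques_growth:
  fixes \<theta> :: real
  assumes V: "finite V" and E: "loopless E" and \<theta>: "\<theta> > 0" "(real k - 1) * \<theta> \<le> 1"
    and big: "ordered_cliques V E k > (\<Prod>s<k. 1 - real s * \<theta>) * card V ^ k"
    and j: "k \<le> Suc j" "real j * \<theta> < 1"
  shows "ordered_cliques V E (Suc j) \<ge> (1 - real j * \<theta>) * card V * ordered_cliques V E j \<and> ordered_cliques V E (Suc j) > 0"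
proof -
  let ?n = "real (card V)"
  have "\<exists>s<k. ordered_cliques V E (Suc s) > (1 - real s * \<theta>) * ?n * ordered_cliques V E s"
  proof (rule ccontr)
    assume "\<not> ?thesis"
    then have le: "ordered_cliques V E (Suc s) \<le> (1 - real s * \<theta>) * ?n * ordered_cliques V E s" if "s < k" for s
      using that by force
    have "ordered_cliques V E i \<le> (\<Prod>s<i. 1 - real s * \<theta>) * ?n ^ i" if "i \<le> k" for i
      using that
    proof (induction i)
      case 0
      then show ?case by (simp add: ordered_cliques_0 V)
    next
      case (Suc i)
      have "real i * \<theta> \<le> (real k - 1) * \<theta>" using Suc.prems \<theta> by (intro mult_right_mono) auto
      then have nn: "0 \<le> 1 - real i * \<theta>" using \<theta> by linarith
      have "ordered_cliques V E (Suc i) \<le> (1 - real i * \<theta>) * ?n * ordered_cliques V E i" using le Suc by simp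
      also have "\<dots> \<le> (1 - real i * \<theta>) * ?n * ((\<Prod>s<i. 1 - real s * \<theta>) * ?n ^ i)"
        using Suc nn by (intro mult_left_mono) auto
      finally show ?case by (simp add: mult_ac)
    qed
    then show False using big by force
  qed
  then obtain s where s: "s < k" and gs: "ordered_cliques V E (Suc s) > (1 - real s * \<theta>) * ?n * ordered_cliques V E s" by blast
  \<comment> \<open>At index \<open>0\<close> the ratio is exactly \<open>card V\<close>, which the
    strict inequality excludes. A positive index is needed since Moon-Moser bounds the next clique
    count only through its multiple by the index.\<close>
  have s0: "s \<noteq> 0"
  proof
    assume "s = 0"
    then show False using gs by (simp add: ordered_cliques_def card_cliques_1 cliques_0 V)
  qed
  have growth: "ordered_cliques V E (Suc (Suc i)) \<ge> (1 - real (Suc i) * \<theta>) * ?n * ordered_cliques V E (Suc i)"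
    if i: "i \<ge> 1" "ordered_cliques V E (Suc i) \<ge> (1 - real i * \<theta>) * ?n * ordered_cliques V E i" "ordered_cliques V E (Suc i) > 0" for i
  proof (rule ccontr)
    assume neg: "\<not> ?thesis"
    have pos: "ordered_cliques V E i > 0"
    proof (rule ccontr)
      assume "\<not> ordered_cliques V E i > 0"
      then have "ordered_cliques V E i = 0" using ordered_cliques_nonneg[of V E i] by linarith
      then show False using ordered_cliques_Suc_le[OF V E, of i] i(3) by simp
    qed
    have "ordered_cliques V E i * (?n * ordered_cliques V E (Suc i) + i * ordered_cliques V E (Suc (Suc i)))
        < ordered_cliques V E i * (?n * ordered_cliques V E (Suc i) + i * ((1 - real (Suc i) * \<theta>) * ?n * ordered_cliques V E (Suc i)))"
      using neg i pos by (intro mult_strict_left_mono add_strict_left_mono) auto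
    \<comment> \<open>The bound reproduces itself because
      \<open>1 + i * (1 - (i + 1) * \<theta>)\<close> factors as
      \<open>(i + 1) * (1 - i * \<theta>)\<close>.\<close>
    also have "\<dots> = (Suc i * ordered_cliques V E (Suc i)) * ((1 - real i * \<theta>) * ?n * ordered_cliques V E i)"
      by (simp add: algebra_simps)
    also have "\<dots> \<le> (Suc i * ordered_cliques V E (Suc i)) * ordered_cliques V E (Suc i)"
      using i by (intro mult_left_mono) auto
    finally show False using moon_moser[OF V E, of i] by (simp add: power2_eq_square)
  qed
  have n0: "?n > 0"
  proof (rule ccontr)
    assume "\<not> ?n > 0"
    then have "ordered_cliques V E k = 0 \<or> k = 0"
      using ordered_cliques_Suc_le[OF V E, of "k - 1"] ordered_cliques_nonneg[of V E k] by (cases k) auto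
    then show False using big s \<open>\<not> ?n > 0\<close> by (cases k) auto
  qed
  have "ordered_cliques V E (Suc i) \<ge> (1 - real i * \<theta>) * ?n * ordered_cliques V E i \<and> ordered_cliques V E (Suc i) > 0"
    if "s \<le> i" "i \<le> j" for i
    using that
  proof (induction i rule: dec_induct)
    case base
    have "real s * \<theta> \<le> (real k - 1) * \<theta>" using s \<theta> by (intro mult_right_mono) auto
    then have "0 \<le> 1 - real s * \<theta>" using \<theta> by linarith
    then have "0 \<le> (1 - real s * \<theta>) * ?n * ordered_cliques V E s"
      by (intro mult_nonneg_nonneg ordered_cliques_nonneg) auto
    then show ?case using gs by linarith
  next
    case (step i)
    then have IH: "ordered_cliques V E (Suc i) \<ge> (1 - real i * \<theta>) * ?n * ordered_cliques V E i" "ordered_cliques V E (Suc i) > 0" by auto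
    have a: "ordered_cliques V E (Suc (Suc i)) \<ge> (1 - real (Suc i) * \<theta>) * ?n * ordered_cliques V E (Suc i)"
      using step IH s0 by (intro growth) auto
    have "real (Suc i) * \<theta> \<le> real j * \<theta>" using step \<theta> by (intro mult_right_mono) auto
    then have "1 - real (Suc i) * \<theta> > 0" using j by linarith
    then have "(1 - real (Suc i) * \<theta>) * ?n * ordered_cliques V E (Suc i) > 0" using n0 IH by simp
    then show ?case using a by linarith
  qed
  then show ?thesis using j s by simp
qed

section \<open>Erdos's theorem on complete multipartite hypergraphs\<close>

text \<open>A complete \<open>r\<close>-partite pattern in a set of ordered \<open>r\<close>-tuples,
  where \<open>a i\<close> enumerates the \<open>s\<close> values of coordinate \<open>i\<close>.
  Ordered tuples let an induction split off the head. Disjointness of the parts comes later from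
  adjacency between them.\<close>

definition box :: "nat \<Rightarrow> nat \<Rightarrow> 'b set \<Rightarrow> 'b list set \<Rightarrow> (nat \<Rightarrow> nat \<Rightarrow> 'b) \<Rightarrow> bool" where
  "box r s V R a \<longleftrightarrow> (\<forall>i<r. inj_on (a i) {..<s} \<and> a i ` {..<s} \<subseteq> V) \<and>
     (\<forall>f. (\<forall>i<r. f i < s) \<longrightarrow> map (\<lambda>i. a i (f i)) [0..<r] \<in> R)"

text \<open>Induction on \<open>r\<close>: choose \<open>m\<close> first coordinates of large degree; averaging and the pigeonhole
  principle over subsets of these give many tails with \<open>s\<close> common first coordinates.\<close>

lemma erdos_box:
  fixes \<gamma> :: real and r s :: nat
  assumes "\<gamma> > 0"
  shows "\<exists>n0. \<forall>(V :: 'b set) R. finite V \<longrightarrow> card V \<ge> n0 \<longrightarrow>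
    (R \<subseteq> {xs. set xs \<subseteq> V \<and> length xs = r} \<longrightarrow> card R \<ge> \<gamma> * real (card V) ^ r \<longrightarrow>
      (\<exists>a. box r s V R a))"
  using assms
proof (induction r arbitrary: \<gamma>)
  case 0
  have "[] \<in> R" if "R \<subseteq> {xs. set xs \<subseteq> V \<and> length xs = 0}" "real (card R) \<ge> \<gamma> * real (card V) ^ 0"
    for V :: "'b set" and R
  proof (rule ccontr)
    assume "[] \<notin> R"
    then have "R = {}" using that by auto
    then show False using that 0 by simp
  qed
  then have "\<exists>a. box 0 s V R a" if "R \<subseteq> {xs. set xs \<subseteq> V \<and> length xs = 0}" "real (card R) \<ge> \<gamma> * real (card V) ^ 0"
    for V :: "'b set" and R
    using that by (simp add: box_def)
  then show ?case by meson
next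
  case (Suc r)
  \<comment> \<open>Tails with fewer than \<open>s\<close> of the \<open>m\<close> heads then
    account for at most half of the lower bound \<open>m * (\<gamma> / 2 * n ^ r)\<close>.\<close>
  define m where "m = nat \<lceil>4 * real s / \<gamma>\<rceil> + 1"
  have m: "real s \<le> m * \<gamma> / 4" "m \<ge> 1"
  proof -
    have "4 * real s / \<gamma> \<le> m" unfolding m_def by linarith
    then show "real s \<le> m * \<gamma> / 4" using Suc.prems by (simp add: field_simps)
  qed (simp add: m_def)
  \<comment> \<open>The density \<open>\<gamma> / 4\<close> of the useful tails is shared among the
    \<open>2 ^ m\<close> subsets of the chosen heads.\<close>
  define \<gamma>' where "\<gamma>' = \<gamma> / 4 / 2 ^ m"
  have \<gamma>': "\<gamma>' > 0" using Suc.prems by (simp add: \<gamma>'_def)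
  obtain n1 where n1: "\<And>(V :: 'b set) R. finite V \<Longrightarrow> card V \<ge> n1 \<Longrightarrow>
    R \<subseteq> {xs. set xs \<subseteq> V \<and> length xs = r} \<Longrightarrow> card R \<ge> \<gamma>' * real (card V) ^ r \<Longrightarrow>
      (\<exists>a. box r s V R a)"
    using Suc.IH[OF \<gamma>'] by blast
  define n0 where "n0 = max n1 (max 1 (nat \<lceil>2 * real m / \<gamma>\<rceil>))"
  show ?case
  proof (intro exI[of _ n0] allI impI)
    fix V :: "'b set" and R
    assume V: "finite V" "n0 \<le> card V" and R: "R \<subseteq> {xs. set xs \<subseteq> V \<and> length xs = Suc r}"
      and big: "real (card R) \<ge> \<gamma> * real (card V) ^ Suc r"
    define n where "n = real (card V)"
    have n: "n \<ge> 1" "card V \<ge> n1" using V(2) by (auto simp: n0_def n_def)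
    have nm: "\<gamma> / 2 * n \<ge> m"
    proof -
      have "2 * real m / \<gamma> \<le> n" using V(2) unfolding n0_def n_def by linarith
      then show ?thesis using Suc.prems by (simp add: field_simps)
    qed
    define L where "L = {xs. set xs \<subseteq> V \<and> length xs = r}"
    have L: "finite L" "real (card L) = n ^ r"
      using finite_lists_length_eq[OF V(1)] card_lists_length_eq[OF V(1)] by (auto simp: L_def n_def)
    define D where "D x = {ys \<in> L. x # ys \<in> R}" for x
    have D: "finite (D x)" "D x \<subseteq> L" for x using L by (auto simp: D_def)
    have cD: "real (card (D x)) \<le> n ^ r" for x using card_mono[OF L(1) D(2), of x] L(2) by linarith
    have "R = (\<Union>x\<in>V. (\<lambda>ys. x # ys) ` D x)"
      using R by (auto simp: D_def L_def image_iff length_Suc_conv subset_iff)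
    then have "card R = (\<Sum>x\<in>V. card ((\<lambda>ys. x # ys) ` D x))"
      using V D by (simp only:) (rule card_UN_disjoint, auto)
    then have cR: "card R = (\<Sum>x\<in>V. card (D x))" by (simp add: card_image)
    define X0 where "X0 = {x \<in> V. real (card (D x)) \<ge> \<gamma> / 2 * n ^ r}"
    have X0: "finite X0" "X0 \<subseteq> V" using V by (auto simp: X0_def)
    have "real (card R) = (\<Sum>x\<in>X0. real (card (D x))) + (\<Sum>x\<in>V - X0. real (card (D x)))"
      unfolding cR using sum.subset_diff[OF X0(2) V(1), of "\<lambda>x. real (card (D x))"] by simp
    also have "\<dots> \<le> (\<Sum>x\<in>X0. n ^ r) + (\<Sum>x\<in>V - X0. \<gamma> / 2 * n ^ r)"
      using cD by (intro add_mono sum_mono) (auto simp: X0_def)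
    also have "\<dots> \<le> card X0 * n ^ r + n * (\<gamma> / 2 * n ^ r)"
      using Suc.prems n V(1) by (auto simp: n_def intro!: mult_right_mono card_mono)
    finally have "\<gamma> * n ^ Suc r \<le> card X0 * n ^ r + n * (\<gamma> / 2 * n ^ r)" using big by (simp add: n_def)
    then have "(\<gamma> / 2 * n) * n ^ r \<le> card X0 * n ^ r" by (simp add: algebra_simps)
    then have "\<gamma> / 2 * n \<le> card X0" using n by (simp add: mult_le_cancel_right)
    then have "m \<le> card X0" using nm by linarith
    then obtain X where X: "X \<subseteq> X0" "card X = m" "finite X" using obtain_subset_with_card_n by metis
    define N where "N ys = {x \<in> X. x # ys \<in> R}" for ys
    have N: "finite (N ys)" "N ys \<subseteq> X" for ys using X by (auto simp: N_def)
    define Y where "Y = {ys \<in> L. card (N ys) \<ge> s}"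
    have Y: "finite Y" "Y \<subseteq> L" using L by (auto simp: Y_def)
    have "(\<Sum>x\<in>X. card (D x)) = (\<Sum>ys\<in>L. card (N ys))"
    proof -
      have "(\<Sum>x\<in>X. card (D x)) = (\<Sum>x\<in>X. \<Sum>ys\<in>L. if x # ys \<in> R then 1 else 0)"
        using L by (simp add: D_def sum.If_cases Int_def)
      also have "\<dots> = (\<Sum>ys\<in>L. \<Sum>x\<in>X. if x # ys \<in> R then 1 else 0)" by (rule sum.swap)
      also have "\<dots> = (\<Sum>ys\<in>L. card (N ys))" using X by (simp add: N_def sum.If_cases Int_def)
      finally show ?thesis .
    qed
    moreover have "real m * (\<gamma> / 2 * n ^ r) \<le> (\<Sum>x\<in>X. real (card (D x)))"
      using sum_bounded_below[of X "\<gamma> / 2 * n ^ r" "\<lambda>x. real (card (D x))"] X by (auto simp: X0_def)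
    ultimately have "real m * (\<gamma> / 2 * n ^ r) \<le> (\<Sum>ys\<in>L. real (card (N ys)))"
      by (metis of_nat_sum)
    also have "\<dots> = (\<Sum>ys\<in>Y. real (card (N ys))) + (\<Sum>ys\<in>L - Y. real (card (N ys)))"
      using sum.subset_diff[OF Y(2) L(1), of "\<lambda>x. real (card (N x))"] by simp
    also have "\<dots> \<le> (\<Sum>ys\<in>Y. real m) + (\<Sum>ys\<in>L - Y. m * \<gamma> / 4)"
    proof (intro add_mono sum_mono)
      fix ys show "real (card (N ys)) \<le> real m" using card_mono[OF X(3) N(2)] X by simp
    next
      fix ys assume "ys \<in> L - Y"
      then have "card (N ys) < s" by (auto simp: Y_def)
      then show "real (card (N ys)) \<le> m * \<gamma> / 4" using m by linarith
    qed
    also have "\<dots> \<le> card Y * m + n ^ r * (m * \<gamma> / 4)"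
      unfolding L(2)[symmetric] using Suc.prems L(1)
      by (auto intro!: mult_right_mono card_mono)
    finally have "real m * (\<gamma> / 4 * n ^ r) \<le> m * card Y" by (simp add: algebra_simps)
    then have cY: "\<gamma> / 4 * n ^ r \<le> card Y" using m by (simp add: mult_le_cancel_left)
    have "\<exists>S\<in>Pow X. \<gamma>' * n ^ r \<le> card {ys \<in> Y. N ys = S}"
    proof (rule ccontr)
      assume "\<not> ?thesis"
      then have lt: "card {ys \<in> Y. N ys = S} < \<gamma>' * n ^ r" if "S \<in> Pow X" for S using that by (meson not_le)
      have "Y = (\<Union>S\<in>Pow X. {ys \<in> Y. N ys = S})" using N(2) by blast
      then have "card Y \<le> (\<Sum>S\<in>Pow X. card {ys \<in> Y. N ys = S})"
        using card_UN_le[of "Pow X" "\<lambda>S. {ys \<in> Y. N ys = S}"] X by simp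
      then have "real (card Y) \<le> (\<Sum>S\<in>Pow X. real (card {ys \<in> Y. N ys = S}))"
        unfolding of_nat_sum[symmetric] of_nat_le_iff .
      also have "\<dots> < (\<Sum>S\<in>Pow X. \<gamma>' * n ^ r)"
        using X lt by (intro sum_strict_mono) auto
      also have "\<dots> = \<gamma> / 4 * n ^ r" using X by (simp add: card_Pow \<gamma>'_def)
      finally show False using cY by simp
    qed
    then obtain S where S: "S \<subseteq> X" "\<gamma>' * n ^ r \<le> card {ys \<in> Y. N ys = S}" by auto
    let ?R' = "{ys \<in> Y. N ys = S}"
    have "0 < \<gamma>' * n ^ r" using \<gamma>' n by simp
    then have "?R' \<noteq> {}" using S(2) by (metis card.empty not_le of_nat_0)
    then have "s \<le> card S" by (auto simp: Y_def)
    then obtain T where T: "T \<subseteq> S" "card T = s" "finite T" using obtain_subset_with_card_n by metis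
    have TV: "T \<subseteq> V" using T S X X0 by blast
    obtain a0 where a0: "bij_betw a0 {..<s} T"
      using T by (metis bij_betw_iff_card card_lessThan finite_lessThan)
    have R': "?R' \<subseteq> {xs. set xs \<subseteq> V \<and> length xs = r}" using Y(2) unfolding L_def by blast
    have "\<exists>a'. box r s V ?R' a'"
      using n1[OF V(1) n(2) R'] S(2) by (simp add: n_def)
    then obtain a' where "box r s V ?R' a'" by blast
    then have a': "\<forall>i<r. inj_on (a' i) {..<s} \<and> a' i ` {..<s} \<subseteq> V"
      "\<forall>f. (\<forall>i<r. f i < s) \<longrightarrow> map (\<lambda>i. a' i (f i)) [0..<r] \<in> ?R'"
      by (simp_all add: box_def)
    let ?a = "case_nat a0 a'"
    show "\<exists>a. box (Suc r) s V R a"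
      unfolding box_def
    proof (intro exI[of _ ?a] conjI allI impI)
      fix i assume "i < Suc r"
      then show "inj_on (?a i) {..<s}" using a' a0 by (auto simp: bij_betw_def split: nat.split)
      show "?a i ` {..<s} \<subseteq> V" using a'(1) a0 TV \<open>i < Suc r\<close>
        by (cases i) (auto simp: bij_betw_def)
    next
      fix f :: "nat \<Rightarrow> nat" assume f: "\<forall>i<Suc r. f i < s"
      have tl: "map (\<lambda>i. a' i (f (Suc i))) [0..<r] \<in> ?R'"
        using a'(2) f by auto
      have "a0 (f 0) \<in> S" using a0 f T by (auto simp: bij_betw_def)
      then have "a0 (f 0) # map (\<lambda>i. a' i (f (Suc i))) [0..<r] \<in> R" using tl by (auto simp: N_def)
      moreover have "map (\<lambda>i. ?a i (f i)) [0..<Suc r] = a0 (f 0) # map (\<lambda>i. a' i (f (Suc i))) [0..<r]"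
        by (simp add: upt_conv_Cons map_Suc_upt[symmetric] del: upt_Suc)
      ultimately show "map (\<lambda>i. ?a i (f i)) [0..<Suc r] \<in> R" by simp
    qed
  qed
qed

definition clique_box ::
    "nat \<Rightarrow> nat \<Rightarrow> 'b set \<Rightarrow> 'b set set \<Rightarrow> 'b set set \<Rightarrow> (nat \<Rightarrow> nat \<Rightarrow> 'b) \<Rightarrow> bool" where
  "clique_box r s V E \<Q> a \<longleftrightarrow> (\<forall>i<r. inj_on (a i) {..<s} \<and> a i ` {..<s} \<subseteq> V) \<and>
     (\<forall>f. (\<forall>i<r. f i < s) \<longrightarrow> (\<lambda>i. a i (f i)) ` {..<r} \<in> \<Q>) \<and>
     (\<forall>i<r. \<forall>i'<r. \<forall>j<s. \<forall>j'<s. i \<noteq> i' \<longrightarrow> {a i j, a i' j'} \<in> E)"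

lemma clique_boxD:
  assumes "clique_box r s V E \<Q> a" "i < r"
  shows "inj_on (a i) {..<s}" "a i ` {..<s} \<subseteq> V"
    "\<And>j. j < s \<Longrightarrow> (\<lambda>i. a i j) ` {..<r} \<in> \<Q>"
    "\<And>i' j j'. i' < r \<Longrightarrow> j < s \<Longrightarrow> j' < s \<Longrightarrow> i \<noteq> i' \<Longrightarrow> {a i j, a i' j'} \<in> E"
  using assms unfolding clique_box_def by simp_all

text \<open>Every clique of \<open>\<Q>\<close> has an enumeration as a tuple, so passing to tuples
  does not lower the count. Vertices from two different parts lie in a common transversal, which is
  a clique with \<open>r\<close> members; so they are distinct and adjacent.\<close>

lemma erdos_cliques:
  fixes \<gamma> :: real and r s :: nat
  assumes "\<gamma> > 0"
  shows "\<exists>n0. \<forall>(V :: 'b set) E \<Q>. finite V \<longrightarrow> card V \<ge> n0 \<longrightarrow> loopless E \<longrightarrow> \<Q> \<subseteq> cliques V E r \<longrightarrow>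
    card \<Q> \<ge> \<gamma> * real (card V) ^ r \<longrightarrow>
      (\<exists>a. clique_box r s V E \<Q> a)"
proof -
  obtain n0 where n0: "\<And>(V :: 'b set) R. finite V \<Longrightarrow> card V \<ge> n0 \<Longrightarrow>
    R \<subseteq> {xs. set xs \<subseteq> V \<and> length xs = r} \<Longrightarrow> card R \<ge> \<gamma> * real (card V) ^ r \<Longrightarrow>
      (\<exists>a. box r s V R a)"
    using erdos_box[OF assms, of r s] by blast
  show ?thesis
  proof (intro exI[of _ n0] allI impI)
    fix V :: "'b set" and E \<Q>
    assume V: "finite V" "n0 \<le> card V" and E: "loopless E" and Q: "\<Q> \<subseteq> cliques V E r"
      "\<gamma> * real (card V) ^ r \<le> card \<Q>"
    let ?R = "{xs. set xs \<in> \<Q> \<and> length xs = r}"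
    have R: "?R \<subseteq> {xs. set xs \<subseteq> V \<and> length xs = r}" using Q by (auto simp: cliques_def)
    have "\<Q> \<subseteq> set ` ?R"
    proof
      fix Q assume Q': "Q \<in> \<Q>"
      then have Q'': "Q \<in> cliques V E r" using Q by blast
      then have "finite Q" "card Q = r" using cliques_finite[OF V(1) Q''] by (auto simp: cliques_def)
      then obtain xs where "set xs = Q" "length xs = r" by (metis distinct_card finite_distinct_list)
      then show "Q \<in> set ` ?R" using Q' by auto
    qed
    moreover have fR: "finite ?R" using finite_lists_length_eq[OF V(1)] R by (rule finite_subset[rotated])
    ultimately have "card \<Q> \<le> card (set ` ?R)" by (intro card_mono finite_imageI)
    also have "\<dots> \<le> card ?R" by (rule card_image_le[OF fR])
    finally have "card \<Q> \<le> card ?R" .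
    then have "\<gamma> * real (card V) ^ r \<le> card ?R" using Q(2) by linarith
    from n0[OF V R this] obtain a where "box r s V ?R a" by blast
    then have a: "\<forall>i<r. inj_on (a i) {..<s} \<and> a i ` {..<s} \<subseteq> V"
      "\<forall>i<r. f i < s \<Longrightarrow> map (\<lambda>i. a i (f i)) [0..<r] \<in> ?R" for f by (simp_all add: box_def)
    have tr: "(\<lambda>i. a i (f i)) ` {..<r} \<in> \<Q>" if "\<forall>i<r. f i < s" for f
      using a(2)[OF that] by (simp add: atLeast0LessThan)
    show "\<exists>a. clique_box r s V E \<Q> a"
      unfolding clique_box_def
    proof (intro exI[of _ a] conjI allI impI)
      fix i i' j j' assume ij: "i < r" "i' < r" "j < s" "j' < s" "i \<noteq> i'"
      let ?f = "\<lambda>l. if l = i then j else j'"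
      let ?Q = "(\<lambda>i. a i (?f i)) ` {..<r}"
      have "?Q \<in> cliques V E r" using tr[of ?f] ij Q by auto
      then have Q: "card ?Q = r" "\<forall>x\<in>?Q. \<forall>y\<in>?Q. x \<noteq> y \<longrightarrow> {x, y} \<in> E"
        unfolding cliques_def by auto
      have inj: "inj_on (\<lambda>i. a i (?f i)) {..<r}" by (rule eq_card_imp_inj_on) (use Q in auto)
      then have "a i (?f i) \<noteq> a i' (?f i')" using inj_onD[OF inj, of i i'] ij by auto
      moreover have "a i (?f i) \<in> ?Q" "a i' (?f i') \<in> ?Q" using ij(1,2) by blast+
      ultimately have "{a i (?f i), a i' (?f i')} \<in> E" using Q(2) by blast
      then show "{a i j, a i' j'} \<in> E" using ij by auto
    qed (use a tr in auto)
  qed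
qed

section \<open>Embedding graphs with a colour-critical vertex\<close>

definition embeds :: "'a hypergraph \<Rightarrow> 'b set \<Rightarrow> 'b set set \<Rightarrow> bool" where
  "embeds F V E \<longleftrightarrow>
    (\<exists>\<phi>. inj_on \<phi> (verts F) \<and> \<phi> ` verts F \<subseteq> V \<and> (\<forall>e\<in>edges F. \<phi> ` e \<in> E))"

lemma embeds_mono: "embeds F V E \<Longrightarrow> E \<subseteq> E' \<Longrightarrow> embeds F V E'"
  unfolding embeds_def by blast

lemma graph_edge:
  assumes "graph F" "e \<in> edges F"
  obtains x y where "e = {x, y}" "x \<noteq> y" "x \<in> verts F" "y \<in> verts F"
proof -
  have "card e = 2" "e \<subseteq> verts F" using assms by (auto simp: graph_def uniform_def hypergraph_def)
  then obtain x y where "e = {x, y}" "x \<noteq> y" by (auto simp: card_2_iff)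
  then show ?thesis using that \<open>e \<subseteq> verts F\<close> by auto
qed

lemma graph_finite: "graph F \<Longrightarrow> finite (verts F)"
  by (simp add: graph_def uniform_def hypergraph_def)

lemma graph_free_iff_embeds:
  assumes F: "graph F" and "finite V" and E: "\<And>e. e \<in> E \<Longrightarrow> e \<subseteq> V"
  shows "graph_free F (V, E) \<longleftrightarrow> \<not> embeds F V E"
proof -
  have "embeds F V E" if "subhypergraph S (V, E)" "isomorphic F S" for S :: "'b hypergraph"
  proof -
    obtain f where f: "bij_betw f (verts F) (verts S)" "(\<lambda>e. f ` e) ` edges F = edges S"
      using \<open>isomorphic F S\<close> by (auto simp: isomorphic_def)
    show ?thesis unfolding embeds_def using f that(1)
      by (intro exI[of _ f]) (auto simp: bij_betw_def subhypergraph_def)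
  qed
  moreover have "\<exists>S. subhypergraph S (V, E) \<and> isomorphic F S" if em: "embeds F V E"
  proof -
    obtain \<phi> where \<phi>: "inj_on \<phi> (verts F)" "\<phi> ` verts F \<subseteq> V" "\<forall>e\<in>edges F. \<phi> ` e \<in> E"
      using em unfolding embeds_def by blast
    let ?S = "(\<phi> ` verts F, (\<lambda>e. \<phi> ` e) ` edges F)"
    have "hypergraph ?S" using F by (auto simp: hypergraph_def graph_def uniform_def)
    then have "subhypergraph ?S (V, E)" using \<phi> by (auto simp: subhypergraph_def)
    moreover have "isomorphic F ?S" unfolding isomorphic_def
      using \<phi> by (intro exI[of _ \<phi>]) (auto simp: bij_betw_def)
    ultimately show ?thesis by blast
  qed
  ultimately show ?thesis unfolding graph_free_def by blast
qed

text \<open>The critical vertex goes to \<open>x0\<close> and each colour class of the rest goes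
  into its own \<open>M i\<close>. That these sets are disjoint and avoid \<open>x0\<close> follows
  from the adjacencies, as \<open>E\<close> is loopless.\<close>

lemma embeds_multipartite:
  fixes F :: "'a hypergraph" and E :: "'b set set"
  assumes F: "graph F" "card (verts F) \<le> t" and v: "v \<in> verts F" "colorable (delete_vertex F v) r"
    and E: "loopless E" and x0: "x0 \<in> V" and M: "\<And>i. i < r \<Longrightarrow> M i \<subseteq> V"
      "\<And>i. i < r \<Longrightarrow> finite (M i)" "\<And>i. i < r \<Longrightarrow> t \<le> card (M i)"
    and xM: "\<And>i y. i < r \<Longrightarrow> y \<in> M i \<Longrightarrow> {x0, y} \<in> E"
    and MM: "\<And>i i' y y'. i < r \<Longrightarrow> i' < r \<Longrightarrow> i \<noteq> i' \<Longrightarrow> y \<in> M i \<Longrightarrow> y' \<in> M i' \<Longrightarrow> {y, y'} \<in> E"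
  shows "embeds F V E"
proof -
  obtain f :: "'a \<Rightarrow> nat" where f: "\<And>u. u \<in> verts F - {v} \<Longrightarrow> f u < r"
    "\<And>a b. {a, b} \<in> edges F \<Longrightarrow> v \<notin> {a, b} \<Longrightarrow> f a \<noteq> f b"
    using v(2) unfolding colorable_def delete_vertex_def by auto
  define C where "C i = {u \<in> verts F - {v}. f u = i}" for i
  have "\<exists>g. g ` C i \<subseteq> M i \<and> inj_on g (C i)" if "i < r" for i
  proof (rule card_le_inj)
    show "finite (C i)" using graph_finite[OF F(1)] by (simp add: C_def)
    have "card (C i) \<le> card (verts F)"
      by (rule card_mono) (use graph_finite[OF F(1)] in \<open>auto simp: C_def\<close>)
    then show "card (C i) \<le> card (M i)" using F(2) M(3)[OF that] by linarith
  qed (use M that in auto)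
  then obtain g where g: "\<And>i. i < r \<Longrightarrow> g i ` C i \<subseteq> M i" "\<And>i. i < r \<Longrightarrow> inj_on (g i) (C i)" by metis
  define \<phi> where "\<phi> u = (if u = v then x0 else g (f u) u)" for u
  have \<phi>v: "\<phi> v = x0" by (simp add: \<phi>_def)
  have \<phi>M: "\<phi> u \<in> M (f u)" if "u \<in> verts F" "u \<noteq> v" for u
    using g(1)[of "f u"] f(1)[of u] that by (auto simp: \<phi>_def C_def)
  have edge: "{\<phi> a, \<phi> b} \<in> E"
    if ab: "{a, b} \<in> edges F" "a \<in> verts F" "b \<in> verts F" "a \<noteq> b" for a b
  proof (cases "v \<in> {a, b}")
    case True
    then show ?thesis
      using xM[of "f a" "\<phi> a"] xM[of "f b" "\<phi> b"] \<phi>M[of a] \<phi>M[of b] f(1)[of a] f(1)[of b] ab \<phi>v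
      by (auto simp: insert_commute)
  next
    case False
    then show ?thesis using MM[of "f a" "f b" "\<phi> a" "\<phi> b"] \<phi>M[of a] \<phi>M[of b] f(1)[of a] f(1)[of b]
      f(2)[of a b] ab by auto
  qed
  have "inj_on \<phi> (verts F)"
  proof (rule inj_onI)
    fix a b assume ab: "a \<in> verts F" "b \<in> verts F" "\<phi> a = \<phi> b"
    show "a = b"
    proof (rule ccontr)
      assume ne: "a \<noteq> b"
      consider "a = v" "b \<noteq> v" | "b = v" "a \<noteq> v" | "a \<noteq> v" "b \<noteq> v" "f a \<noteq> f b" | "a \<noteq> v" "b \<noteq> v" "f a = f b"
        using ne by blast
      then show False
      proof cases
        case 1
        then show False using xM[of "f b" "\<phi> b"] \<phi>M[of b] f(1)[of b] ab \<phi>v loopless_ne[OF E, of "\<phi> b" "\<phi> b"] by auto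
      next
        case 2
        then show False using xM[of "f a" "\<phi> a"] \<phi>M[of a] f(1)[of a] ab \<phi>v loopless_ne[OF E, of "\<phi> b" "\<phi> b"] by auto
      next
        case 3
        then show False using MM[of "f a" "f b" "\<phi> a" "\<phi> b"] \<phi>M[of a] \<phi>M[of b] f(1)[of a] f(1)[of b]
          ab loopless_ne[OF E, of "\<phi> b" "\<phi> b"] by auto
      next
        case 4
        then show False using inj_onD[OF g(2)[of "f a"], of a b] f(1)[of a] ab ne
          by (auto simp: \<phi>_def C_def)
      qed
    qed
  qed
  moreover have "\<phi> ` verts F \<subseteq> V"
  proof
    fix y assume "y \<in> \<phi> ` verts F"
    then obtain u where u: "u \<in> verts F" "y = \<phi> u" by blast
    show "y \<in> V" using u \<phi>M[of u] M(1)[of "f u"] f(1)[of u] x0 \<phi>v by (cases "u = v") auto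
  qed
  moreover have "\<phi> ` e \<in> E" if e: "e \<in> edges F" for e
  proof -
    obtain x y where "e = {x, y}" "x \<noteq> y" "x \<in> verts F" "y \<in> verts F"
      using graph_edge[OF F(1) e] .
    then show ?thesis using edge[of x y] e by simp
  qed
  ultimately show ?thesis unfolding embeds_def by blast
qed

lemma ex_colorable:
  assumes "graph F"
  shows "\<exists>c. colorable F c"
proof -
  obtain f :: "'a \<Rightarrow> nat" and n where f: "f ` verts F = {i. i < n}" "inj_on f (verts F)"
    using finite_imp_inj_to_nat_seg[OF graph_finite[OF assms]] by blast
  have "colorable F n" unfolding colorable_def
  proof (intro exI[of _ f] conjI allI impI ballI)
    fix u v assume e: "{u, v} \<in> edges F"
    then obtain x y where "{u, v} = {x, y}" "x \<noteq> y" "x \<in> verts F" "y \<in> verts F"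
      using graph_edge[OF assms] by metis
    then have "u \<in> verts F" "v \<in> verts F" "u \<noteq> v" by (auto simp: doubleton_eq_iff)
    then show "f u \<noteq> f v" using f(2) by (auto dest: inj_onD)
  qed (use f in auto)
  then show ?thesis by blast
qed

lemma colorable_mono: "colorable F c \<Longrightarrow> c \<le> d \<Longrightarrow> colorable F d"
  unfolding colorable_def by (meson order_less_le_trans)

lemma not_colorable: "c < chromatic_number F \<Longrightarrow> \<not> colorable F c"
  unfolding chromatic_number_def by (rule not_less_Least)

lemma graph_delete_vertex: "graph F \<Longrightarrow> graph (delete_vertex F v)"
  by (auto simp: graph_def uniform_def hypergraph_def delete_vertex_def)

lemma color_critical_colorable:
  assumes "graph F" "color_critical_vertex F v"
  shows "colorable (delete_vertex F v) (chromatic_number F - 1)"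
proof -
  have "colorable (delete_vertex F v) (chromatic_number (delete_vertex F v))"
    unfolding chromatic_number_def using ex_colorable[OF graph_delete_vertex[OF assms(1)]]
    by (rule LeastI_ex)
  then show ?thesis using assms(2) unfolding color_critical_vertex_def
    by (elim colorable_mono conjE) linarith
qed

text \<open>Subtracting \<open>v\<close> keeps the result loopless: the set \<open>S\<close> used
  later is built without regard to \<open>v\<close> and may contain it.\<close>

definition clone :: "'b set set \<Rightarrow> 'b \<Rightarrow> 'b set \<Rightarrow> 'b set set" where
  "clone E v S = {e \<in> E. v \<notin> e} \<union> (\<lambda>x. {v, x}) ` (S - {v})"

text \<open>In a copy of \<open>F\<close> that uses \<open>v\<close>, replace \<open>v\<close> by an old common neighbour of the images of
  its neighbours.\<close>

lemma not_embeds_clone: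
  fixes F :: "'a hypergraph" and E :: "'b set set"
  assumes F: "graph F" "card (verts F) \<le> t" and free: "\<not> embeds F V E" and V: "finite V"
    and S: "\<And>P. P \<subseteq> S \<Longrightarrow> finite P \<Longrightarrow> card P \<le> t \<Longrightarrow> t < card (extensions V E P)"
  shows "\<not> embeds F V (clone E v S)"
proof
  assume "embeds F V (clone E v S)"
  then obtain \<phi> where inj: "inj_on \<phi> (verts F)" and \<phi>V: "\<phi> ` verts F \<subseteq> V"
    and \<phi>e: "\<And>e. e \<in> edges F \<Longrightarrow> \<phi> ` e \<in> clone E v S" by (auto simp: embeds_def)
  have fin: "finite (verts F)" by (rule graph_finite[OF F(1)])
  have old: "\<phi> ` e \<in> E" if "e \<in> edges F" "v \<notin> \<phi> ` e" for e
    using \<phi>e[OF that(1)] that(2) by (auto simp: clone_def)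
  show False
  proof (cases "v \<in> \<phi> ` verts F")
    case False
    have "\<phi> ` e \<in> E" if "e \<in> edges F" for e
    proof (rule old[OF that])
      show "v \<notin> \<phi> ` e" using False graph_edge[OF F(1) that] by blast
    qed
    then show False using free inj \<phi>V unfolding embeds_def by blast
  next
    case True
    then obtain u0 where u0: "u0 \<in> verts F" "\<phi> u0 = v" by blast
    define P where "P = \<phi> ` {u \<in> verts F. {u0, u} \<in> edges F}"
    have PS: "P \<subseteq> S"
    proof
      fix y assume "y \<in> P"
      then obtain u where u: "u \<in> verts F" "{u0, u} \<in> edges F" "y = \<phi> u" by (auto simp: P_def)
      have "{v, y} \<in> clone E v S" using \<phi>e[OF u(2)] u u0 by simp
      moreover have "u \<noteq> u0" using graph_edge[OF F(1) u(2)] by (metis insert_absorb2 insert_iff singleton_iff)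
      then have "y \<noteq> v" using inj_onD[OF inj] u u0 by metis
      ultimately show "y \<in> S" by (auto simp: clone_def doubleton_eq_iff)
    qed
    have "card P \<le> card (verts F)"
      unfolding P_def using fin by (metis (no_types, lifting) card_image_le card_mono finite_subset le_trans mem_Collect_eq subsetI)
    then have "t < card (extensions V E P)" using S[OF PS] fin F by (simp add: P_def)
    moreover have "card (\<phi> ` verts F) \<le> t" using card_image_le[OF fin, of \<phi>] F by simp
    \<comment> \<open>More than \<open>t\<close> common neighbours face at most \<open>t\<close>
      occupied vertices, so one is free to take over the role of \<open>v\<close>.\<close>
    ultimately have "\<not> extensions V E P \<subseteq> \<phi> ` verts F"
      using card_mono[of "\<phi> ` verts F" "extensions V E P"] fin by auto
    then obtain w where w: "w \<in> V" "\<And>x. x \<in> P \<Longrightarrow> {x, w} \<in> E" "w \<notin> \<phi> ` verts F"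
      by (auto simp: extensions_def)
    define \<psi> where "\<psi> = \<phi>(u0 := w)"
    have "inj_on \<psi> (verts F)" unfolding \<psi>_def using inj w(3)
      by (auto simp: inj_on_def)
    moreover have "\<psi> ` verts F \<subseteq> V" using w \<phi>V by (auto simp: \<psi>_def)
    moreover have "\<psi> ` e \<in> E" if e: "e \<in> edges F" for e
    proof (cases "u0 \<in> e")
      case True
      then obtain u where u: "e = {u0, u}" "u \<noteq> u0" "u \<in> verts F"
        using graph_edge[OF F(1) e] by (metis doubleton_eq_iff insertE singletonD)
      then have "\<phi> u \<in> P" using e by (auto simp: P_def)
      then show ?thesis using w(2)[of "\<phi> u"] u by (simp add: \<psi>_def insert_commute)
    next
      case False
      then have "\<psi> ` e = \<phi> ` e" by (auto simp: \<psi>_def)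
      moreover have "v \<notin> \<phi> ` e"
      proof
        assume "v \<in> \<phi> ` e"
        then obtain u where u: "u \<in> e" "\<phi> u = v" by blast
        then have "u \<in> verts F" using graph_edge[OF F(1) e] by blast
        then show False using inj_onD[OF inj, of u u0] u u0 False by auto
      qed
      ultimately show ?thesis using old[OF e] by simp
    qed
    ultimately show False using free unfolding embeds_def by blast
  qed
qed

section \<open>Class structure around a complete multipartite skeleton\<close>

lemma card_subsets_le: "finite V \<Longrightarrow> card {Q. Q \<subseteq> V \<and> card Q = m} \<le> card V ^ m"
  by (cases "m \<le> card V") (auto simp: n_subsets binomial_le_pow binomial_eq_0)

lemma card_cliques_le: "finite V \<Longrightarrow> card (cliques V E m) \<le> card V ^ m"
  by (rule order_trans[OF card_mono card_subsets_le]) (auto simp: cliques_def)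

lemma card_cliques_meeting:
  assumes V: "finite V" and U: "U \<subseteq> V"
  shows "card {Q \<in> cliques V E (Suc m). Q \<inter> U \<noteq> {}} \<le> card U * card V ^ m"
proof -
  let ?P = "{P. P \<subseteq> V \<and> card P = m}"
  have P: "finite ?P" using V by simp
  have fU: "finite U" using V U by (rule finite_subset[rotated])
  have "{Q \<in> cliques V E (Suc m). Q \<inter> U \<noteq> {}} \<subseteq> (\<Union>u\<in>U. insert u ` ?P)"
  proof
    fix Q assume "Q \<in> {Q \<in> cliques V E (Suc m). Q \<inter> U \<noteq> {}}"
    then obtain u where Q: "Q \<in> cliques V E (Suc m)" "u \<in> Q" "u \<in> U" by blast
    then have "Q - {u} \<in> ?P" using remove_cliques(1)[OF V Q(1,2)] by (simp add: cliques_def)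
    moreover have "insert u (Q - {u}) = Q" using Q(2) by blast
    ultimately have "Q \<in> insert u ` ?P" using imageI[of "Q - {u}" ?P "insert u"] by metis
    then show "Q \<in> (\<Union>u\<in>U. insert u ` ?P)" using Q(3) by blast
  qed
  then have "card {Q \<in> cliques V E (Suc m). Q \<inter> U \<noteq> {}} \<le> card (\<Union>u\<in>U. insert u ` ?P)"
    using P fU by (intro card_mono) auto
  also have "\<dots> \<le> (\<Sum>u\<in>U. card (insert u ` ?P))" by (rule card_UN_le[OF fU])
  also have "\<dots> \<le> (\<Sum>u\<in>U. card V ^ m)"
    by (intro sum_mono order_trans[OF card_image_le[OF P] card_subsets_le[OF V]])
  finally show ?thesis by simp
qed

text \<open>Such a clique is determined by \<open>y\<close>, one of at most \<open>t\<close>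
  vertices \<open>z\<close>, and \<open>m\<close> further vertices. With \<open>D y\<close> the
  neighbours of \<open>y\<close> in its own class, cliques that repeat a class turn out to be
  rare.\<close>

lemma card_cliques_pairs:
  assumes V: "finite V" and D: "\<And>y. D y \<subseteq> V" "\<And>y. y \<in> T \<Longrightarrow> card (D y) \<le> t" and T: "T \<subseteq> V"
  shows "card {Q \<in> cliques V E (m + 2). \<exists>y\<in>Q. \<exists>z\<in>Q. z \<noteq> y \<and> y \<in> T \<and> z \<in> D y} \<le> card V * t * card V ^ m"
proof -
  let ?P = "{P. P \<subseteq> V \<and> card P = m}"
  let ?I = "Sigma T D"
  have P: "finite ?P" using V by simp
  have fD: "finite (D y)" for y using V D(1) by (rule finite_subset[rotated])
  have fT: "finite T" using V T by (rule finite_subset[rotated])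
  have fI: "finite ?I" using fD fT by blast
  have sub: "{Q \<in> cliques V E (m + 2). \<exists>y\<in>Q. \<exists>z\<in>Q. z \<noteq> y \<and> y \<in> T \<and> z \<in> D y}
      \<subseteq> (\<Union>p\<in>?I. (\<lambda>P. insert (fst p) (insert (snd p) P)) ` ?P)"
  proof clarify
    fix Q y z assume Q: "Q \<in> cliques V E (m + 2)" "y \<in> Q" "z \<in> Q" "z \<noteq> y" "y \<in> T" "z \<in> D y"
    have 1: "Q - {y} \<in> cliques V E (Suc m)" using remove_cliques(1)[OF V, of Q E "Suc m" y] Q by simp
    have "Q - {y} - {z} \<in> cliques V E m" using remove_cliques(1)[OF V 1, of z] Q by simp
    then have 2: "Q - {y} - {z} \<in> ?P" by (simp add: cliques_def)
    have "insert (fst (y, z)) (insert (snd (y, z)) (Q - {y} - {z})) = Q"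
      unfolding fst_conv snd_conv using Q by blast
    then have "Q \<in> (\<lambda>P. insert (fst (y, z)) (insert (snd (y, z)) P)) ` ?P"
      using imageI[OF 2, of "\<lambda>P. insert (fst (y, z)) (insert (snd (y, z)) P)"] by metis
    then show "Q \<in> (\<Union>p\<in>?I. (\<lambda>P. insert (fst p) (insert (snd p) P)) ` ?P)"
      using Q(5,6) by blast
  qed
  have "card {Q \<in> cliques V E (m + 2). \<exists>y\<in>Q. \<exists>z\<in>Q. z \<noteq> y \<and> y \<in> T \<and> z \<in> D y}
      \<le> card (\<Union>p\<in>?I. (\<lambda>P. insert (fst p) (insert (snd p) P)) ` ?P)"
    using P fI by (intro card_mono[OF _ sub]) auto
  also have "\<dots> \<le> (\<Sum>p\<in>?I. card ((\<lambda>P. insert (fst p) (insert (snd p) P)) ` ?P))" by (rule card_UN_le[OF fI])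
  also have "\<dots> \<le> (\<Sum>p\<in>?I. card V ^ m)"
    by (intro sum_mono order_trans[OF card_image_le[OF P] card_subsets_le[OF V]])
  also have "\<dots> = (\<Sum>y\<in>T. card (D y)) * card V ^ m" using card_SigmaI[of T D] fD fT by simp
  also have "\<dots> \<le> (\<Sum>y\<in>T. t) * card V ^ m" using D by (intro mult_le_mono1 sum_mono) auto
  also have "\<dots> \<le> card V * t * card V ^ m" using card_mono[OF V T] by simp
  finally show ?thesis .
qed

text \<open>This is the half of the hypotheses that makes \<open>F\<close> easy to embed. The other
  half, that \<open>F\<close> is not \<open>r\<close>-colourable, is a separate premise where the
  Turan graph has to be free of \<open>F\<close>.\<close>

locale critical_graph =
  fixes F :: "'a hypergraph" and t r :: nat and v0 :: 'a
  assumes F: "graph F" "card (verts F) \<le> t" and v0: "v0 \<in> verts F" "colorable (delete_vertex F v0) r"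

text \<open>The part \<open>i\<close> of a blue complete \<open>r\<close>-partite graph is \<open>a i ` {..<s}\<close>. Of its transversals
  only the \<open>s\<close> diagonal ones are used. The constant \<open>\<epsilon>\<close> will be small compared to \<open>1 / s\<close>.\<close>

locale skeleton = critical_graph F t r v0
  for F :: "'a hypergraph" and t r :: nat and v0 :: 'a +
  fixes V :: "'b set" and E B :: "'b set set" and a :: "nat \<Rightarrow> nat \<Rightarrow> 'b" and s :: nat and \<epsilon> :: real
  assumes V: "finite V" and E: "loopless E" and BE: "B \<subseteq> E" and free: "\<not> embeds F V E"
    and s: "s = t * t + 2 * t + 1"
    and inj_a: "\<And>i. i < r \<Longrightarrow> inj_on (a i) {..<s}" and aV: "\<And>i. i < r \<Longrightarrow> a i ` {..<s} \<subseteq> V"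
    and aB: "\<And>i i' j j'. i < r \<Longrightarrow> i' < r \<Longrightarrow> j < s \<Longrightarrow> j' < s \<Longrightarrow> i \<noteq> i' \<Longrightarrow> {a i j, a i' j'} \<in> B"
    and good: "\<And>j. j < s \<Longrightarrow> (1 - \<epsilon>) * card V \<le> card (near_extensions V B ((\<lambda>i. a i j) ` {..<r}))"
begin

lemma loopless_B: "loopless B"
  using E BE by (auto simp: loopless_def)

text \<open>Neighbours are recorded by their index within the part, so that different parts can be
  compared along the diagonal transversals.\<close>

definition J :: "'b \<Rightarrow> nat \<Rightarrow> nat set" where
  "J y i = {j. j < s \<and> {a i j, y} \<in> B}"

definition typical :: "'b set" where
  "typical = {y \<in> V. \<forall>j<s. y \<in> near_extensions V B ((\<lambda>i. a i j) ` {..<r})}"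

lemma finite_J [simp]: "finite (J y i)" and J_sub: "J y i \<subseteq> {..<s}"
  by (auto simp: J_def)

lemma typical_sub: "typical \<subseteq> V" by (auto simp: typical_def)

lemma finite_typical [simp]: "finite typical" using typical_sub V by (rule finite_subset)

lemma card_a: "i < r \<Longrightarrow> X \<subseteq> {..<s} \<Longrightarrow> card (a i ` X) = card X"
  using inj_a[of i] by (intro card_image) (rule inj_on_subset)

lemma card_a_Collect: "i < r \<Longrightarrow> card (a i ` {j. j < s \<and> P j}) = card {j. j < s \<and> P j}"
  by (rule card_a) auto

lemma card_atypical: "card (V - typical) \<le> s * \<epsilon> * card V"
proof -
  let ?N = "\<lambda>j. near_extensions V B ((\<lambda>i. a i j) ` {..<r})"
  have "V - typical \<subseteq> (\<Union>j<s. V - ?N j)" by (auto simp: typical_def)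
  then have "card (V - typical) \<le> card (\<Union>j<s. V - ?N j)" using V by (intro card_mono) auto
  also have "\<dots> \<le> (\<Sum>j<s. card (V - ?N j))" by (rule card_UN_le) simp
  finally have "real (card (V - typical)) \<le> (\<Sum>j<s. real (card (V - ?N j)))"
    unfolding of_nat_sum[symmetric] of_nat_le_iff .
  also have "\<dots> \<le> (\<Sum>j<s. \<epsilon> * card V)"
  proof (rule sum_mono)
    fix j assume j: "j \<in> {..<s}"
    have sub: "?N j \<subseteq> V" by (auto simp: near_extensions_def extensions_def)
    have "card (V - ?N j) = card V - card (?N j)" using sub V by (intro card_Diff_subset) auto
    then show "real (card (V - ?N j)) \<le> \<epsilon> * card V"
      using good[of j] j card_mono[OF V sub] by (simp add: algebra_simps of_nat_diff)
  qed
  finally show ?thesis by simp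
qed

text \<open>A vertex with \<open>t\<close> neighbours in every part could play the critical vertex
  in a copy of \<open>F\<close>.\<close>

lemma ex_class:
  assumes "y \<in> V"
  shows "\<exists>i<r. card (J y i) < t"
proof (rule ccontr)
  assume "\<not> ?thesis"
  then have big: "\<And>i. i < r \<Longrightarrow> t \<le> card (J y i)" by force
  have "embeds F V E"
  proof (rule embeds_multipartite[OF F v0 E assms, where M = "\<lambda>i. a i ` J y i"])
    fix i assume i: "i < r"
    show "a i ` J y i \<subseteq> V" using aV[OF i] J_sub[of y i] by blast
    show "finite (a i ` J y i)" by simp
    show "t \<le> card (a i ` J y i)" using big[OF i] card_a[OF i J_sub] by simp
    show "{y, z} \<in> E" if "z \<in> a i ` J y i" for z
      using that BE by (auto simp: J_def insert_commute)
    show "{z, z'} \<in> E" if "i' < r" "i \<noteq> i'" "z \<in> a i ` J y i" "z' \<in> a i' ` J y i'" for z z' i'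
      using that i aB BE by (auto simp: J_def)
  qed
  then show False using free by simp
qed

text \<open>The choice is a real one only for atypical vertices: by \<open>card_J_other\<close> a
  typical vertex is adjacent to all but at most \<open>t\<close> of the \<open>s\<close> vertices of
  every other part.\<close>

definition cls :: "'b \<Rightarrow> nat" where
  "cls y = (SOME i. i < r \<and> card (J y i) < t)"

lemma cls: "y \<in> V \<Longrightarrow> cls y < r" "y \<in> V \<Longrightarrow> card (J y (cls y)) < t"
  using someI_ex[of "\<lambda>i. i < r \<and> card (J y i) < t"] ex_class[of y] unfolding cls_def by blast+

text \<open>On each diagonal transversal \<open>y\<close> misses at most one vertex. If it misses
  the one in part \<open>i\<close>, it is adjacent to the one in part \<open>cls y\<close>; so every
  missing index belongs to \<open>J y (cls y)\<close>, which has fewer than \<open>t\<close>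
  elements.\<close>

lemma card_J_other:
  assumes y: "y \<in> typical" and i: "i < r" "i \<noteq> cls y"
  shows "card ({..<s} - J y i) \<le> t"
proof -
  have yV: "y \<in> V" using y typical_sub by blast
  have "{..<s} - J y i \<subseteq> J y (cls y)"
  proof
    fix j assume j: "j \<in> {..<s} - J y i"
    then have "y \<in> near_extensions V B ((\<lambda>i. a i j) ` {..<r})" using y by (auto simp: typical_def)
    then obtain l where l: "l < r" and adj: "\<And>x. x \<in> (\<lambda>i. a i j) ` {..<r} - {a l j} \<Longrightarrow> {x, y} \<in> B"
      by (auto simp: near_extensions_def extensions_def)
    have "l = i"
    proof (rule ccontr)
      assume "l \<noteq> i"
      then have "a i j \<noteq> a l j" using aB[of i l j j] i l j loopless_ne[OF loopless_B] by blast
      then have "{a i j, y} \<in> B" using adj i by blast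
      then show False using j by (auto simp: J_def)
    qed
    then have "a (cls y) j \<noteq> a l j"
      using aB[of i "cls y" j j] i j cls(1)[OF yV] loopless_ne[OF loopless_B, of "a i j" "a (cls y) j"] by auto
    then have "{a (cls y) j, y} \<in> B" using adj cls(1)[OF yV] by blast
    then show "j \<in> J y (cls y)" using j by (auto simp: J_def)
  qed
  then have "card ({..<s} - J y i) \<le> card (J y (cls y))" by (intro card_mono) auto
  then show ?thesis using cls(2)[OF yV] by linarith
qed

lemma card_common:
  assumes P: "P \<subseteq> typical" "finite P" "card P \<le> c" and i: "i < r" "\<And>y. y \<in> P \<Longrightarrow> cls y \<noteq> i"
  shows "s \<le> card {j. j < s \<and> (\<forall>y\<in>P. j \<in> J y i)} + c * t"
proof -
  let ?X = "{j. j < s \<and> (\<forall>y\<in>P. j \<in> J y i)}"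
  have "{..<s} \<subseteq> ?X \<union> (\<Union>y\<in>P. {..<s} - J y i)" by auto
  then have "card {..<s} \<le> card (?X \<union> (\<Union>y\<in>P. {..<s} - J y i))" using P by (intro card_mono) auto
  also have "\<dots> \<le> card ?X + card (\<Union>y\<in>P. {..<s} - J y i)" by (rule card_Un_le)
  also have "card (\<Union>y\<in>P. {..<s} - J y i) \<le> (\<Sum>y\<in>P. card ({..<s} - J y i))"
    using P by (intro card_UN_le)
  also have "\<dots> \<le> (\<Sum>y\<in>P. t)" using P i by (intro sum_mono card_J_other) auto
  also have "\<dots> \<le> c * t" using P by simp
  finally show ?thesis by simp
qed

definition avoiding :: "nat \<Rightarrow> 'b set" where
  "avoiding i = {y \<in> typical. cls y \<noteq> i}"

lemma card_extensions_avoiding: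
  assumes i: "i < r" and P: "P \<subseteq> avoiding i" "finite P" "card P \<le> t"
  shows "t < card (extensions V B P)"
proof -
  let ?X = "{j. j < s \<and> (\<forall>y\<in>P. j \<in> J y i)}"
  have "s \<le> card ?X + t * t" using P i by (intro card_common) (auto simp: avoiding_def)
  then have "t < card ?X" using s by linarith
  also have "card ?X = card (a i ` ?X)" using card_a_Collect[OF i] by simp
  also have "\<dots> \<le> card (extensions V B P)"
    using V aV[OF i] by (intro card_mono) (auto simp: extensions_def J_def insert_commute)
  finally show ?thesis .
qed

text \<open>From \<open>t\<close> neighbours of \<open>y\<close> in its own class a copy of
  \<open>F\<close> arises: \<open>y\<close> is the single vertex, these neighbours replace the part
  \<open>cls y\<close>, and their common neighbours with \<open>y\<close> in the other parts of the
  skeleton complete the pattern.\<close>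

lemma card_inner_degree:
  assumes y: "y \<in> typical"
  shows "card {z \<in> typical. cls z = cls y \<and> {y, z} \<in> B} < t"
proof (rule ccontr)
  let ?D = "{z \<in> typical. cls z = cls y \<and> {y, z} \<in> B}"
  assume "\<not> ?thesis"
  then obtain L where L: "L \<subseteq> ?D" "card L = t" "finite L"
    using obtain_subset_with_card_n[of t ?D] by auto
  let ?P = "insert y L"
  have P: "?P \<subseteq> typical" "finite ?P" "card ?P \<le> t + 1"
    using L y by (auto simp: card_insert_if)
  let ?X = "\<lambda>i. {j. j < s \<and> (\<forall>z\<in>?P. j \<in> J z i)}"
  \<comment> \<open>The value of \<open>s\<close> is made for this estimate: \<open>t + 1\<close>
    typical vertices of one class together miss at most \<open>(t + 1) * t\<close> indices of
    another part.\<close>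
  have X: "t \<le> card (?X i)" if "i < r" "i \<noteq> cls y" for i
  proof -
    have "s \<le> card (?X i) + (t + 1) * t" using that L by (intro card_common P) auto
    then show ?thesis using s by (simp add: algebra_simps)
  qed
  let ?M = "\<lambda>i. if i = cls y then L else a i ` ?X i"
  have yV: "y \<in> V" using y typical_sub by blast
  have LX: "{z, x} \<in> E" if "z \<in> ?P" "x \<in> a i ` ?X i" for z x i
    using that BE by (auto simp: J_def insert_commute)
  have "embeds F V E"
  proof (rule embeds_multipartite[OF F v0 E yV, where M = ?M])
    fix i assume i: "i < r"
    show "?M i \<subseteq> V" using aV[OF i] L typical_sub by auto
    show "finite (?M i)" using L by simp
    show "t \<le> card (?M i)" using X[OF i] card_a_Collect[OF i] L by auto
    show "{y, z} \<in> E" if "z \<in> ?M i" for z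
      using that L BE LX[of y z i] by (auto split: if_splits)
    show "{z, z'} \<in> E" if i': "i' < r" "i \<noteq> i'" and z: "z \<in> ?M i" "z' \<in> ?M i'" for z z' i'
    proof -
      consider "i = cls y" "i' \<noteq> cls y" | "i' = cls y" "i \<noteq> cls y" | "i \<noteq> cls y" "i' \<noteq> cls y"
        using i' by blast
      then show ?thesis
      proof cases
        case 1 then show ?thesis using LX[of z z' i'] z by auto
      next
        case 2 then show ?thesis using LX[of z' z i] z by (auto simp: insert_commute)
      next
        case 3
        then obtain j j' where "z = a i j" "j < s" "z' = a i' j'" "j' < s" using z by auto
        then show ?thesis using aB[of i i' j j'] i i' BE by blast
      qed
    qed
  qed
  then show False using free by simp
qed

section \<open>Cliques with at most one vertex in each class\<close>

definition transversals :: "nat \<Rightarrow> 'b set set" where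
  "transversals k = {Q \<in> cliques V B k. Q \<subseteq> typical \<and> inj_on cls Q}"

lemma finite_transversals [simp]: "finite (transversals k)"
  using V by (simp add: transversals_def)

text \<open>Any other clique contains an atypical vertex, which gives the term with
  \<open>s * \<epsilon>\<close>, or an edge inside a class, which costs a factor
  \<open>t / card V\<close> because degrees inside classes are below \<open>t\<close>.\<close>

lemma card_transversals:
  "card (cliques V B (m + 2)) \<le> card (transversals (m + 2)) + (s * \<epsilon> + t / card V) * real (card V) ^ (m + 2)"
proof -
  let ?n = "card V"
  let ?D = "\<lambda>y. {z \<in> typical. cls z = cls y \<and> {y, z} \<in> B}"
  let ?X = "{Q \<in> cliques V B (Suc (m + 1)). Q \<inter> (V - typical) \<noteq> {}}"
  let ?Y = "{Q \<in> cliques V B (m + 2). \<exists>y\<in>Q. \<exists>z\<in>Q. z \<noteq> y \<and> y \<in> typical \<and> z \<in> ?D y}"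
  have "cliques V B (m + 2) \<subseteq> transversals (m + 2) \<union> (?X \<union> ?Y)"
  proof
    fix Q assume Q: "Q \<in> cliques V B (m + 2)"
    then have QV: "Q \<subseteq> V" by (auto simp: cliques_def)
    show "Q \<in> transversals (m + 2) \<union> (?X \<union> ?Y)"
    proof (cases "Q \<subseteq> typical \<and> inj_on cls Q")
      case True
      then show ?thesis using Q by (simp add: transversals_def)
    next
      case F: False
      show ?thesis
      proof (cases "Q \<subseteq> typical")
        case False
        then have "Q \<inter> (V - typical) \<noteq> {}" using QV by blast
        then show ?thesis using Q by simp
      next
        case True
        then obtain y z where yz: "y \<in> Q" "z \<in> Q" "z \<noteq> y" "cls z = cls y"
          using F by (auto simp: inj_on_def)
        then have "{y, z} \<in> B" using Q by (auto simp: cliques_def)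
        then show ?thesis using Q yz True by blast
      qed
    qed
  qed
  then have "card (cliques V B (m + 2)) \<le> card (transversals (m + 2) \<union> (?X \<union> ?Y))"
    using V by (intro card_mono) auto
  also have "\<dots> \<le> card (transversals (m + 2)) + (card ?X + card ?Y)"
    by (meson add_left_mono card_Un_le le_trans)
  finally have *: "card (cliques V B (m + 2)) \<le> card (transversals (m + 2)) + (card ?X + card ?Y)" .
  have "card ?X \<le> card (V - typical) * ?n ^ (m + 1)" using V by (intro card_cliques_meeting) auto
  then have "real (card ?X) \<le> real (card (V - typical) * ?n ^ (m + 1))" by (rule of_nat_mono)
  also have "\<dots> \<le> (s * \<epsilon> * ?n) * real ?n ^ (m + 1)"
    unfolding of_nat_mult of_nat_power using card_atypical by (intro mult_right_mono) auto
  finally have X: "real (card ?X) \<le> s * \<epsilon> * real ?n ^ (m + 2)" by (simp add: mult_ac)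
  have "card ?Y \<le> ?n * t * ?n ^ m"
  proof (rule card_cliques_pairs[OF V])
    fix y
    show "?D y \<subseteq> V" using typical_sub by blast
    show "y \<in> typical \<Longrightarrow> card (?D y) \<le> t" using card_inner_degree[of y] by simp
  qed (rule typical_sub)
  then have "real (card ?Y) \<le> real (?n * t * ?n ^ m)" by (rule of_nat_mono)
  also have "\<dots> = t / ?n * real ?n ^ (m + 2)" by (simp add: power2_eq_square)
  finally show ?thesis using * X by (simp only: distrib_right)
qed

text \<open>For \<open>v\<close> in class \<open>i\<close>, removing \<open>v\<close> maps the transversal cliques through \<open>v\<close> to cliques
  avoiding class \<open>i\<close>; sum over \<open>v\<close>.\<close>

lemma ex_avoiding_cliques:
  assumes "V \<noteq> {}"
  shows "\<exists>i<r. (m + 2) * card (transversals (m + 2)) \<le> card V * card (cliques (avoiding i) B (m + 1))"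
proof (rule ccontr)
  let ?\<tau> = "transversals (m + 2)"
  let ?c = "\<lambda>i. card (cliques (avoiding i) B (m + 1))"
  assume "\<not> ?thesis"
  then have lt: "\<And>i. i < r \<Longrightarrow> card V * ?c i < (m + 2) * card ?\<tau>" by force
  \<comment> \<open>A class exists, so the contrary assumption yields a transversal clique and with
    it a typical vertex; the strict sum below needs one.\<close>
  obtain x where x: "x \<in> V" using assms by blast
  have "0 < card ?\<tau>" using lt[OF cls(1)[OF x]] by (cases "card ?\<tau>") auto
  then obtain Q where "Q \<in> ?\<tau>" by fastforce
  then have "Q \<subseteq> typical" "Q \<noteq> {}" by (auto simp: transversals_def cliques_def)
  then have typical: "typical \<noteq> {}" by blast
  have "(m + 2) * card ?\<tau> = (\<Sum>Q\<in>?\<tau>. card Q)" by (simp add: transversals_def cliques_def)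
  also have "\<dots> = (\<Sum>Q\<in>?\<tau>. \<Sum>v\<in>typical. if v \<in> Q then 1 else 0)"
    by (rule sum.cong) (auto simp: transversals_def sum.If_cases Int_absorb1)
  also have "\<dots> = (\<Sum>v\<in>typical. \<Sum>Q\<in>?\<tau>. if v \<in> Q then 1 else 0)" by (rule sum.swap)
  also have "\<dots> = (\<Sum>v\<in>typical. card {Q \<in> ?\<tau>. v \<in> Q})"
    by (simp add: sum.If_cases Int_def)
  also have "\<dots> \<le> (\<Sum>v\<in>typical. ?c (cls v))"
  proof (rule sum_mono)
    fix v assume v: "v \<in> typical"
    have "inj_on (\<lambda>Q. Q - {v}) {Q \<in> ?\<tau>. v \<in> Q}" by (auto simp: inj_on_def)
    moreover have "(\<lambda>Q. Q - {v}) ` {Q \<in> ?\<tau>. v \<in> Q} \<subseteq> cliques (avoiding (cls v)) B (m + 1)"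
    proof clarify
      fix Q assume Q: "Q \<in> ?\<tau>" "v \<in> Q"
      then have "Q - {v} \<in> cliques V B (m + 1)"
        using remove_cliques(1)[OF V, of Q B "m + 1" v] by (simp add: transversals_def)
      moreover have "Q - {v} \<subseteq> avoiding (cls v)"
        using Q by (auto simp: transversals_def avoiding_def inj_on_def)
      ultimately show "Q - {v} \<in> cliques (avoiding (cls v)) B (m + 1)" by (simp add: cliques_def)
    qed
    moreover have "finite (cliques (avoiding (cls v)) B (m + 1))" by (simp add: avoiding_def)
    ultimately show "card {Q \<in> ?\<tau>. v \<in> Q} \<le> ?c (cls v)" by (rule card_inj_on_le)
  qed
  finally have "card V * ((m + 2) * card ?\<tau>) \<le> card V * (\<Sum>v\<in>typical. ?c (cls v))" by (rule mult_le_mono2)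
  also have "\<dots> = (\<Sum>v\<in>typical. card V * ?c (cls v))" by (rule sum_distrib_left)
  also have "\<dots> < (\<Sum>v\<in>typical. (m + 2) * card ?\<tau>)"
    using typical lt cls(1) typical_sub by (intro sum_strict_mono) auto
  also have "\<dots> \<le> card V * ((m + 2) * card ?\<tau>)"
    using card_mono[OF V typical_sub] by (simp only: sum_constant of_nat_id) (rule mult_le_mono1)
  finally show False by simp
qed

end

text \<open>Multiplying the number of cliques by \<open>(m + 2) / card V\<close> gives the average
  number through a vertex. So a new vertex joined to \<open>S\<close> does as well as the average
  vertex, up to the error term. The classes no longer appear in this form.\<close>

lemma (in critical_graph) ex_clone_set:
  assumes "skeleton F t r v0 V E B a s \<epsilon>" "V \<noteq> {}"
  shows "\<exists>S\<subseteq>V. (\<forall>P. P \<subseteq> S \<longrightarrow> finite P \<longrightarrow> card P \<le> t \<longrightarrow> t < card (extensions V B P)) \<and>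
    real (m + 2) * (real (card (cliques V B (m + 2))) - (s * \<epsilon> + t / card V) * real (card V) ^ (m + 2))
      \<le> real (card V) * card (cliques S B (m + 1))"
proof -
  interpret skeleton F t r v0 V E B a s \<epsilon> by fact
  obtain i where i: "i < r" "(m + 2) * card (transversals (m + 2)) \<le> card V * card (cliques (avoiding i) B (m + 1))"
    using ex_avoiding_cliques[OF assms(2)] by blast
  have "real (m + 2) * (real (card (cliques V B (m + 2))) - (s * \<epsilon> + t / card V) * real (card V) ^ (m + 2))
    \<le> real (m + 2) * real (card (transversals (m + 2)))"
    using card_transversals[of m] by (intro mult_left_mono) auto
  also have "\<dots> \<le> real (card V) * card (cliques (avoiding i) B (m + 1))"
    using i(2) by (metis of_nat_le_iff of_nat_mult)
  finally have "real (m + 2) * (real (card (cliques V B (m + 2))) - (s * \<epsilon> + t / card V) * real (card V) ^ (m + 2))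
    \<le> real (card V) * card (cliques (avoiding i) B (m + 1))" .
  moreover have "avoiding i \<subseteq> V" using typical_sub by (auto simp: avoiding_def)
  ultimately show ?thesis using card_extensions_avoiding[OF i(1)] by blast
qed

section \<open>Clique densities\<close>

lemma ordered_cliques_lower:
  fixes \<theta> :: real
  assumes V: "finite V" and E: "loopless E" and \<theta>: "\<theta> > 0" "(real k - 1) * \<theta> \<le> 1"
    and big: "ordered_cliques V E k > (\<Prod>s<k. 1 - real s * \<theta>) * card V ^ k"
    and j: "k \<le> j" "(real j - 1) * \<theta> < 1"
  shows "ordered_cliques V E j \<ge> (\<Prod>s<j. 1 - real s * \<theta>) * card V ^ j"
  using j
proof (induction j rule: dec_induct)
  case base
  then show ?case using big by simp
next
  case (step i)
  have i: "real i * \<theta> < 1" using step.prems by simp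
  then have "(real i - 1) * \<theta> < 1" using \<theta> by (simp add: algebra_simps)
  then have IH: "ordered_cliques V E i \<ge> (\<Prod>s<i. 1 - real s * \<theta>) * card V ^ i" by (rule step.IH)
  have "(\<Prod>s<Suc i. 1 - real s * \<theta>) * card V ^ Suc i
      = (1 - real i * \<theta>) * card V * ((\<Prod>s<i. 1 - real s * \<theta>) * card V ^ i)" by simp
  also have "\<dots> \<le> (1 - real i * \<theta>) * card V * ordered_cliques V E i"
    using IH i by (intro mult_left_mono) auto
  also have "\<dots> \<le> ordered_cliques V E (Suc i)"
    using ordered_cliques_growth[OF V E \<theta> big, of i] step.hyps i by auto
  finally show ?case .
qed

context critical_graph
begin

text \<open>Otherwise Erdos's theorem finds \<open>r\<close> large parts inside the neighbourhood,
  and \<open>x\<close> serves as the single vertex. The theorem is applied in all of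
  \<open>V\<close> to the family of cliques in the neighbourhood, so the density is relative to
  \<open>card V\<close>.\<close>

lemma few_cliques_nbhd:
  fixes \<gamma> :: real
  assumes "\<gamma> > 0"
  shows "\<exists>n0. \<forall>(V :: 'b set) E x. finite V \<longrightarrow> card V \<ge> n0 \<longrightarrow> loopless E \<longrightarrow> \<not> embeds F V E \<longrightarrow> x \<in> V \<longrightarrow>
    card (cliques (extensions V E {x}) E r) < \<gamma> * real (card V) ^ r"
proof -
  obtain n0 where n0: "\<And>(V :: 'b set) E \<Q>. finite V \<Longrightarrow> card V \<ge> n0 \<Longrightarrow> loopless E \<Longrightarrow> \<Q> \<subseteq> cliques V E r \<Longrightarrow>
    card \<Q> \<ge> \<gamma> * real (card V) ^ r \<Longrightarrow>
      (\<exists>a. clique_box r t V E \<Q> a)"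
    using erdos_cliques[OF assms, of r t] by (elim exE) blast
  show ?thesis
  proof (intro exI[of _ n0] allI impI, rule ccontr)
    fix V :: "'b set" and E x
    assume V: "finite V" "n0 \<le> card V" and E: "loopless E" and free: "\<not> embeds F V E" and x: "x \<in> V"
      and "\<not> card (cliques (extensions V E {x}) E r) < \<gamma> * real (card V) ^ r"
    then have big: "card (cliques (extensions V E {x}) E r) \<ge> \<gamma> * real (card V) ^ r" by linarith
    have "cliques (extensions V E {x}) E r \<subseteq> cliques V E r" by (rule cliques_mono) (auto simp: extensions_def)
    from n0[OF V E this big] obtain a where a: "clique_box r t V E (cliques (extensions V E {x}) E r) a" by blast
    have "embeds F V E"
    proof (rule embeds_multipartite[OF F v0 E x, where M = "\<lambda>i. a i ` {..<t}"])
      fix i assume i: "i < r"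
      show "a i ` {..<t} \<subseteq> V" by (rule clique_boxD(2)[OF a i])
      show "finite (a i ` {..<t})" by simp
      show "t \<le> card (a i ` {..<t})" using clique_boxD(1)[OF a i] by (simp add: card_image)
      show "{x, y} \<in> E" if y: "y \<in> a i ` {..<t}" for y
      proof -
        obtain j where j: "j < t" "y = a i j" using y by blast
        have "(\<lambda>i. a i j) ` {..<r} \<in> cliques (extensions V E {x}) E r" using clique_boxD(3)[OF a i j(1)] .
        then have "y \<in> extensions V E {x}" using j i by (auto simp: cliques_def)
        then show ?thesis by (simp add: extensions_def)
      qed
      show "{y, y'} \<in> E" if "i' < r" "i \<noteq> i'" "y \<in> a i ` {..<t}" "y' \<in> a i' ` {..<t}" for i' y y'
        using clique_boxD(4)[OF a i] that by blast
    qed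
    then show False using free by simp
  qed
qed

lemma few_cliques:
  fixes \<gamma> :: real
  assumes "\<gamma> > 0"
  shows "\<exists>n0. \<forall>(V :: 'b set) E. finite V \<longrightarrow> card V \<ge> n0 \<longrightarrow> loopless E \<longrightarrow> \<not> embeds F V E \<longrightarrow>
    card (cliques V E (Suc r)) \<le> \<gamma> * real (card V) ^ Suc r"
proof -
  obtain n0 where n0: "\<And>(V :: 'b set) E x. finite V \<Longrightarrow> card V \<ge> n0 \<Longrightarrow> loopless E \<Longrightarrow> \<not> embeds F V E \<Longrightarrow> x \<in> V \<Longrightarrow>
    card (cliques (extensions V E {x}) E r) < \<gamma> * real (card V) ^ r"
    using few_cliques_nbhd[OF assms] by (elim exE) blast
  show ?thesis
  proof (intro exI[of _ n0] allI impI)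
    fix V :: "'b set" and E
    assume V: "finite V" "n0 \<le> card V" and E: "loopless E" and free: "\<not> embeds F V E"
    let ?X = "\<lambda>x. insert x ` cliques (extensions V E {x}) E r"
    have fin: "finite (cliques (extensions V E {x}) E r)" for x using V by simp
    have sub: "cliques V E (Suc r) \<subseteq> (\<Union>x\<in>V. ?X x)"
    proof
      fix Q assume Q: "Q \<in> cliques V E (Suc r)"
      then obtain x where x: "x \<in> Q" by (fastforce simp: cliques_def)
      have xV: "x \<in> V" using Q x by (auto simp: cliques_def)
      have "Q - {x} \<in> cliques V E r" by (rule remove_cliques(1)[OF V(1) Q x])
      moreover have "Q - {x} \<subseteq> extensions V E {x}" using Q x by (auto simp: cliques_def extensions_def)
      ultimately have "Q - {x} \<in> cliques (extensions V E {x}) E r" by (simp add: cliques_def)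
      then have "insert x (Q - {x}) \<in> ?X x" by (rule imageI)
      then have "Q \<in> ?X x" using x by (simp add: insert_absorb)
      then show "Q \<in> (\<Union>x\<in>V. ?X x)" using xV by blast
    qed
    have "card (cliques V E (Suc r)) \<le> card (\<Union>x\<in>V. ?X x)"
      using V fin by (intro card_mono[OF _ sub]) auto
    also have "\<dots> \<le> (\<Sum>x\<in>V. card (?X x))" by (rule card_UN_le[OF V(1)])
    also have "\<dots> \<le> (\<Sum>x\<in>V. card (cliques (extensions V E {x}) E r))"
      by (intro sum_mono card_image_le fin)
    finally have "real (card (cliques V E (Suc r))) \<le> (\<Sum>x\<in>V. real (card (cliques (extensions V E {x}) E r)))"
      unfolding of_nat_sum[symmetric] of_nat_le_iff .
    also have "\<dots> \<le> (\<Sum>x\<in>V. \<gamma> * real (card V) ^ r)"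
      using n0[OF V E free] by (intro sum_mono less_imp_le)
    finally show "card (cliques V E (Suc r)) \<le> \<gamma> * real (card V) ^ Suc r" by (simp add: mult_ac)
  qed
qed

end

text \<open>Moon-Moser is almost tight here. By Cauchy-Schwarz the squared extension numbers of the
  \<open>(r - 1)\<close>-cliques sum to almost \<open>card V\<close> times the number of
  \<open>r\<close>-cliques, as \<open>r * (1 - (real r - 1) * \<theta>)\<close> is nearly
  \<open>1\<close>. Since \<open>(r + 1)\<close>-cliques are few, this forces the average of
  \<open>card (near_extensions V E Q)\<close> to be almost \<open>card V\<close>.\<close>

lemma many_good_cliques:
  fixes \<theta> \<epsilon> \<gamma> :: real
  assumes V: "finite V" and E: "loopless E" and k: "1 \<le> k" "k \<le> r"
    and \<theta>: "\<theta> > 0" "(real r - 1) * \<theta> < 1" and \<epsilon>: "\<epsilon> > 0" "1 - \<epsilon> / 4 \<le> r * (1 - (real r - 1) * \<theta>)"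
    and big: "ordered_cliques V E k > (\<Prod>s<k. 1 - real s * \<theta>) * card V ^ k"
    and few: "card (cliques V E (Suc r)) \<le> \<gamma> * real (card V) ^ Suc r"
    and \<gamma>: "real r * real r * \<gamma> \<le> \<epsilon> / 4 * ((\<Prod>s<r. 1 - real s * \<theta>) / fact r)" "\<gamma> \<ge> 0"
  shows "(\<Prod>s<r. 1 - real s * \<theta>) / fact r / 2 * real (card V) ^ r
    \<le> card {Q \<in> cliques V E r. (1 - \<epsilon>) * card V \<le> card (near_extensions V E Q)}"
proof -
  let ?n = "real (card V)"
  define c where "c = (\<Prod>s<r. 1 - real s * \<theta>) / fact r"
  define kr where "kr = real (card (cliques V E r))"
  define X where "X = (\<Sum>P\<in>cliques V E (r - 1). (real (card (extensions V E P)))\<^sup>2)"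
  have r: "r = Suc (r - 1)" "real (r - 1) = real r - 1" using k by auto
  have "(real k - 1) * \<theta> \<le> (real r - 1) * \<theta>" using k \<theta> by (intro mult_right_mono) auto
  then have k\<theta>: "(real k - 1) * \<theta> \<le> 1" using \<theta> by linarith
  have "ordered_cliques V E r \<ge> (\<Prod>s<r. 1 - real s * \<theta>) * card V ^ r"
    by (rule ordered_cliques_lower[OF V E \<theta>(1) k\<theta> big k(2) \<theta>(2)])
  then have kr: "c * ?n ^ r \<le> kr" by (simp add: ordered_cliques_def c_def kr_def field_simps)
  have g: "ordered_cliques V E r \<ge> (1 - (real r - 1) * \<theta>) * ?n * ordered_cliques V E (r - 1)" "ordered_cliques V E r > 0"
    using ordered_cliques_growth[OF V E \<theta>(1) k\<theta> big, of "r - 1"] r k \<theta>(2) by auto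
  have hpos: "ordered_cliques V E (r - 1) > 0"
    using ordered_cliques_Suc_le[OF V E, of "r - 1"] g(2) r ordered_cliques_nonneg[of V E "r - 1"]
    by (cases "ordered_cliques V E (r - 1) = 0") auto
  have "ordered_cliques V E (r - 1) * ((1 - (real r - 1) * \<theta>) * ?n * ordered_cliques V E r) =
      ordered_cliques V E r * ((1 - (real r - 1) * \<theta>) * ?n * ordered_cliques V E (r - 1))" by (simp add: mult_ac)
  also have "\<dots> \<le> ordered_cliques V E r * ordered_cliques V E r" using g by (intro mult_left_mono) auto
  also have "\<dots> \<le> ordered_cliques V E (r - 1) * (fact (r - 1) * X)"
    using ordered_cliques_sq_le[OF V E, of "r - 1"] r(1) by (simp add: power2_eq_square X_def)
  finally have "(1 - (real r - 1) * \<theta>) * ?n * ordered_cliques V E r \<le> fact (r - 1) * X"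
    using hpos by (simp add: mult_le_cancel_left)
  moreover have "ordered_cliques V E r = fact (r - 1) * (real r * kr)"
    unfolding ordered_cliques_def kr_def using k by (simp add: fact_reduce)
  ultimately have "fact (r - 1) * ((1 - (real r - 1) * \<theta>) * ?n * (real r * kr)) \<le> fact (r - 1) * X"
    by (simp add: mult_ac)
  then have X: "(1 - (real r - 1) * \<theta>) * ?n * (real r * kr) \<le> X"
    by (simp add: mult_le_cancel_left)
  have "X \<le> (\<Sum>Q\<in>cliques V E r. real (card (near_extensions V E Q))) +
      (real r - 1) * (real r + 1) * card (cliques V E (Suc r))"
    using sum_card_extensions_sq[OF V E, of "r - 1"] r by (simp add: X_def add.commute)
  also have "(real r - 1) * (real r + 1) * card (cliques V E (Suc r)) \<le> (real r - 1) * (real r + 1) * (\<gamma> * ?n ^ Suc r)"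
    using few k by (intro mult_left_mono) auto
  also have "\<dots> \<le> (real r * real r) * (\<gamma> * ?n ^ Suc r)"
    using \<gamma>(2) by (intro mult_right_mono) (auto simp: algebra_simps)
  also have "\<dots> \<le> \<epsilon> / 4 * c * ?n ^ Suc r"
    using mult_right_mono[OF \<gamma>(1), of "?n ^ Suc r"] by (simp add: c_def mult_ac)
  also have "\<dots> = \<epsilon> / 4 * ?n * (c * ?n ^ r)" by simp
  also have "\<dots> \<le> \<epsilon> / 4 * ?n * kr" using kr \<epsilon> by (intro mult_left_mono) auto
  finally have X2: "X \<le> (\<Sum>Q\<in>cliques V E r. real (card (near_extensions V E Q))) + \<epsilon> / 4 * ?n * kr" by simp
  have "(1 - \<epsilon> / 4) * (?n * kr) \<le> real r * (1 - (real r - 1) * \<theta>) * (?n * kr)"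
    using \<epsilon> by (intro mult_right_mono) (auto simp: kr_def)
  then have low: "(1 - \<epsilon> / 2) * ?n * kr \<le> (\<Sum>Q\<in>cliques V E r. real (card (near_extensions V E Q)))"
    using X X2 by (simp add: algebra_simps)
  let ?G = "{Q \<in> cliques V E r. (1 - \<epsilon>) * card V \<le> card (near_extensions V E Q)}"
  have G: "?G \<subseteq> cliques V E r" "finite (cliques V E r)" using V by auto
  have "(\<Sum>Q\<in>cliques V E r. real (card (near_extensions V E Q))) =
      (\<Sum>Q\<in>?G. real (card (near_extensions V E Q))) + (\<Sum>Q\<in>cliques V E r - ?G. real (card (near_extensions V E Q)))"
    using sum.subset_diff[OF G, of "\<lambda>Q. real (card (near_extensions V E Q))"] by simp
  \<comment> \<open>The average is at least \<open>(1 - \<epsilon> / 2) * ?n\<close>, but values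
    outside \<open>?G\<close> stay below \<open>(1 - \<epsilon>) * ?n\<close>; so \<open>?G\<close>
    holds at least half of the \<open>r\<close>-cliques.\<close>
  also have "\<dots> \<le> (\<Sum>Q\<in>?G. ?n) + (\<Sum>Q\<in>cliques V E r - ?G. (1 - \<epsilon>) * ?n)"
    using card_near_extensions_le[OF V] by (intro add_mono sum_mono) auto
  also have "\<dots> = card ?G * ?n + (kr - card ?G) * ((1 - \<epsilon>) * ?n)"
    using card_Diff_subset[OF finite_subset[OF G] G(1)] card_mono[OF G(2,1)]
    by (simp add: kr_def of_nat_diff)
  finally have "(1 - \<epsilon> / 2) * ?n * kr \<le> card ?G * ?n + (kr - card ?G) * ((1 - \<epsilon>) * ?n)" using low by linarith
  then have "(\<epsilon> * ?n) * (kr / 2) \<le> (\<epsilon> * ?n) * card ?G" by (simp add: algebra_simps)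
  moreover have "?n > 0"
  proof (rule ccontr)
    assume "\<not> ?n > 0"
    then show False using ordered_cliques_Suc_le[OF V E, of "r - 1"] r(1) g(2) by simp
  qed
  ultimately have "kr / 2 \<le> card ?G" using \<epsilon> by (simp add: mult_le_cancel_left)
  then show ?thesis using kr unfolding c_def by simp
qed

text \<open>Here \<open>N\<close> is a neighbourhood in a graph with \<open>n\<close> vertices. Were
  it smaller than \<open>\<mu> * n\<close>, its \<open>m\<close>-cliques would be so dense relative
  to \<open>card N\<close> that Moon-Moser produces a positive proportion of
  \<open>r\<close>-cliques.\<close>

lemma degree_lower:
  fixes \<theta> \<mu> lam \<gamma> n :: real
  assumes N: "finite N" and E: "loopless E" and n: "real (card N) \<le> n" "n > 0" and m: "1 \<le> m" "m \<le> r"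
    and \<theta>: "\<theta> > 0" "(real r - 1) * \<theta> < 1" and lam: "0 < lam" "\<mu> ^ m * (\<Prod>s<m. 1 - real s * \<theta>) < lam"
    and big: "ordered_cliques N E m \<ge> lam * n ^ m"
    and few: "card (cliques N E r) < \<gamma> * n ^ r"
    and \<gamma>: "fact r * \<gamma> \<le> (\<Prod>s<r. 1 - real s * \<theta>) * lam ^ r"
  shows "\<mu> * n \<le> card N"
proof (rule ccontr)
  let ?m = "real (card N)"
  assume "\<not> ?thesis"
  then have lt: "?m < \<mu> * n" by simp
  have pos: "0 < 1 - real s * \<theta>" if "s < r" for s
  proof -
    have "real s * \<theta> \<le> (real r - 1) * \<theta>" using that \<theta> by (intro mult_right_mono) auto
    then show ?thesis using \<theta> by linarith
  qed
  have P: "0 \<le> (\<Prod>s<m. 1 - real s * \<theta>)" using pos m by (intro prod_nonneg less_imp_le) auto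
  have "(\<Prod>s<m. 1 - real s * \<theta>) * ?m ^ m \<le> (\<Prod>s<m. 1 - real s * \<theta>) * (\<mu> * n) ^ m"
    using lt P by (intro mult_left_mono power_mono) auto
  also have "\<dots> = (\<mu> ^ m * (\<Prod>s<m. 1 - real s * \<theta>)) * n ^ m" by (simp add: power_mult_distrib)
  also have "\<dots> < lam * n ^ m" using lam n by (intro mult_strict_right_mono) auto
  finally have gr: "ordered_cliques N E m > (\<Prod>s<m. 1 - real s * \<theta>) * card N ^ m" using big by simp
  have m\<theta>: "(real m - 1) * \<theta> \<le> 1" proof -
    have "m - 1 < r" using m by simp
    then show ?thesis using pos[of "m - 1"] m by simp
  qed
  have low: "ordered_cliques N E r \<ge> (\<Prod>s<r. 1 - real s * \<theta>) * ?m ^ r"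
    using ordered_cliques_lower[OF N E \<theta>(1) m\<theta> gr m(2) \<theta>(2)] by simp
  have hm: "ordered_cliques N E j \<le> ?m ^ j" for j
  proof (induction j)
    case (Suc j)
    have "ordered_cliques N E (Suc j) \<le> ?m * ordered_cliques N E j" by (rule ordered_cliques_Suc_le[OF N E])
    also have "\<dots> \<le> ?m * ?m ^ j" using Suc by (intro mult_left_mono) auto
    finally show ?case by simp
  qed (simp add: ordered_cliques_0 N)
  \<comment> \<open>The \<open>m\<close>-cliques alone force \<open>N\<close> to have linear size,
    so a proportion of \<open>?m ^ r\<close> is also one of \<open>n ^ r\<close>.\<close>
  have "lam \<le> (?m / n) ^ m" using hm[of m] big n by (simp add: power_divide field_simps)
  also have "\<dots> \<le> (?m / n) ^ 1" using n m by (intro power_decreasing) auto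
  finally have "lam * n \<le> ?m" using n by (simp add: field_simps)
  then have "(lam * n) ^ r \<le> ?m ^ r" using lam n by (intro power_mono) auto
  then have "(\<Prod>s<r. 1 - real s * \<theta>) * (lam * n) ^ r \<le> (\<Prod>s<r. 1 - real s * \<theta>) * ?m ^ r"
    using pos by (intro mult_left_mono prod_nonneg) (auto simp: less_imp_le)
  also have "\<dots> \<le> fact r * real (card (cliques N E r))" using low by (simp add: ordered_cliques_def)
  also have "\<dots> < fact r * (\<gamma> * n ^ r)" using few by (intro mult_strict_left_mono) auto
  also have "\<dots> \<le> (\<Prod>s<r. 1 - real s * \<theta>) * lam ^ r * n ^ r"
    using mult_right_mono[OF \<gamma>, of "n ^ r"] n by (simp add: mult_ac)
  finally show False by (simp add: power_mult_distrib)
qed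

section \<open>Colourings and recolourings\<close>

definition colour_edges :: "'b set \<Rightarrow> ('b \<Rightarrow> nat) \<Rightarrow> 'b set set" where
  "colour_edges V c = {{x, y} | x y. x \<in> V \<and> y \<in> V \<and> c x \<noteq> c y}"

lemma colour_edges_card: "e \<in> colour_edges V c \<Longrightarrow> e \<subseteq> V \<and> card e = 2"
  by (auto simp: colour_edges_def card_2_iff)

lemma not_embeds_colour_edges:
  assumes F: "\<not> colorable F r" and c: "\<And>y. y \<in> V \<Longrightarrow> c y < r"
  shows "\<not> embeds F V (colour_edges V c)"
proof
  assume "embeds F V (colour_edges V c)"
  then obtain \<phi> where \<phi>: "\<phi> ` verts F \<subseteq> V" "\<forall>e\<in>edges F. \<phi> ` e \<in> colour_edges V c"
    unfolding embeds_def by blast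
  have "colorable F r" unfolding colorable_def
  proof (intro exI[of _ "c \<circ> \<phi>"] conjI ballI allI impI)
    fix u assume "u \<in> verts F"
    then show "(c \<circ> \<phi>) u < r" using \<phi> c by auto
  next
    fix u v assume "{u, v} \<in> edges F"
    then have "\<phi> ` {u, v} \<in> colour_edges V c" using \<phi> by blast
    then obtain x y where "{\<phi> u, \<phi> v} = {x, y}" "c x \<noteq> c y" by (auto simp: colour_edges_def)
    then show "(c \<circ> \<phi>) u \<noteq> (c \<circ> \<phi>) v" by (auto simp: doubleton_eq_iff)
  qed
  then show False using F by simp
qed

lemma ex_balanced_colouring:
  assumes V: "finite V" and r: "r > 0"
  shows "\<exists>c. (\<forall>y\<in>V. c y < r) \<and> (\<forall>i. card {y \<in> V. c y = i} \<le> card V div r + 1)"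
proof -
  obtain h where h: "bij_betw h V {0..<card V}" using ex_bij_betw_finite_nat[OF V] by blast
  have "card {y \<in> V. h y mod r = i} \<le> card {..card V div r}" for i
  proof (rule card_inj_on_le)
    show "inj_on (\<lambda>y. h y div r) {y \<in> V. h y mod r = i}"
    proof (rule inj_onI)
      fix x y assume "x \<in> {y \<in> V. h y mod r = i}" "y \<in> {y \<in> V. h y mod r = i}" "h x div r = h y div r"
      moreover from this have "h x = h y" by (metis (mono_tags, lifting) div_mult_mod_eq mem_Collect_eq)
      ultimately show "x = y" using h by (auto simp: bij_betw_def dest: inj_onD)
    qed
    show "(\<lambda>y. h y div r) ` {y \<in> V. h y mod r = i} \<subseteq> {..card V div r}"
    proof clarify
      fix y assume "y \<in> V"
      then have "h y < card V" using h by (auto simp: bij_betw_def)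
      then show "h y div r \<le> card V div r" by (intro div_le_mono) simp
    qed
  qed simp
  then show ?thesis using r by (intro exI[of _ "\<lambda>y. h y mod r"]) auto
qed

text \<open>Every vertex of a clique rules out just its own colour class, of size at most
  \<open>card V / r + 1\<close>; the clique is built greedily. The condition
  \<open>r * r \<le> card V\<close> keeps all factors nonnegative.\<close>

lemma ordered_cliques_colour_edges:
  assumes V: "finite V" and r: "r > 0" "r * r \<le> card V" "k \<le> r"
    and c: "\<And>i. card {y \<in> V. c y = i} \<le> card V div r + 1"
  shows "(\<Prod>s<k. 1 - real s / r - real s / card V) * real (card V) ^ k \<le> ordered_cliques V (colour_edges V c) k"
  using r(3)
proof (induction k)
  case 0
  then show ?case by (simp add: ordered_cliques_0 V)
next
  case (Suc k)
  let ?E = "colour_edges V c" and ?n = "real (card V)"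
  have E: "loopless ?E" using colour_edges_card by (auto simp: loopless_def)
  have n: "?n > 0" using r by (cases "card V = 0") auto
  let ?d = "1 - real k / r - real k / ?n"
  have "0 \<le> ?d"
  proof -
    have "real k * (?n + r) \<le> (real r - 1) * (?n + r)" using Suc.prems by (intro mult_right_mono) auto
    also have "real r * r \<le> ?n" using r(2) by (metis of_nat_le_iff of_nat_mult)
    then have "(real r - 1) * (?n + r) \<le> real r * ?n" by (simp add: algebra_simps)
    finally show ?thesis using n r(1) by (simp add: field_simps)
  qed
  have ge: "?d * ?n \<le> card (extensions V ?E P)" if P: "P \<in> cliques V ?E k" for P
  proof -
    have fP: "finite P" by (rule cliques_finite[OF V P])
    have "V \<subseteq> extensions V ?E P \<union> (\<Union>x\<in>P. {y \<in> V. c y = c x})"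
      using P by (fastforce simp: extensions_def colour_edges_def cliques_def)
    then have "card V \<le> card (extensions V ?E P \<union> (\<Union>x\<in>P. {y \<in> V. c y = c x}))"
      using V fP by (intro card_mono) auto
    also have "\<dots> \<le> card (extensions V ?E P) + card (\<Union>x\<in>P. {y \<in> V. c y = c x})" by (rule card_Un_le)
    also have "card (\<Union>x\<in>P. {y \<in> V. c y = c x}) \<le> (\<Sum>x\<in>P. card {y \<in> V. c y = c x})"
      by (rule card_UN_le[OF fP])
    also have "\<dots> \<le> (\<Sum>x\<in>P. card V div r + 1)" by (intro sum_mono c)
    also have "\<dots> = k * (card V div r + 1)" using P by (simp add: cliques_def)
    finally have "?n \<le> card (extensions V ?E P) + real k * (real (card V div r) + 1)"
      by (metis (no_types, opaque_lifting) add_left_mono of_nat_1 of_nat_add of_nat_le_iff of_nat_mult)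
    moreover have "real (card V div r) \<le> ?n / r" by (rule of_nat_div_le_of_nat)
    then have "real k * (real (card V div r) + 1) \<le> real k * (?n / r + 1)" by (intro mult_left_mono) auto
    moreover have "?d * ?n = ?n - real k * (?n / r + 1)" using n by (simp add: field_simps)
    ultimately show ?thesis by linarith
  qed
  have "(\<Prod>s<Suc k. 1 - real s / r - real s / ?n) * ?n ^ Suc k
     = ?d * ?n * ((\<Prod>s<k. 1 - real s / r - real s / ?n) * ?n ^ k)" by simp
  also have "\<dots> \<le> ?d * ?n * ordered_cliques V ?E k"
    using Suc \<open>0 \<le> ?d\<close> by (intro mult_left_mono) auto
  also have "\<dots> = fact k * (\<Sum>P\<in>cliques V ?E k. ?d * ?n)" by (simp add: ordered_cliques_def)
  also have "\<dots> \<le> fact k * (\<Sum>P\<in>cliques V ?E k. real (card (extensions V ?E P)))"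
    using ge by (intro mult_left_mono sum_mono) auto
  also have "\<dots> = ordered_cliques V ?E (Suc k)" by (rule ordered_cliques_Suc[OF V E, symmetric])
  finally show ?case .
qed

section \<open>Trading red edges for cliques, and the effect of cloning on the weight\<close>

lemma card_extensions_ge:
  fixes \<mu> :: real
  assumes V: "finite V" and P: "finite P" "P \<subseteq> V" and deg: "\<And>x. x \<in> V \<Longrightarrow> \<mu> * card V \<le> card (extensions V B {x})"
  shows "card V - card P * ((1 - \<mu>) * card V) \<le> card (extensions V B P)"
proof -
  have sub: "extensions V B X \<subseteq> V" for X by (auto simp: extensions_def)
  have "V \<subseteq> extensions V B P \<union> (\<Union>x\<in>P. V - extensions V B {x})" by (auto simp: extensions_def)
  then have "card V \<le> card (extensions V B P \<union> (\<Union>x\<in>P. V - extensions V B {x}))"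
    using V P by (intro card_mono) auto
  also have "\<dots> \<le> card (extensions V B P) + card (\<Union>x\<in>P. V - extensions V B {x})" by (rule card_Un_le)
  also have "card (\<Union>x\<in>P. V - extensions V B {x}) \<le> (\<Sum>x\<in>P. card (V - extensions V B {x}))"
    by (rule card_UN_le[OF P(1)])
  finally have "card V \<le> card (extensions V B P) + (\<Sum>x\<in>P. card (V - extensions V B {x}))" by simp
  then have "real (card V) \<le> real (card (extensions V B P) + (\<Sum>x\<in>P. card (V - extensions V B {x})))" by (rule of_nat_mono)
  also have "\<dots> = card (extensions V B P) + (\<Sum>x\<in>P. real (card (V - extensions V B {x})))" by simp
  also have "(\<Sum>x\<in>P. real (card (V - extensions V B {x}))) \<le> (\<Sum>x\<in>P. (1 - \<mu>) * card V)"
  proof (rule sum_mono)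
    fix x assume x: "x \<in> P"
    have "card (V - extensions V B {x}) = card V - card (extensions V B {x})"
      using sub V by (intro card_Diff_subset) auto
    then show "real (card (V - extensions V B {x})) \<le> (1 - \<mu>) * card V"
      using deg[of x] x P(2) card_mono[OF V sub] by (auto simp: of_nat_diff algebra_simps)
  qed
  finally show ?thesis by simp
qed

text \<open>Greedy extension by blue neighbours only: the edge \<open>e\<close> may itself be red.
  One extension per step suffices up to \<open>k - 1\<close> vertices, and the last step alone
  offers \<open>k * k\<close> different cliques.\<close>

lemma many_cliques_through_edge:
  fixes \<mu> :: real
  assumes V: "finite V" and E: "loopless E" and BE: "B \<subseteq> E"
    and deg: "\<And>x. x \<in> V \<Longrightarrow> \<mu> * card V \<le> card (extensions V B {x})"
    and e: "e \<in> E" "e \<subseteq> V" and k: "3 \<le> k" and \<mu>: "\<mu> \<le> 1"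
    and n: "(real k - 1) * ((1 - \<mu>) * card V) + real (k * k) \<le> card V"
  shows "k * k \<le> card {Q \<in> cliques V E k. e \<subseteq> Q}"
proof -
  have ge: "k * k \<le> card (extensions V E P)" if P: "P \<in> cliques V E i" "i \<le> k - 1" for P i
  proof -
    have "card P * ((1 - \<mu>) * card V) \<le> (real k - 1) * ((1 - \<mu>) * card V)"
      using P k \<mu> by (intro mult_right_mono) (auto simp: cliques_def)
    then have "real (k * k) \<le> card V - card P * ((1 - \<mu>) * card V)" using n by linarith
    also have "\<dots> \<le> card (extensions V B P)"
      using P by (intro card_extensions_ge[OF V cliques_finite[OF V P(1)] _ deg]) (auto simp: cliques_def)
    also have "\<dots> \<le> card (extensions V E P)"
      using V BE by (intro of_nat_mono card_mono) (auto simp: extensions_def)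
    finally show ?thesis by (simp only: of_nat_le_iff)
  qed
  have ce: "card e = 2" using e E by (auto simp: loopless_def)
  have "\<exists>P\<in>cliques V E (Suc i). e \<subseteq> P" if "1 \<le> i" "i < k - 1" for i
    using that
  proof (induction i rule: dec_induct)
    case base
    obtain x y where "e = {x, y}" using ce by (auto simp: card_2_iff)
    then have "e \<in> cliques V E (Suc 1)" using e ce by (auto simp: cliques_def insert_commute)
    then show ?case by blast
  next
    case (step i)
    then obtain P where P: "P \<in> cliques V E (Suc i)" "e \<subseteq> P" by auto
    have "k * k \<le> card (extensions V E P)" using ge[OF P(1)] step by simp
    then have "extensions V E P \<noteq> {}" using k by auto
    then obtain y where "y \<in> extensions V E P" by blast
    then have "insert y P \<in> cliques V E (Suc (Suc i))" using insert_cliques(1)[OF V E P(1)] by blast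
    then show ?case using P(2) by blast
  qed
  moreover have "1 \<le> k - 2" "k - 2 < k - 1" "Suc (k - 2) = k - 1" using k by auto
  ultimately obtain P where P: "P \<in> cliques V E (k - 1)" "e \<subseteq> P" by metis
  have ins: "insert y P \<in> cliques V E k" "y \<notin> P" if "y \<in> extensions V E P" for y
    using insert_cliques[OF V E P(1) that] k by simp_all
  have "k * k \<le> card (extensions V E P)" using ge[OF P(1)] by simp
  also have "\<dots> \<le> card {Q \<in> cliques V E k. e \<subseteq> Q}"
  proof (rule card_inj_on_le)
    show "inj_on (\<lambda>y. insert y P) (extensions V E P)" using ins(2) by (auto simp: inj_on_def)
    show "(\<lambda>y. insert y P) ` extensions V E P \<subseteq> {Q \<in> cliques V E k. e \<subseteq> Q}" using ins(1) P(2) by blast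
  qed (simp add: V)
  finally show ?thesis .
qed

text \<open>Count pairs of a red edge and a clique containing it. Such a clique is not blue, hence
  new, and no \<open>k\<close>-clique contains more than \<open>k * k\<close> red edges.\<close>

lemma weight_le_cliques:
  assumes V: "finite V" and R: "finite R" "\<And>e. e \<in> R \<Longrightarrow> card e = 2" and BR: "B \<inter> R = {}"
    and many: "\<And>e. e \<in> R \<Longrightarrow> k * k \<le> card {Q \<in> cliques V (B \<union> R) k. e \<subseteq> Q}" and k: "k > 0"
  shows "card (cliques V B k) + card R \<le> card (cliques V (B \<union> R) k)"
proof -
  let ?C = "cliques V (B \<union> R) k"
  let ?N = "?C - cliques V B k"
  have N: "finite ?N" using V by simp
  have "card R * (k * k) = (\<Sum>e\<in>R. k * k)" by simp
  also have "\<dots> \<le> (\<Sum>e\<in>R. card {Q \<in> ?N. e \<subseteq> Q})"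
  proof (rule sum_mono)
    fix e assume e: "e \<in> R"
    have "Q \<notin> cliques V B k" if "e \<subseteq> Q" for Q
    proof
      assume Q: "Q \<in> cliques V B k"
      obtain x y where xy: "e = {x, y}" "x \<noteq> y" using R(2)[OF e] by (auto simp: card_2_iff)
      then have "e \<in> B" using Q that by (auto simp: cliques_def)
      then show False using e BR by blast
    qed
    then have "{Q \<in> ?C. e \<subseteq> Q} = {Q \<in> ?N. e \<subseteq> Q}" by blast
    then show "k * k \<le> card {Q \<in> ?N. e \<subseteq> Q}" using many[OF e] by simp
  qed
  also have "\<dots> = (\<Sum>e\<in>R. \<Sum>Q\<in>?N. if e \<subseteq> Q then 1 else 0)"
    using N by (simp add: sum.If_cases Int_def)
  also have "\<dots> = (\<Sum>Q\<in>?N. \<Sum>e\<in>R. if e \<subseteq> Q then 1 else 0)" by (rule sum.swap)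
  also have "\<dots> \<le> (\<Sum>Q\<in>?N. k * k)"
  proof (rule sum_mono)
    fix Q assume Q: "Q \<in> ?N"
    then have fQ: "finite Q" "card Q = k" using cliques_finite[OF V, of Q] by (auto simp: cliques_def)
    have "(\<Sum>e\<in>R. if e \<subseteq> Q then 1 else 0) = card {e \<in> R. e \<subseteq> Q}"
      using R(1) by (simp add: sum.If_cases Int_def)
    also have "\<dots> \<le> card {e. e \<subseteq> Q \<and> card e = 2}" using fQ R(2) by (intro card_mono) auto
    also have "\<dots> \<le> k * k" using card_subsets_le[OF fQ(1), of 2] fQ(2) by (simp add: power2_eq_square)
    finally show "(\<Sum>e\<in>R. if e \<subseteq> Q then 1 else 0) \<le> k * k" .
  qed
  also have "\<dots> = card ?N * (k * k)" by simp
  finally have "card R \<le> card ?N" using k by simp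
  moreover have "cliques V B k \<subseteq> ?C" by (rule cliques_mono) auto
  then have "card ?N = card ?C - card (cliques V B k)" "card (cliques V B k) \<le> card ?C"
    using V by (auto intro: card_Diff_subset card_mono)
  ultimately show ?thesis by linarith
qed

text \<open>Cliques avoiding \<open>v\<close> survive, and those through \<open>v\<close> are
  exchanged for cliques in \<open>S - {v}\<close>. The error \<open>card V ^ m\<close> covers
  cliques of \<open>S\<close> containing \<open>v\<close> itself, the error \<open>card V\<close>
  the red edges lost at \<open>v\<close>.\<close>

lemma clone_weight:
  assumes V: "finite V" and R: "finite R" "\<And>e. e \<in> R \<Longrightarrow> card e = 2 \<and> e \<subseteq> V" and B: "loopless B"
    and v: "v \<in> V" and S: "S \<subseteq> V"
    and le: "card (cliques V (clone B v S) (m + 2)) + card {e \<in> R. v \<notin> e} \<le> card (cliques V B (m + 2)) + card R"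
  shows "card (cliques S B (m + 1)) \<le> card (cliques (extensions V B {v}) B (m + 1)) + card V ^ m + card V"
proof -
  let ?B' = "clone B v S"
  have fS: "finite S" using V S by (rule finite_subset[rotated])
  let ?X = "{Q \<in> cliques V B (m + 2). v \<notin> Q}" and ?Y = "{Q \<in> cliques V B (m + 2). v \<in> Q}"
  let ?Z = "cliques (S - {v}) B (m + 1)"
  have sub: "?X \<union> insert v ` ?Z \<subseteq> cliques V ?B' (m + 2)"
  proof
    fix Q assume "Q \<in> ?X \<union> insert v ` ?Z"
    then consider "Q \<in> ?X" | P where "P \<in> ?Z" "Q = insert v P" by blast
    then show "Q \<in> cliques V ?B' (m + 2)"
    proof cases
      case 1
      then show ?thesis by (auto simp: cliques_def clone_def)
    next
      case 2
      have P: "P \<subseteq> S - {v}" "card P = m + 1" "\<And>x y. x \<in> P \<Longrightarrow> y \<in> P \<Longrightarrow> x \<noteq> y \<Longrightarrow> {x, y} \<in> B"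
        using 2(1) by (auto simp: cliques_def)
      then have "v \<notin> P" "finite P" using fS finite_subset[of P S] by auto
      then have "card Q = m + 2" using P(2) 2(2) by simp
      moreover have "Q \<subseteq> V" using P(1) S v 2(2) by blast
      moreover have "{x, y} \<in> ?B'" if "x \<in> Q" "y \<in> Q" "x \<noteq> y" for x y
        using that P(1,3) 2(2) \<open>v \<notin> P\<close> unfolding clone_def
        by (cases "x = v"; cases "y = v") (auto simp: insert_commute)
      ultimately show ?thesis by (simp add: cliques_def)
    qed
  qed
  have fZ: "finite ?Z" using fS by simp
  have injZ: "inj_on (insert v) ?Z"
  proof (rule inj_onI)
    fix P P' assume "P \<in> ?Z" "P' \<in> ?Z" "insert v P = insert v P'"
    moreover from this have "v \<notin> P" "v \<notin> P'" by (auto simp: cliques_def)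
    ultimately show "P = P'" by (simp add: insert_ident)
  qed
  have "card ?X + card ?Z = card ?X + card (insert v ` ?Z)" using injZ by (simp add: card_image)
  also have "\<dots> = card (?X \<union> insert v ` ?Z)"
    using V fZ by (intro card_Un_disjoint[symmetric]) auto
  also have "\<dots> \<le> card (cliques V ?B' (m + 2))" using V by (intro card_mono[OF _ sub]) simp
  finally have 1: "card ?X + card ?Z \<le> card (cliques V ?B' (m + 2))" .
  have "cliques V B (m + 2) = ?X \<union> ?Y" by blast
  then have "card (cliques V B (m + 2)) \<le> card ?X + card ?Y" using card_Un_le by metis
  moreover have "card ?Y \<le> card (cliques (extensions V B {v}) B (m + 1))"
  proof (rule card_inj_on_le)
    show "inj_on (\<lambda>Q. Q - {v}) ?Y" by (auto simp: inj_on_def)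
    show "(\<lambda>Q. Q - {v}) ` ?Y \<subseteq> cliques (extensions V B {v}) B (m + 1)"
    proof clarify
      fix Q assume Q: "Q \<in> cliques V B (m + 2)" "v \<in> Q"
      have "Q - {v} \<in> cliques V B (m + 1)" using remove_cliques(1)[OF V, of Q B "m + 1" v] Q by simp
      moreover have "Q - {v} \<subseteq> extensions V B {v}" using Q by (auto simp: cliques_def extensions_def)
      ultimately show "Q - {v} \<in> cliques (extensions V B {v}) B (m + 1)" by (simp add: cliques_def)
    qed
  qed (use V in simp)
  moreover have "card R \<le> card {e \<in> R. v \<notin> e} + card V"
  proof -
    have "R \<subseteq> {e \<in> R. v \<notin> e} \<union> (\<lambda>x. {v, x}) ` V"
    proof
      fix e assume e: "e \<in> R"
      then obtain x y where "e = {x, y}" "x \<in> V" "y \<in> V" using R(2)[OF e] by (auto simp: card_2_iff)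
      then show "e \<in> {e \<in> R. v \<notin> e} \<union> (\<lambda>x. {v, x}) ` V" using e by (auto simp: insert_commute)
    qed
    then have "card R \<le> card ({e \<in> R. v \<notin> e} \<union> (\<lambda>x. {v, x}) ` V)" using R V by (intro card_mono) auto
    also have "\<dots> \<le> card {e \<in> R. v \<notin> e} + card ((\<lambda>x. {v, x}) ` V)" by (rule card_Un_le)
    also have "card ((\<lambda>x. {v, x}) ` V) \<le> card V" by (rule card_image_le[OF V])
    finally show ?thesis by simp
  qed
  moreover have "card (cliques S B (m + 1)) \<le> card ?Z + card V ^ m"
  proof -
    let ?U = "{Q \<in> cliques V B (Suc m). Q \<inter> {v} \<noteq> {}}"
    have "cliques S B (m + 1) \<subseteq> ?Z \<union> ?U" using S by (auto simp: cliques_def)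
    then have "card (cliques S B (m + 1)) \<le> card (?Z \<union> ?U)" using fZ V by (intro card_mono) auto
    also have "\<dots> \<le> card ?Z + card ?U" by (rule card_Un_le)
    also have "card ?U \<le> card {v} * card V ^ m" using v by (intro card_cliques_meeting[OF V]) simp
    finally show ?thesis by simp
  qed
  ultimately show ?thesis using 1 le by linarith
qed

section \<open>Berge copies and red-blue graphs\<close>

text \<open>Rado's proof: as long as some set has two elements, one of them can be removed.\<close>

lemma hall:
  assumes "finite A" and "\<And>a. a \<in> A \<Longrightarrow> finite (N a)" and "\<And>X. X \<subseteq> A \<Longrightarrow> card X \<le> card (\<Union>(N ` X))"
  shows "\<exists>f. inj_on f A \<and> (\<forall>a\<in>A. f a \<in> N a)"
  using assms
proof (induction "\<Sum>a\<in>A. card (N a)" arbitrary: N rule: less_induct)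
  case (less N)
  note fin = less.prems(1,2) and hall = less.prems(3)
  show ?case
  proof (cases "\<exists>a\<in>A. card (N a) \<ge> 2")
    case True
    then obtain a where a: "a \<in> A" "card (N a) \<ge> 2" by blast
    then obtain Z where "Z \<subseteq> N a" "card Z = 2" using obtain_subset_with_card_n by metis
    then obtain x y where xy: "x \<in> N a" "y \<in> N a" "x \<noteq> y" by (auto simp: card_2_iff)
    define N' where "N' z = N(a := N a - {z})" for z
    have use: "\<exists>f. inj_on f A \<and> (\<forall>a\<in>A. f a \<in> N a)"
      if z: "z \<in> N a" and H: "\<And>X. X \<subseteq> A \<Longrightarrow> card X \<le> card (\<Union>(N' z ` X))" for z
    proof -
      have "(\<Sum>b\<in>A. card (N' z b)) < (\<Sum>b\<in>A. card (N b))"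
      proof (rule sum_strict_mono_ex1[OF fin(1)])
        show "\<forall>b\<in>A. card (N' z b) \<le> card (N b)"
          using fin(2) by (auto simp: N'_def intro: card_mono)
        show "\<exists>b\<in>A. card (N' z b) < card (N b)"
          using a(1) z fin(2)[OF a(1)] by (intro bexI[of _ a]) (simp_all only: N'_def fun_upd_same card_Diff1_less)
      qed
      then obtain f where f: "inj_on f A" "\<forall>b\<in>A. f b \<in> N' z b"
        using less.hyps[of "N' z"] fin H by (force simp: N'_def)
      then show ?thesis by (intro exI[of _ f]) (auto simp: N'_def split: if_splits)
    qed
    have viol: "\<exists>Y\<subseteq>A - {a}. card (\<Union>(N ` Y) \<union> (N a - {z})) \<le> card Y"
      if H: "\<not> (\<forall>X. X \<subseteq> A \<longrightarrow> card X \<le> card (\<Union>(N' z ` X)))" for z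
    proof -
      obtain X where X: "X \<subseteq> A" "card (\<Union>(N' z ` X)) < card X" using H by (auto simp: not_le)
      have aX: "a \<in> X"
      proof (rule ccontr)
        assume "a \<notin> X"
        then have "N' z ` X = N ` X" by (intro image_cong) (auto simp: N'_def)
        then show False using X hall[OF X(1)] by simp
      qed
      have "\<Union>(N' z ` X) = \<Union>(N ` (X - {a})) \<union> (N a - {z})"
        using aX by (auto simp: N'_def split: if_splits)
      moreover have "card X = Suc (card (X - {a}))"
        using card_Suc_Diff1[OF finite_subset[OF X(1) fin(1)] aX] by simp
      ultimately show ?thesis using X by (intro exI[of _ "X - {a}"]) auto
    qed
    show ?thesis
    proof (rule ccontr)
      assume contra: "\<not> ?thesis"
      have "\<not> (\<forall>X. X \<subseteq> A \<longrightarrow> card X \<le> card (\<Union>(N' z ` X)))" if "z \<in> N a" for z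
        using use[OF that] contra by blast
      then obtain Y1 Y2 where Y1: "Y1 \<subseteq> A - {a}" "card (\<Union>(N ` Y1) \<union> (N a - {x})) \<le> card Y1"
        and Y2: "Y2 \<subseteq> A - {a}" "card (\<Union>(N ` Y2) \<union> (N a - {y})) \<le> card Y2"
        using viol xy by meson
      let ?U1 = "\<Union>(N ` Y1) \<union> (N a - {x})" and ?U2 = "\<Union>(N ` Y2) \<union> (N a - {y})"
      have fY: "finite Y1" "finite Y2" using Y1 Y2 fin(1) by (auto intro: finite_subset)
      have fU: "finite ?U1" "finite ?U2" using fY fin(2) Y1 Y2 a(1) by auto
      have "card (insert a (Y1 \<union> Y2)) \<le> card (\<Union>(N ` insert a (Y1 \<union> Y2)))"
        using Y1 Y2 a by (intro hall) auto
      \<comment> \<open>As \<open>x \<noteq> y\<close>, the two reduced neighbourhoods together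
        cover \<open>N a\<close>. Adding the Hall inequalities for union and intersection then
        contradicts the two violations, with a surplus of one coming from \<open>a\<close>.\<close>
      also have "\<Union>(N ` insert a (Y1 \<union> Y2)) = ?U1 \<union> ?U2" using xy by auto
      finally have 1: "Suc (card (Y1 \<union> Y2)) \<le> card (?U1 \<union> ?U2)"
        using fY Y1 Y2 by (subst (asm) card_insert_disjoint) auto
      have "card (Y1 \<inter> Y2) \<le> card (\<Union>(N ` (Y1 \<inter> Y2)))" using Y1 by (intro hall) auto
      also have "\<dots> \<le> card (?U1 \<inter> ?U2)" using fU by (intro card_mono) auto
      finally have 2: "card (Y1 \<inter> Y2) \<le> card (?U1 \<inter> ?U2)" .
      show False using 1 2 card_Un_Int[OF fU] card_Un_Int[OF fY] Y1(2) Y2(2) by linarith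
    qed
  next
    case False
    have "\<exists>b. N a = {b}" if "a \<in> A" for a
    proof -
      have "1 \<le> card (N a)" using hall[of "{a}"] that by simp
      moreover have "card (N a) < 2" using False that by force
      ultimately have "card (N a) = 1" by linarith
      then show ?thesis by (rule card_1_singletonE) blast
    qed
    then obtain f where f: "\<And>a. a \<in> A \<Longrightarrow> N a = {f a}" by metis
    have "inj_on f A"
    proof (rule inj_onI, rule ccontr)
      fix a b assume ab: "a \<in> A" "b \<in> A" "f a = f b" "a \<noteq> b"
      then show False using hall[of "{a, b}"] f[of a] f[of b] by simp
    qed
    then show ?thesis using f by (intro exI[of _ f]) auto
  qed
qed

text \<open>Take \<open>A1\<close> of maximal deficiency and apply Hall's theorem on both sides.\<close>

lemma hall_decomposition:
  assumes A: "finite A" and N: "\<And>a. a \<in> A \<Longrightarrow> finite (N a)"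
  shows "\<exists>A1\<subseteq>A. (\<exists>f. inj_on f (A - A1) \<and> (\<forall>a\<in>A - A1. f a \<in> N a - \<Union>(N ` A1))) \<and>
    (\<exists>g. inj_on g (\<Union>(N ` A1)) \<and> (\<forall>b\<in>\<Union>(N ` A1). g b \<in> A1 \<and> b \<in> N (g b)))"
proof -
  define d where "d X = int (card X) - int (card (\<Union>(N ` X)))" for X
  have "Max (d ` Pow A) \<in> d ` Pow A" using A by (intro Max_in) auto
  then obtain A1 where A1: "A1 \<subseteq> A" "d A1 = Max (d ` Pow A)" by auto
  have max: "d X \<le> d A1" if "X \<subseteq> A" for X using A1(2) A that by simp
  let ?B = "\<Union>(N ` A1)"
  have fA1: "finite A1" using A1 A by (auto intro: finite_subset)
  have fB: "finite ?B" using fA1 N A1 by auto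
  have "\<exists>f. inj_on f (A - A1) \<and> (\<forall>a\<in>A - A1. f a \<in> N a - ?B)"
  proof (rule hall)
    fix X assume X: "X \<subseteq> A - A1"
    then have fX: "finite X" using A by (auto intro: finite_subset)
    have fN: "finite (\<Union>((\<lambda>a. N a - ?B) ` X))" using fX N X by auto
    have "\<Union>(N ` (A1 \<union> X)) = ?B \<union> \<Union>((\<lambda>a. N a - ?B) ` X)" by auto
    then have "card (\<Union>(N ` (A1 \<union> X))) = card ?B + card (\<Union>((\<lambda>a. N a - ?B) ` X))"
      using fB fN by (simp only:) (rule card_Un_disjoint, auto)
    moreover have "card (A1 \<union> X) = card A1 + card X"
      using fA1 fX X by (intro card_Un_disjoint) auto
    moreover have "A1 \<union> X \<subseteq> A" using A1(1) X by blast
    then have "d (A1 \<union> X) \<le> d A1" by (rule max)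
    ultimately show "card X \<le> card (\<Union>((\<lambda>a. N a - ?B) ` X))" unfolding d_def by linarith
  qed (use A N in auto)
  moreover have "\<exists>g. inj_on g ?B \<and> (\<forall>b\<in>?B. g b \<in> {a \<in> A1. b \<in> N a})"
  proof (rule hall[OF fB])
    fix Y assume Y: "Y \<subseteq> ?B"
    let ?M = "\<Union>((\<lambda>b. {a \<in> A1. b \<in> N a}) ` Y)"
    have M: "?M \<subseteq> A1" by auto
    have fY: "finite Y" using Y fB by (rule finite_subset)
    \<comment> \<open>Discarding all members of \<open>A1\<close> that meet \<open>Y\<close> removes
      \<open>Y\<close> from the joint neighbourhood; if fewer than \<open>card Y\<close> members
      were discarded, the deficiency would rise.\<close>
    have "\<Union>(N ` (A1 - ?M)) \<subseteq> ?B - Y" by auto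
    then have "card (\<Union>(N ` (A1 - ?M))) \<le> card ?B - card Y"
      using card_mono[of "?B - Y" "\<Union>(N ` (A1 - ?M))"] fB fY Y by (simp add: card_Diff_subset)
    moreover have "card Y \<le> card ?B" using card_mono[OF fB Y] .
    moreover have "card (A1 - ?M) = card A1 - card ?M" "card ?M \<le> card A1"
      using M fA1 by (auto intro: card_Diff_subset finite_subset card_mono)
    moreover have "A1 - ?M \<subseteq> A" using A1(1) by blast
    then have "d (A1 - ?M) \<le> d A1" by (rule max)
    ultimately show "card Y \<le> card ?M" unfolding d_def by linarith
  qed (use fA1 in auto)
  ultimately show ?thesis using A1(1) by (intro exI[of _ A1]) auto
qed

lemma isomorphic_image:
  assumes "inj_on \<phi> (verts F)"
  shows "isomorphic F (\<phi> ` verts F, (\<lambda>e. \<phi> ` e) ` edges F)"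
  unfolding isomorphic_def using assms by (intro exI[of _ \<phi>]) (auto simp: bij_betw_def)

text \<open>Hall's theorem is applied to hyperedges and the pairs they contain. All pairs inside
  hyperedges of \<open>A1\<close> become blue, so \<open>A1\<close> consists of blue cliques, and
  each remaining hyperedge gets its own red pair. Distinct coloured pairs are assigned distinct
  hyperedges containing them, so a copy of \<open>F\<close> would be the core of a Berge
  copy.\<close>

lemma berge_free_red_blue:
  fixes F :: "'a hypergraph" and H :: "'b hypergraph"
  assumes F: "graph F" and H: "uniform k H" and free: "berge_free F H"
  shows "\<exists>B R. B \<inter> R = {} \<and> (\<forall>e\<in>B \<union> R. e \<subseteq> verts H \<and> card e = 2) \<and> \<not> embeds F (verts H) (B \<union> R) \<and>
    card (edges H) \<le> card (cliques (verts H) B k) + card R"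
proof -
  let ?V = "verts H" and ?A = "edges H"
  have V: "finite ?V" and A: "\<And>h. h \<in> ?A \<Longrightarrow> h \<subseteq> ?V" "\<And>h. h \<in> ?A \<Longrightarrow> card h = k"
    using H by (auto simp: uniform_def hypergraph_def)
  have fA: "finite ?A" by (rule finite_subset[of _ "Pow ?V"]) (use A V in auto)
  define N :: "'b set \<Rightarrow> 'b set set" where "N h = {e. e \<subseteq> h \<and> card e = 2}" for h
  have fN: "finite (N h)" if "h \<in> ?A" for h
  proof -
    have "finite h" using A(1)[OF that] V by (rule finite_subset)
    then show ?thesis by (auto simp: N_def intro: finite_subset[of _ "Pow h"])
  qed
  obtain A1 f g where A1: "A1 \<subseteq> ?A" and f: "inj_on f (?A - A1)" "\<And>h. h \<in> ?A - A1 \<Longrightarrow> f h \<in> N h - \<Union>(N ` A1)"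
    and g: "inj_on g (\<Union>(N ` A1))" "\<And>e. e \<in> \<Union>(N ` A1) \<Longrightarrow> g e \<in> A1 \<and> e \<in> N (g e)"
    using hall_decomposition[of ?A N, OF fA fN] by metis
  define B where "B = \<Union>(N ` A1)"
  define R where "R = f ` (?A - A1)"
  have BR: "B \<inter> R = {}" using f(2) by (auto simp: B_def R_def)
  have pairs: "e \<subseteq> ?V \<and> card e = 2" if "e \<in> B \<union> R" for e
    using that A(1) A1 f(2) by (fastforce simp: B_def R_def N_def)
  define \<psi> where "\<psi> e = (if e \<in> B then g e else inv_into (?A - A1) f e)" for e
  have \<psi>: "\<psi> e \<in> ?A" "e \<subseteq> \<psi> e" if "e \<in> B \<union> R" for e
  proof -
    have "\<psi> e \<in> ?A \<and> e \<subseteq> \<psi> e"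
    proof (cases "e \<in> B")
      case True
      then show ?thesis using g(2)[of e] A1 by (auto simp: \<psi>_def B_def N_def)
    next
      case False
      then have e: "e \<in> f ` (?A - A1)" using that by (auto simp: R_def)
      then have "inv_into (?A - A1) f e \<in> ?A - A1" "f (inv_into (?A - A1) f e) = e"
        by (rule inv_into_into, rule f_inv_into_f)
      then show ?thesis using False f(2)[of "inv_into (?A - A1) f e"] by (auto simp: \<psi>_def N_def)
    qed
    then show "\<psi> e \<in> ?A" "e \<subseteq> \<psi> e" by auto
  qed
  have "inj_on \<psi> (B \<union> R)"
  proof -
    have "inj_on \<psi> B" using g(1) by (auto simp: \<psi>_def B_def inj_on_def)
    moreover have "inj_on \<psi> R"
    proof -
      have "inj_on (inv_into (?A - A1) f) R" unfolding R_def by (rule inj_on_inv_into) simp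
      moreover have "\<psi> e = inv_into (?A - A1) f e" if "e \<in> R" for e using that BR by (auto simp: \<psi>_def)
      ultimately show ?thesis by (simp add: inj_on_def)
    qed
    moreover have "\<psi> ` B \<subseteq> A1" using g(2) by (auto simp: \<psi>_def B_def)
    moreover have "\<psi> ` R \<inter> A1 = {}"
    proof -
      have "\<psi> e \<notin> A1" if "e \<in> R" for e
        using that BR inv_into_into[of e f "?A - A1"] by (auto simp: \<psi>_def R_def)
      then show ?thesis by blast
    qed
    ultimately show ?thesis by (subst inj_on_Un) blast
  qed
  have nemb: "\<not> embeds F ?V (B \<union> R)"
  proof
    assume "embeds F ?V (B \<union> R)"
    then obtain \<phi> where \<phi>: "inj_on \<phi> (verts F)" "\<phi> ` verts F \<subseteq> ?V" "\<And>e. e \<in> edges F \<Longrightarrow> \<phi> ` e \<in> B \<union> R"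
      unfolding embeds_def by blast
    define G where "G = (\<phi> ` verts F, (\<lambda>e. \<phi> ` e) ` edges F)"
    define S where "S = (?V, \<psi> ` edges G)"
    have G: "edges G \<subseteq> B \<union> R" using \<phi>(3) by (auto simp: G_def)
    have "isomorphic F G" unfolding G_def by (rule isomorphic_image[OF \<phi>(1)])
    moreover have "edges S \<subseteq> ?A" using \<psi>(1) G by (auto simp: S_def)
    then have "subhypergraph S H" using V A(1) by (auto simp: subhypergraph_def hypergraph_def S_def)
    moreover have "is_berge S G" unfolding is_berge_def
    proof (intro conjI exI[of _ "inv_into (edges G) \<psi>"] ballI)
      have inj: "inj_on \<psi> (edges G)" using \<open>inj_on \<psi> (B \<union> R)\<close> G by (rule inj_on_subset)
      show "verts G \<subseteq> verts S" using \<phi>(2) by (simp add: G_def S_def)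
      show "bij_betw (inv_into (edges G) \<psi>) (edges S) (edges G)"
        unfolding S_def snd_conv by (rule bij_betw_inv_into) (use inj in \<open>simp add: bij_betw_def\<close>)
      fix h assume "h \<in> edges S"
      then obtain e where e: "e \<in> edges G" "h = \<psi> e" by (auto simp: S_def)
      then show "inv_into (edges G) \<psi> h \<subseteq> h" using \<psi>(2)[of e] G inv_into_f_f[OF inj e(1)] by auto
    qed
    ultimately show False using free unfolding berge_free_def by blast
  qed
  have "A1 \<subseteq> cliques ?V B k"
  proof
    fix h assume h: "h \<in> A1"
    then show "h \<in> cliques ?V B k" using A A1 by (auto simp: cliques_def B_def N_def)
  qed
  then have "card A1 \<le> card (cliques ?V B k)" using V by (intro card_mono) auto
  moreover have "card (?A - A1) = card R" unfolding R_def using f(1) by (simp add: card_image)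
  moreover have "card ?A = card A1 + card (?A - A1)"
    using A1 fA by (simp add: card_Diff_subset finite_subset card_mono)
  ultimately show ?thesis using BR pairs nemb by (intro exI[of _ B] exI[of _ R]) auto
qed

text \<open>In a Berge copy every core edge lies inside a hyperedge, that is, inside a clique of the
  graph, and so is an edge of the graph.\<close>

lemma berge_free_cliques:
  assumes F: "graph F" and V: "finite V" and E: "\<And>e. e \<in> E \<Longrightarrow> e \<subseteq> V" and free: "\<not> embeds F V E"
  shows "uniform k (V, cliques V E k)" "berge_free F (V, cliques V E k)"
proof -
  show "uniform k (V, cliques V E k)" using V by (auto simp: uniform_def hypergraph_def cliques_def)
  show "berge_free F (V, cliques V E k)" unfolding berge_free_def
  proof (intro notI, elim exE conjE)
    fix S G :: "'b hypergraph"
    assume S: "subhypergraph S (V, cliques V E k)" and iso: "isomorphic F G" and berge: "is_berge S G"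
    obtain f where f: "bij_betw f (verts F) (verts G)" "(\<lambda>e. f ` e) ` edges F = edges G"
      using iso by (auto simp: isomorphic_def)
    obtain \<phi> where \<phi>: "bij_betw \<phi> (edges S) (edges G)" "\<And>h. h \<in> edges S \<Longrightarrow> \<phi> h \<subseteq> h"
      using berge by (auto simp: is_berge_def)
    have "f ` e \<in> E" if e: "e \<in> edges F" for e
    proof -
      obtain x y where xy: "e = {x, y}" "x \<noteq> y" "x \<in> verts F" "y \<in> verts F"
        using graph_edge[OF F e] .
      then have ne: "f x \<noteq> f y" using f(1) by (auto simp: bij_betw_def inj_on_def)
      have "f ` e \<in> edges G" using f(2) e by blast
      then have "f ` e \<in> \<phi> ` edges S" using \<phi>(1) by (simp add: bij_betw_def)
      then obtain h where h: "h \<in> edges S" "\<phi> h = f ` e" by (metis imageE)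
      then have "h \<in> cliques V E k" using S by (auto simp: subhypergraph_def)
      moreover have "f x \<in> h" "f y \<in> h" using \<phi>(2)[OF h(1)] h(2) xy by auto
      ultimately show ?thesis using ne xy(1) by (simp add: cliques_def)
    qed
    moreover have "f ` verts F \<subseteq> V"
      using f(1) berge S by (auto simp: bij_betw_def is_berge_def subhypergraph_def)
    ultimately have "embeds F V E" unfolding embeds_def using f(1)
      by (intro exI[of _ f]) (auto simp: bij_betw_def)
    then show False using free by simp
  qed
qed

section \<open>Copies of complete graphs as cliques\<close>

lemma image_pairs:
  assumes "bij_betw f A B"
  shows "(\<lambda>e. f ` e) ` {e. e \<subseteq> A \<and> card e = 2} = {e. e \<subseteq> B \<and> card e = 2}"
proof (intro equalityI subsetI)
  fix e assume "e \<in> (\<lambda>e. f ` e) ` {e. e \<subseteq> A \<and> card e = 2}"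
  then obtain d where d: "d \<subseteq> A" "card d = 2" "e = f ` d" by auto
  have "card (f ` d) = card d" using assms d(1) by (intro card_image) (auto simp: bij_betw_def intro: inj_on_subset)
  then show "e \<in> {e. e \<subseteq> B \<and> card e = 2}" using d assms by (auto simp: bij_betw_def)
next
  fix e assume e: "e \<in> {e. e \<subseteq> B \<and> card e = 2}"
  then obtain d where d: "d \<subseteq> A" "e = f ` d" using assms by (auto simp: bij_betw_def subset_image_iff)
  have "card (f ` d) = card d" using assms d(1) by (intro card_image) (auto simp: bij_betw_def intro: inj_on_subset)
  then show "e \<in> (\<lambda>e. f ` e) ` {e. e \<subseteq> A \<and> card e = 2}" using d e by auto
qed

lemma copies_complete_graph:
  assumes V: "finite V"
  shows "copies (complete_graph k) (V, E) = card (cliques V E k)"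
proof -
  let ?c = "\<lambda>Q. (Q, {e. e \<subseteq> Q \<and> card e = 2})"
  have "{S. subhypergraph S (V, E) \<and> isomorphic (complete_graph k) S} = ?c ` cliques V E k"
  proof (intro equalityI subsetI)
    fix S assume "S \<in> {S. subhypergraph S (V, E) \<and> isomorphic (complete_graph k) S}"
    then have S: "verts S \<subseteq> V" "edges S \<subseteq> E" and "isomorphic (complete_graph k) S"
      by (auto simp: subhypergraph_def)
    then obtain f where f: "bij_betw f {..<k} (verts S)"
      "(\<lambda>e. f ` e) ` {e. e \<subseteq> {..<k} \<and> card e = 2} = edges S"
      by (auto simp: isomorphic_def complete_graph_def)
    have e: "edges S = {e. e \<subseteq> verts S \<and> card e = 2}" using image_pairs[OF f(1)] f(2) by simp
    have "card (verts S) = k" using bij_betw_same_card[OF f(1)] by simp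
    moreover have "{x, y} \<in> E" if "x \<in> verts S" "y \<in> verts S" "x \<noteq> y" for x y
      using that S(2) unfolding e by auto
    ultimately have "verts S \<in> cliques V E k" using S(1) by (simp add: cliques_def)
    moreover have "S = ?c (verts S)" using e by (simp add: prod_eq_iff)
    ultimately show "S \<in> ?c ` cliques V E k" by blast
  next
    fix S assume "S \<in> ?c ` cliques V E k"
    then obtain Q where Q: "Q \<in> cliques V E k" "S = ?c Q" by blast
    have fQ: "finite Q" "card Q = k" using Q(1) V by (auto simp: cliques_def intro: finite_subset)
    then obtain f where f: "bij_betw f {..<k} Q"
      by (metis bij_betw_iff_card card_lessThan finite_lessThan)
    have "isomorphic (complete_graph k) S" unfolding isomorphic_def complete_graph_def
      using f image_pairs[OF f] Q(2) by auto
    moreover have "subhypergraph S (V, E)"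
      using Q fQ by (auto simp: subhypergraph_def hypergraph_def cliques_def card_2_iff)
    ultimately show "S \<in> {S. subhypergraph S (V, E) \<and> isomorphic (complete_graph k) S}" by blast
  qed
  then show ?thesis unfolding copies_def by (simp add: card_image inj_on_def)
qed

section \<open>Maximal red-blue graphs\<close>

text \<open>At \<open>\<theta> = 1 / (r - 1)\<close> and \<open>\<mu> = (r - 1) / r\<close> the last inequality would hold with equality for
  the upper bound of \<open>lam\<close>, which leaves room for smaller values.\<close>

lemma parameters_degree:
  fixes \<mu> :: real
  assumes r: "m + 2 \<le> r" and \<mu>: "0 < \<mu>" "\<mu> < (real r - 1) / r"
  shows "\<exists>lam \<theta>. 0 < lam \<and> lam < (\<Prod>s<m + 2. 1 - real s * (1 / r)) \<and> 0 < \<theta> \<and> (real r - 1) * \<theta> < 1 \<and>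
    \<mu> ^ (m + 1) * (\<Prod>s<m + 1. 1 - real s * \<theta>) < lam"
proof -
  let ?L = "\<Prod>s<m + 2. 1 - real s * (1 / r)"
  let ?P = "\<lambda>\<theta>. \<Prod>s<m + 1. 1 - real s * \<theta>"
  let ?b = "1 / (real r - 1)"
  have r1: "real r - 1 > 0" using r by simp
  have "?L = (\<Prod>s<Suc (m + 1). 1 - real s * (1 / r))" by simp
  also have "\<dots> = (\<Prod>s<m + 1. 1 - real (Suc s) * (1 / r))"
    unfolding prod.lessThan_Suc_shift by simp
  \<comment> \<open>In the Turan graph a neighbourhood is itself a Turan graph, with
    \<open>r - 1\<close> parts on a fraction \<open>(r - 1) / r\<close> of the vertices; the
    factorisation expresses this.\<close>
  also have "\<dots> = (\<Prod>s<m + 1. (real r - 1) / r * (1 - real s * ?b))"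
    using r1 by (intro prod.cong) (auto simp: field_simps)
  also have "\<dots> = ((real r - 1) / r) ^ (m + 1) * ?P ?b"
    by (simp only: prod.distrib prod_constant card_lessThan)
  finally have L: "?L = ((real r - 1) / r) ^ (m + 1) * ?P ?b" .
  have "?P ?b > 0" using r r1 by (intro prod_pos) (auto simp: field_simps)
  moreover have "\<mu> ^ (m + 1) < ((real r - 1) / r) ^ (m + 1)" using \<mu> by (intro power_strict_mono) auto
  ultimately have lt: "\<mu> ^ (m + 1) * ?P ?b < ?L" unfolding L by (rule mult_strict_right_mono[rotated])
  have x0: "0 < \<mu> ^ (m + 1) * ?P ?b" using \<mu> \<open>?P ?b > 0\<close> by simp
  obtain lam where lam': "\<mu> ^ (m + 1) * ?P ?b < lam" "lam < ?L" using dense[OF lt] by blast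
  have lam: "0 < lam" "lam < ?L" "\<mu> ^ (m + 1) * ?P ?b < lam" by (rule less_trans[OF x0 lam'(1)]) (fact lam')+
  have "((\<lambda>\<theta>. \<mu> ^ (m + 1) * ?P \<theta>) \<longlongrightarrow> \<mu> ^ (m + 1) * ?P ?b) (at_left ?b)"
    by (intro tendsto_intros)
  then have "\<forall>\<^sub>F \<theta> in at_left ?b. \<mu> ^ (m + 1) * ?P \<theta> < lam" using lam(3) by (rule order_tendstoD(2))
  moreover have "\<forall>\<^sub>F \<theta> in at_left ?b. \<theta> \<in> {0<..<?b}" using r1 by (intro eventually_at_left_real) simp
  ultimately have "\<forall>\<^sub>F \<theta> in at_left ?b. \<mu> ^ (m + 1) * ?P \<theta> < lam \<and> \<theta> \<in> {0<..<?b}"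
    by (rule eventually_conj)
  then obtain \<theta> where \<theta>: "\<mu> ^ (m + 1) * ?P \<theta> < lam" "0 < \<theta>" "\<theta> < ?b"
    using eventually_happens[of _ "at_left ?b"] by (auto simp: trivial_limit_at_left_real)
  then have "(real r - 1) * \<theta> < 1" using r1 by (simp add: field_simps)
  then show ?thesis using lam \<theta> by blast
qed

text \<open>The parameter lies just above \<open>1 / r\<close>: above, so that the threshold is
  strictly below the Turan density and finite \<open>n\<close> can absorb error terms; close, so
  that Moon-Moser is almost tight at \<open>r\<close>-cliques.\<close>

lemma parameters_density:
  fixes \<epsilon> l :: real
  assumes r: "m + 2 \<le> r" and \<epsilon>: "\<epsilon> > 0" and l: "l < (\<Prod>s<m + 2. 1 - real s * (1 / r))"
  shows "\<exists>\<theta>>0. (real r - 1) * \<theta> < 1 \<and> 1 - \<epsilon> / 4 \<le> r * (1 - (real r - 1) * \<theta>) \<and>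
    l < (\<Prod>s<m + 2. 1 - real s * \<theta>) \<and>
    (\<Prod>s<m + 2. 1 - real s * \<theta>) < (\<Prod>s<m + 2. 1 - real s * (1 / r))"
proof -
  let ?P = "\<lambda>\<theta>. \<Prod>s<m + 2. 1 - real s * \<theta>"
  let ?a = "1 / real r" and ?b = "1 / (real r - 1)"
  let ?Q = "\<lambda>\<theta>. real r * (1 - (real r - 1) * \<theta>)"
  have r1: "real r - 1 > 0" "real r > 0" using r by auto
  have "(?P \<longlongrightarrow> ?P ?a) (at_right ?a)" by (intro tendsto_intros)
  then have "\<forall>\<^sub>F \<theta> in at_right ?a. l < ?P \<theta>" using l by (rule order_tendstoD(1))
  moreover have "(?Q \<longlongrightarrow> ?Q ?a) (at_right ?a)" by (intro tendsto_intros)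
  moreover have "?Q ?a = 1" using r1 by (simp add: field_simps)
  ultimately have "\<forall>\<^sub>F \<theta> in at_right ?a. l < ?P \<theta> \<and> 1 - \<epsilon> / 4 < ?Q \<theta>"
    using \<epsilon> by (intro eventually_conj order_tendstoD(1)[of ?Q "?Q ?a"]) auto
  moreover have "\<forall>\<^sub>F \<theta> in at_right ?a. \<theta> \<in> {?a<..<?b}"
    using r1 by (intro eventually_at_right_real) (simp add: field_simps)
  ultimately have "\<forall>\<^sub>F \<theta> in at_right ?a. (l < ?P \<theta> \<and> 1 - \<epsilon> / 4 < ?Q \<theta>) \<and> \<theta> \<in> {?a<..<?b}"
    by (rule eventually_conj)
  then obtain \<theta> where \<theta>: "l < ?P \<theta>" "1 - \<epsilon> / 4 < ?Q \<theta>" "?a < \<theta>" "\<theta> < ?b"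
    using eventually_happens[of _ "at_right ?a"] by (auto simp: trivial_limit_at_right_real)
  have \<theta>b: "(real r - 1) * \<theta> < 1" using \<theta>(4) r1 by (simp add: field_simps)
  have \<theta>0: "\<theta> > 0" using \<theta>(3) r1 by (meson less_trans zero_less_divide_1_iff)
  have factor: "0 \<le> 1 - real (Suc s) * \<theta>" "1 - real (Suc s) * \<theta> < 1 - real (Suc s) * ?a" if "s < m + 1" for s
  proof -
    have "real (Suc s) * \<theta> \<le> (real r - 1) * \<theta>" using that r \<theta>0 by (intro mult_right_mono) auto
    moreover have "real (Suc s) * ?a < real (Suc s) * \<theta>" using \<theta>(3) by (intro mult_strict_left_mono) auto
    ultimately show "0 \<le> 1 - real (Suc s) * \<theta>" "1 - real (Suc s) * \<theta> < 1 - real (Suc s) * ?a"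
      using \<theta>b by linarith+
  qed
  \<comment> \<open>The factor of index \<open>0\<close> is \<open>1\<close> on both sides and is
    dropped to compare all factors strictly.\<close>
  have "(\<Prod>s<m + 1. 1 - real (Suc s) * \<theta>) < (\<Prod>s<m + 1. 1 - real (Suc s) * ?a)"
  proof (rule prod_mono_strict[of 0])
    fix s assume "s \<in> {..<m + 1}"
    then have s: "s < m + 1" by simp
    show "0 \<le> 1 - real (Suc s) * \<theta> \<and> 1 - real (Suc s) * \<theta> \<le> 1 - real (Suc s) * ?a"
      using factor[OF s] by linarith
    show "0 < 1 - real (Suc s) * ?a" using factor[OF s] by linarith
  qed (use factor[of 0] in auto)
  moreover have "?P x = (\<Prod>s<m + 1. 1 - real (Suc s) * x)" for x
  proof -
    have "?P x = (\<Prod>s<Suc (m + 1). 1 - real s * x)" by simp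
    also have "\<dots> = (\<Prod>s<m + 1. 1 - real (Suc s) * x)" unfolding prod.lessThan_Suc_shift by simp
    finally show ?thesis .
  qed
  ultimately have "?P \<theta> < ?P ?a" by presburger
  then show ?thesis using \<theta> \<theta>0 \<theta>b by (intro exI[of _ \<theta>]) auto
qed

text \<open>The summands \<open>s / n\<close> are the rounding loss of a balanced colouring;
  \<open>c / n\<close> will absorb the red edges.\<close>

lemma parameters_size:
  fixes l c :: real
  assumes "l < (\<Prod>s<k. 1 - real s * (1 / r))"
  shows "\<exists>n0. \<forall>n\<ge>n0. l < (\<Prod>s<k. 1 - real s / r - real s / real n) - c / real n"
proof -
  have "((\<lambda>n. (\<Prod>s<k. 1 - real s / r - real s / real n) - c / real n) \<longlongrightarrow>
      (\<Prod>s<k. 1 - real s / r - 0) - 0) sequentially"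
    by (intro tendsto_intros lim_const_over_n)
  then have "\<forall>\<^sub>F n in sequentially. l < (\<Prod>s<k. 1 - real s / r - real s / real n) - c / real n"
    using assms by (intro order_tendstoD(1)) auto
  then show ?thesis by (simp add: eventually_sequentially)
qed

section \<open>Red-blue graphs and the existence of one of maximal weight\<close>

definition red_blue :: "'a hypergraph \<Rightarrow> 'b set \<Rightarrow> 'b set set \<Rightarrow> 'b set set \<Rightarrow> bool" where
  "red_blue F V B R \<longleftrightarrow> B \<inter> R = {} \<and> (\<forall>e\<in>B \<union> R. e \<subseteq> V \<and> card e = 2) \<and> \<not> embeds F V (B \<union> R)"

definition weight :: "nat \<Rightarrow> 'b set \<Rightarrow> 'b set set \<Rightarrow> 'b set set \<Rightarrow> nat" where
  "weight k V B R = card (cliques V B k) + card R"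

definition max_red_blue :: "nat \<Rightarrow> 'a hypergraph \<Rightarrow> 'b set \<Rightarrow> 'b set set \<Rightarrow> 'b set set \<Rightarrow> bool" where
  "max_red_blue k F V B R \<longleftrightarrow> red_blue F V B R \<and>
    (\<forall>B' R'. red_blue F V B' R' \<longrightarrow> weight k V B' R' \<le> weight k V B R)"

lemma card_pairs_le:
  assumes V: "finite V" and R: "\<And>e. e \<in> R \<Longrightarrow> e \<subseteq> V \<and> card e = 2"
  shows "finite R" "card R \<le> card V ^ 2"
proof -
  have sub: "R \<subseteq> {e. e \<subseteq> V \<and> card e = 2}" using R by blast
  moreover have fin: "finite {e. e \<subseteq> V \<and> card e = 2}" using V by simp
  ultimately show "finite R" by (rule finite_subset)
  show "card R \<le> card V ^ 2" using card_mono[OF fin sub] card_subsets_le[OF V, of 2] by linarith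
qed

lemma ex_max_red_blue:
  assumes V: "finite V" and rb: "red_blue F V B0 R0"
  shows "\<exists>B R. max_red_blue k F V B R \<and> weight k V B0 R0 \<le> weight k V B R"
proof -
  let ?P = "\<lambda>(B, R). red_blue F V B R" and ?w = "\<lambda>(B, R). weight k V B R"
  have "weight k V B R \<le> card V ^ k + card V ^ 2" if "red_blue F V B R" for B R
    using card_cliques_le[OF V, of B k] card_pairs_le(2)[OF V, of R] that
    unfolding red_blue_def weight_def by fastforce
  then have "\<exists>x. ?P x \<and> (\<forall>y. ?P y \<longrightarrow> ?w y \<le> ?w x)"
    by (intro ex_has_greatest_nat[where k = "(B0, R0)" and b = "Suc (card V ^ k + card V ^ 2)"])
      (use rb in \<open>auto simp: less_Suc_eq_le\<close>)
  then obtain B R where "red_blue F V B R" "\<And>B' R'. red_blue F V B' R' \<Longrightarrow> weight k V B' R' \<le> weight k V B R"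
    by auto
  then show ?thesis using rb unfolding max_red_blue_def by blast
qed

lemma red_blue_turan:
  assumes V: "finite V" and F: "\<not> colorable F r" and r: "r > 0" "r * r \<le> card V" "k \<le> r"
  shows "\<exists>E. red_blue F V E {} \<and>
    (\<Prod>s<k. 1 - real s / r - real s / card V) * real (card V) ^ k \<le> ordered_cliques V E k"
proof -
  obtain c where c: "\<And>y. y \<in> V \<Longrightarrow> c y < r" "\<And>i. card {y \<in> V. c y = i} \<le> card V div r + 1"
    using ex_balanced_colouring[OF V r(1)] by blast
  have "\<not> embeds F V (colour_edges V c)" by (rule not_embeds_colour_edges[OF F c(1)])
  then have "red_blue F V (colour_edges V c) {}"
    unfolding red_blue_def using colour_edges_card[of _ V c] by simp
  then show ?thesis using ordered_cliques_colour_edges[OF V r c(2)] by blast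
qed

lemma red_blue_loopless: "red_blue F V B R \<Longrightarrow> loopless (B \<union> R)" "red_blue F V B R \<Longrightarrow> loopless B"
  by (auto simp: red_blue_def loopless_def)

text \<open>The Turan graph, all blue, is a competitor. At most \<open>card V ^ 2\<close> of the
  weight is red, which is of lower order than \<open>card V ^ k\<close> because
  \<open>k \<ge> 3\<close>.\<close>

lemma max_red_blue_density:
  fixes \<theta> :: real
  assumes V: "finite V" "card V > 0" and F: "\<not> colorable F r" and r: "r > 0" "r * r \<le> card V" and k: "3 \<le> k" "k \<le> r"
    and dens: "(\<Prod>s<k. 1 - real s * \<theta>) < (\<Prod>s<k. 1 - real s / r - real s / real (card V)) - fact k / real (card V)"
    and max: "max_red_blue k F V B R"
  shows "(\<Prod>s<k. 1 - real s * \<theta>) * card V ^ k < ordered_cliques V B k"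
proof -
  let ?n = "real (card V)" and ?P = "\<Prod>s<k. 1 - real s / r - real s / real (card V)"
  obtain E where E: "red_blue F V E {}" "?P * ?n ^ k \<le> ordered_cliques V E k"
    using red_blue_turan[OF V(1) F r k(2)] by blast
  have "weight k V E {} \<le> weight k V B R" using max E(1) unfolding max_red_blue_def by blast
  moreover have "card R \<le> card V ^ 2"
    using max by (intro card_pairs_le[OF V(1)]) (auto simp: max_red_blue_def red_blue_def)
  ultimately have "card (cliques V E k) \<le> card (cliques V B k) + card V ^ 2" by (simp add: weight_def)
  then have "real (card (cliques V E k)) \<le> card (cliques V B k) + ?n ^ 2"
    by (metis of_nat_add of_nat_le_iff of_nat_power)
  then have "fact k * real (card (cliques V E k)) \<le> fact k * (card (cliques V B k) + ?n ^ 2)"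
    by (rule mult_left_mono) simp
  then have "ordered_cliques V E k \<le> ordered_cliques V B k + fact k * ?n ^ 2" by (simp add: ordered_cliques_def distrib_left)
  also have "?n ^ 2 \<le> ?n ^ (k - 1)" using V k by (intro power_increasing) auto
  then have "fact k * ?n ^ 2 \<le> fact k * ?n ^ (k - 1)" by (intro mult_left_mono) auto
  also have "\<dots> = fact k / ?n * ?n ^ k" using V k by (simp add: power_eq_if)
  finally have "(?P - fact k / ?n) * ?n ^ k \<le> ordered_cliques V B k" using E(2) by (simp add: left_diff_distrib)
  moreover have "(\<Prod>s<k. 1 - real s * \<theta>) * ?n ^ k < (?P - fact k / ?n) * ?n ^ k"
    using V dens by (intro mult_strict_right_mono) auto
  ultimately show ?thesis by simp
qed

context critical_graph
begin

text \<open>A positive proportion of all \<open>r\<close>-tuples are good blue cliques, so Erdos's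
  theorem yields a box all of whose transversals are good. Two edge sets occur since density is
  known for \<open>B\<close> but freeness for the larger \<open>E\<close>.\<close>

lemma ex_skeleton:
  fixes \<theta> \<epsilon> :: real
  assumes k: "1 \<le> k" "k \<le> r" and \<theta>: "\<theta> > 0" "(real r - 1) * \<theta> < 1"
    and \<epsilon>: "\<epsilon> > 0" "1 - \<epsilon> / 4 \<le> r * (1 - (real r - 1) * \<theta>)"
  shows "\<exists>n0. \<forall>(V :: 'b set) E B. finite V \<longrightarrow> n0 \<le> card V \<longrightarrow> loopless E \<longrightarrow> B \<subseteq> E \<longrightarrow> \<not> embeds F V E \<longrightarrow>
    (\<Prod>s<k. 1 - real s * \<theta>) * card V ^ k < ordered_cliques V B k \<longrightarrow>
    (\<exists>a. skeleton F t r v0 V E B a (t * t + 2 * t + 1) \<epsilon>)"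
proof -
  let ?s = "t * t + 2 * t + 1"
  define c where "c = (\<Prod>s<r. 1 - real s * \<theta>) / fact r"
  have "0 < 1 - real s * \<theta>" if "s < r" for s
  proof -
    have "real s * \<theta> \<le> (real r - 1) * \<theta>" using that \<theta> by (intro mult_right_mono) auto
    then show ?thesis using \<theta> by linarith
  qed
  then have c: "c > 0" unfolding c_def by (intro divide_pos_pos prod_pos) auto
  define \<gamma> where "\<gamma> = \<epsilon> / 4 * c / (real r * real r)"
  have r0: "real r > 0" using k by simp
  have \<gamma>: "\<gamma> > 0" "real r * real r * \<gamma> \<le> \<epsilon> / 4 * ((\<Prod>s<r. 1 - real s * \<theta>) / fact r)"
    using \<epsilon> c r0 unfolding c_def[symmetric] by (auto simp: \<gamma>_def)
  obtain n1 where n1: "\<And>(V :: 'b set) E. finite V \<Longrightarrow> card V \<ge> n1 \<Longrightarrow> loopless E \<Longrightarrow> \<not> embeds F V E \<Longrightarrow>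
    card (cliques V E (Suc r)) \<le> \<gamma> * real (card V) ^ Suc r"
    using few_cliques[OF \<gamma>(1)] by (elim exE) blast
  have c2: "c / 2 > 0" using c by simp
  obtain n2 where n2: "\<And>(V :: 'b set) E \<Q>. finite V \<Longrightarrow> card V \<ge> n2 \<Longrightarrow> loopless E \<Longrightarrow> \<Q> \<subseteq> cliques V E r \<Longrightarrow>
    card \<Q> \<ge> c / 2 * real (card V) ^ r \<Longrightarrow> (\<exists>a. clique_box r ?s V E \<Q> a)"
    using erdos_cliques[OF c2, of r ?s] by (elim exE) blast
  show ?thesis
  proof (intro exI[of _ "max n1 n2"] allI impI)
    fix V :: "'b set" and E B
    assume V: "finite V" "max n1 n2 \<le> card V" and E: "loopless E" and BE: "B \<subseteq> E"
      and free: "\<not> embeds F V E" and big: "(\<Prod>s<k. 1 - real s * \<theta>) * card V ^ k < ordered_cliques V B k"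
    have B: "loopless B" using E BE by (auto simp: loopless_def)
    have freeB: "\<not> embeds F V B" using embeds_mono[OF _ BE] free by blast
    let ?Q = "{Q \<in> cliques V B r. (1 - \<epsilon>) * card V \<le> card (near_extensions V B Q)}"
    have few: "card (cliques V B (Suc r)) \<le> \<gamma> * real (card V) ^ Suc r" using n1[OF V(1) _ B freeB] V(2) by simp
    have Q: "c / 2 * real (card V) ^ r \<le> card ?Q"
      using many_good_cliques[OF V(1) B k \<theta> \<epsilon> big few \<gamma>(2)] \<gamma>(1) by (simp add: c_def)
    have "\<exists>a. clique_box r ?s V B ?Q a" by (rule n2[OF V(1) _ B _ Q]) (use V(2) in auto)
    then obtain a where a: "clique_box r ?s V B ?Q a" by blast
    have "skeleton F t r v0 V E B a ?s \<epsilon>"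
    proof (intro skeleton.intro skeleton_axioms.intro)
      show "critical_graph F t r v0" by (rule critical_graph_axioms)
      show "(1 - \<epsilon>) * card V \<le> card (near_extensions V B ((\<lambda>i. a i j) ` {..<r}))" if "j < ?s" for j
        using clique_boxD(3)[OF a _ that, of 0] k by simp
    qed (use V E BE free clique_boxD[OF a] in auto)
    then show "\<exists>a. skeleton F t r v0 V E B a ?s \<epsilon>" by blast
  qed
qed

text \<open>The competitor deletes all edges of both colours at \<open>v\<close> and inserts only
  blue ones. The union of its colours is a clone of the whole graph, hence free of \<open>F\<close>,
  and maximality applies.\<close>

lemma max_red_blue_nbhd:
  assumes V: "finite V" and max: "max_red_blue (m + 2) F V B R" and v: "v \<in> V"
    and S: "S \<subseteq> V" "\<And>P. P \<subseteq> S \<Longrightarrow> finite P \<Longrightarrow> card P \<le> t \<Longrightarrow> t < card (extensions V B P)"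
  shows "card (cliques S B (m + 1)) \<le> card (cliques (extensions V B {v}) B (m + 1)) + card V ^ m + card V"
proof (rule clone_weight[OF V _ _ _ v S(1)])
  have rb: "red_blue F V B R" using max by (simp add: max_red_blue_def)
  show R: "\<And>e. e \<in> R \<Longrightarrow> card e = 2 \<and> e \<subseteq> V" using rb by (auto simp: red_blue_def)
  then show fR: "finite R" using card_pairs_le(1)[OF V, of R] by blast
  show "loopless B" by (rule red_blue_loopless[OF rb])
  let ?B = "clone B v S" and ?R = "{e \<in> R. v \<notin> e}"
  have "?B \<union> ?R = clone (B \<union> R) v S" by (auto simp: clone_def)
  moreover have "\<not> embeds F V (clone (B \<union> R) v S)"
  proof (rule not_embeds_clone[OF F _ V])
    show "\<not> embeds F V (B \<union> R)" using rb by (simp add: red_blue_def)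
    show "t < card (extensions V (B \<union> R) P)" if "P \<subseteq> S" "finite P" "card P \<le> t" for P
    proof -
      have "card (extensions V B P) \<le> card (extensions V (B \<union> R) P)" using V by (intro card_mono) (auto simp: extensions_def)
      then show ?thesis using S(2)[OF that] by linarith
    qed
  qed
  moreover have "?B \<inter> ?R = {}" using rb by (auto simp: clone_def red_blue_def)
  moreover have "e \<subseteq> V \<and> card e = 2" if "e \<in> ?B \<union> ?R" for e
    using that rb S(1) v by (auto simp: clone_def red_blue_def card_2_iff)
  ultimately have "red_blue F V ?B ?R" by (simp add: red_blue_def)
  then show "card (cliques V ?B (m + 2)) + card ?R \<le> card (cliques V B (m + 2)) + card R"
    using max by (auto simp: max_red_blue_def weight_def)
qed

text \<open>Two Moon-Moser parameters occur: \<open>\<theta>\<close>, above \<open>1 / r\<close>,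
  for the whole blue graph, and \<open>\<theta>2\<close>, below \<open>1 / (r - 1)\<close>, for a
  neighbourhood, whose model is an \<open>(r - 1)\<close>-partite graph.\<close>

lemma max_red_blue_degree:
  fixes \<mu> :: real
  assumes F': "\<not> colorable F r" and m: "1 \<le> m" "m + 2 \<le> r" and \<mu>: "0 < \<mu>" "\<mu> < (real r - 1) / r"
  shows "\<exists>n0. \<forall>(V :: 'b set) B R. finite V \<longrightarrow> n0 \<le> card V \<longrightarrow> max_red_blue (m + 2) F V B R \<longrightarrow>
    (\<forall>x\<in>V. \<mu> * card V \<le> card (extensions V B {x}))"
proof -
  define s where "s = t * t + 2 * t + 1"
  define L where "L = (\<Prod>s<m + 2. 1 - real s * (1 / r))"
  obtain lam \<theta>2 where lam: "0 < lam" "lam < L" and \<theta>2: "0 < \<theta>2" "(real r - 1) * \<theta>2 < 1"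
    "\<mu> ^ (m + 1) * (\<Prod>s<m + 1. 1 - real s * \<theta>2) < lam"
    using parameters_degree[OF m(2) \<mu>] unfolding L_def by blast
  \<comment> \<open>Half of the gap is spent: one \<open>\<delta>\<close> on atypical vertices,
    through the choice of \<open>\<epsilon>\<close>, and another on all terms of order
    \<open>1 / n\<close>.\<close>
  define \<delta> where "\<delta> = (L - lam) / 4"
  have \<delta>: "\<delta> > 0" using lam by (simp add: \<delta>_def)
  define \<epsilon> where "\<epsilon> = \<delta> / (fact (m + 2) * real s)"
  have s0: "real s > 0" unfolding of_nat_0_less_iff by (simp add: s_def)
  have f0: "(fact (m + 2) :: real) > 0" by (rule fact_gt_zero)
  have \<epsilon>: "\<epsilon> > 0" unfolding \<epsilon>_def by (intro divide_pos_pos mult_pos_pos \<delta> f0 s0)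
  have \<epsilon>s: "fact (m + 2) * (real s * \<epsilon>) = \<delta>"
  proof -
    have "fact (m + 2) * real s \<noteq> 0" using f0 s0 by (metis less_irrefl mult_eq_0_iff)
    then show ?thesis unfolding \<epsilon>_def mult.assoc[symmetric] times_divide_eq_right
      by (rule nonzero_mult_div_cancel_left)
  qed
  have "lam + 2 * \<delta> < L" using lam(2) by (simp add: \<delta>_def field_simps)
  then obtain \<theta> where \<theta>: "\<theta> > 0" "(real r - 1) * \<theta> < 1" "1 - \<epsilon> / 4 \<le> r * (1 - (real r - 1) * \<theta>)"
    "lam + 2 * \<delta> < (\<Prod>s<m + 2. 1 - real s * \<theta>)" "(\<Prod>s<m + 2. 1 - real s * \<theta>) < L"
    using parameters_density[OF m(2) \<epsilon>] unfolding L_def by blast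
  define \<gamma> where "\<gamma> = (\<Prod>s<r. 1 - real s * \<theta>2) * lam ^ r / fact r"
  have pos2: "0 < 1 - real s * \<theta>2" if "s < r" for s
  proof -
    have "real s * \<theta>2 \<le> (real r - 1) * \<theta>2" using that \<theta>2 by (intro mult_right_mono) auto
    then show ?thesis using \<theta>2 by linarith
  qed
  have \<gamma>: "\<gamma> > 0" "fact r * \<gamma> \<le> (\<Prod>s<r. 1 - real s * \<theta>2) * lam ^ r"
  proof -
    have "(\<Prod>s<r. 1 - real s * \<theta>2) > 0" using pos2 by (intro prod_pos) simp
    then show "\<gamma> > 0" using lam(1) unfolding \<gamma>_def by (intro divide_pos_pos mult_pos_pos zero_less_power) auto
    show "fact r * \<gamma> \<le> (\<Prod>s<r. 1 - real s * \<theta>2) * lam ^ r" by (simp add: \<gamma>_def)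
  qed
  have k1: "1 \<le> m + 2" by simp
  obtain n1 where n1: "\<And>(V :: 'b set) E B. finite V \<Longrightarrow> n1 \<le> card V \<Longrightarrow> loopless E \<Longrightarrow> B \<subseteq> E \<Longrightarrow> \<not> embeds F V E \<Longrightarrow>
    (\<Prod>s<m + 2. 1 - real s * \<theta>) * card V ^ (m + 2) < ordered_cliques V B (m + 2) \<Longrightarrow>
    (\<exists>a. skeleton F t r v0 V E B a s \<epsilon>)"
    using ex_skeleton[OF k1 m(2) \<theta>(1,2) \<epsilon> \<theta>(3), folded s_def] by (elim exE) blast
  obtain n2 where n2: "\<And>(V :: 'b set) E x. finite V \<Longrightarrow> card V \<ge> n2 \<Longrightarrow> loopless E \<Longrightarrow> \<not> embeds F V E \<Longrightarrow> x \<in> V \<Longrightarrow>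
    card (cliques (extensions V E {x}) E r) < \<gamma> * real (card V) ^ r"
    using few_cliques_nbhd[OF \<gamma>(1)] by (elim exE) blast
  obtain n3 where n3: "\<And>n. n \<ge> n3 \<Longrightarrow>
    (\<Prod>s<m + 2. 1 - real s * \<theta>) < (\<Prod>s<m + 2. 1 - real s / r - real s / real n) - fact (m + 2) / real n"
    using parameters_size[OF \<theta>(5)[unfolded L_def]] by blast
  \<comment> \<open>The share \<open>t\<close> comes from cliques with an edge inside a class, the
    share \<open>2\<close> from the two error terms of the cloning inequality.\<close>
  define K where "K = fact (m + 2) * (real t + 2)"
  define n0 where "n0 = max (max n1 n2) (max n3 (max (r * r) (nat \<lceil>K / \<delta>\<rceil>)))"
  show ?thesis
  proof (intro exI[of _ n0] allI impI ballI)
    fix V :: "'b set" and B R x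
    assume V: "finite V" "n0 \<le> card V" and max: "max_red_blue (m + 2) F V B R" and x: "x \<in> V"
    let ?n = "real (card V)" and ?N = "extensions V B {x}"
    have ns: "n1 \<le> card V" "n2 \<le> card V" "n3 \<le> card V" "r * r \<le> card V" using V(2) by (auto simp: n0_def)
    have n: "card V > 0" using V(1) x by (auto simp: card_gt_0_iff)
    have Kn: "K / ?n \<le> \<delta>"
    proof -
      have "K / \<delta> \<le> ?n" using V(2) unfolding n0_def by linarith
      then show ?thesis using \<delta> n by (simp add: field_simps)
    qed
    have rb: "red_blue F V B R" using max by (simp add: max_red_blue_def)
    have free: "\<not> embeds F V (B \<union> R)" using rb by (simp add: red_blue_def)
    have B: "loopless B" and freeB: "\<not> embeds F V B"
      using red_blue_loopless[OF rb] embeds_mono[of F V B "B \<union> R"] free by auto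
    have k3: "3 \<le> m + 2" "r > 0" using m by auto
    have dens: "(\<Prod>s<m + 2. 1 - real s * \<theta>) * card V ^ (m + 2) < ordered_cliques V B (m + 2)"
      by (rule max_red_blue_density[OF V(1) n F' k3(2) ns(4) k3(1) m(2) n3[OF ns(3)] max])
    obtain a where sk: "skeleton F t r v0 V (B \<union> R) B a s \<epsilon>"
      using n1[OF V(1) ns(1) red_blue_loopless(1)[OF rb] Un_upper1 free dens] by blast
    have "V \<noteq> {}" using x by blast
    obtain S where S: "S \<subseteq> V" "\<And>P. P \<subseteq> S \<Longrightarrow> finite P \<Longrightarrow> card P \<le> t \<Longrightarrow> t < card (extensions V B P)"
      and Sc: "real (m + 2) * (real (card (cliques V B (m + 2))) - (real s * \<epsilon> + t / ?n) * ?n ^ (m + 2))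
        \<le> ?n * card (cliques S B (m + 1))"
      using ex_clone_set[OF sk \<open>V \<noteq> {}\<close>, of m] by blast
    have "card (cliques S B (m + 1)) \<le> card (cliques ?N B (m + 1)) + card V ^ m + card V"
      by (rule max_red_blue_nbhd[OF V(1) max x S])
    then have "real (card (cliques S B (m + 1))) \<le> real (card (cliques ?N B (m + 1)) + card V ^ m + card V)"
      by (rule of_nat_mono)
    then have "?n * card (cliques S B (m + 1)) \<le> ?n * (card (cliques ?N B (m + 1)) + ?n ^ m + ?n)"
      by (intro mult_left_mono) auto
    also have "\<dots> = ?n * card (cliques ?N B (m + 1)) + (?n ^ (m + 1) + ?n ^ 2)"
      by (simp add: algebra_simps power2_eq_square)
    also have "?n ^ 2 \<le> ?n ^ (m + 1)" using n m by (intro power_increasing) auto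
    finally have "real (m + 2) * (real (card (cliques V B (m + 2))) - (real s * \<epsilon> + t / ?n) * ?n ^ (m + 2))
        \<le> ?n * card (cliques ?N B (m + 1)) + 2 * ?n ^ (m + 1)" using Sc by linarith
    then have "fact (m + 1) * (real (m + 2) * (real (card (cliques V B (m + 2))) - (real s * \<epsilon> + t / ?n) * ?n ^ (m + 2)))
        \<le> fact (m + 1) * (?n * card (cliques ?N B (m + 1)) + 2 * ?n ^ (m + 1))"
      by (intro mult_left_mono) auto
    moreover have f2: "fact (m + 2) = fact (m + 1) * real (m + 2)" by (simp add: algebra_simps)
    then have "fact (m + 1) * (real (m + 2) * (real (card (cliques V B (m + 2))) - (real s * \<epsilon> + t / ?n) * ?n ^ (m + 2)))
      = ordered_cliques V B (m + 2) - (fact (m + 2) * (real s * \<epsilon>) + fact (m + 2) * (real t / ?n)) * ?n ^ (m + 2)"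
      unfolding ordered_cliques_def f2 by (simp only: algebra_simps)
    moreover have "fact (m + 1) * (?n * card (cliques ?N B (m + 1)) + 2 * ?n ^ (m + 1))
      = ?n * ordered_cliques ?N B (m + 1) + 2 * fact (m + 1) / ?n * ?n ^ (m + 2)"
      unfolding ordered_cliques_def using n by (simp add: field_simps)
    moreover have "2 * fact (m + 1) / ?n * ?n ^ (m + 2) \<le> fact (m + 2) * (2 / ?n) * ?n ^ (m + 2)"
      unfolding f2 using n by (intro mult_right_mono) (auto simp: field_simps)
    ultimately have "ordered_cliques V B (m + 2) - (\<delta> + fact (m + 2) * (real t / ?n)) * ?n ^ (m + 2)
      \<le> ?n * ordered_cliques ?N B (m + 1) + fact (m + 2) * (2 / ?n) * ?n ^ (m + 2)"
      unfolding \<epsilon>s by linarith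
    moreover have "(\<delta> + fact (m + 2) * (real t / ?n)) * ?n ^ (m + 2) + fact (m + 2) * (2 / ?n) * ?n ^ (m + 2)
       = (\<delta> + K / ?n) * ?n ^ (m + 2)"
      unfolding K_def by (simp only: add_divide_distrib distrib_left distrib_right times_divide_eq_right add.assoc)
    moreover have "(\<delta> + K / ?n) * ?n ^ (m + 2) \<le> (2 * \<delta>) * ?n ^ (m + 2)"
      using Kn by (intro mult_right_mono) auto
    moreover have "(lam + 2 * \<delta>) * ?n ^ (m + 2) \<le> (\<Prod>s<m + 2. 1 - real s * \<theta>) * ?n ^ (m + 2)"
      using \<theta>(4) by (intro mult_right_mono) auto
    moreover have "(lam + 2 * \<delta>) * ?n ^ (m + 2) = lam * ?n ^ (m + 2) + (2 * \<delta>) * ?n ^ (m + 2)"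
      by (rule distrib_right)
    ultimately have "lam * ?n ^ (m + 2) \<le> ?n * ordered_cliques ?N B (m + 1)" using dens by simp
    then have "?n * (lam * ?n ^ (m + 1)) \<le> ?n * ordered_cliques ?N B (m + 1)" by (simp add: mult_ac)
    then have big: "lam * ?n ^ (m + 1) \<le> ordered_cliques ?N B (m + 1)" using n by (simp add: mult_le_cancel_left)
    show "\<mu> * card V \<le> card ?N"
    proof (rule degree_lower[OF _ B _ _ _ _ \<theta>2(1,2) lam(1) \<theta>2(3) big n2[OF V(1) ns(2) B freeB x] \<gamma>(2)])
      show "real (card ?N) \<le> ?n" using card_extensions_le[OF V(1)] by simp
    qed (use V(1) n m in auto)
  qed
qed

lemma weight_le_max_cliques:
  assumes F': "\<not> colorable F r" and k: "3 \<le> k" "k \<le> r"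
  shows "\<exists>n0. \<forall>(V :: 'b set) B R. finite V \<longrightarrow> n0 \<le> card V \<longrightarrow> red_blue F V B R \<longrightarrow>
    (\<exists>E. red_blue F V E {} \<and> weight k V B R \<le> card (cliques V E k))"
proof -
  define m where "m = k - 2"
  have m: "1 \<le> m" "m + 2 \<le> r" "k = m + 2" using k by (auto simp: m_def)
  \<comment> \<open>Replacing \<open>r\<close> by \<open>r - 1 / 2\<close> puts \<open>\<mu>\<close>
    strictly below \<open>1 - 1 / r\<close>, while \<open>(k - 1) * (1 - \<mu>)\<close> stays below
    \<open>1\<close> for all \<open>k \<le> r\<close>.\<close>
  define \<mu> where "\<mu> = 1 - 1 / (real r - 1 / 2)"
  have r: "real r - 1 / 2 > 0" "real r \<ge> 3" using k by auto
  have \<mu>: "0 < \<mu>" "\<mu> < (real r - 1) / r" "\<mu> \<le> 1" using r by (auto simp: \<mu>_def field_simps)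
  obtain n1 where n1: "\<And>(V :: 'b set) B R x. finite V \<Longrightarrow> n1 \<le> card V \<Longrightarrow> max_red_blue k F V B R \<Longrightarrow>
    x \<in> V \<Longrightarrow> \<mu> * card V \<le> card (extensions V B {x})"
    using max_red_blue_degree[OF F' m(1,2) \<mu>(1,2)] unfolding m(3) by (elim exE) blast
  show ?thesis
  proof (intro exI[of _ "max n1 (2 * k * k * r)"] allI impI)
    fix V :: "'b set" and B0 R0
    assume V: "finite V" "max n1 (2 * k * k * r) \<le> card V" and rb0: "red_blue F V B0 R0"
    obtain B R where max: "max_red_blue k F V B R" and w: "weight k V B0 R0 \<le> weight k V B R"
      using ex_max_red_blue[OF V(1) rb0] by blast
    have rb: "red_blue F V B R" using max by (simp add: max_red_blue_def)
    have deg: "\<And>x. x \<in> V \<Longrightarrow> \<mu> * card V \<le> card (extensions V B {x})" using n1[OF V(1) _ max] V(2) by simp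
    \<comment> \<open>The slack left by \<open>\<mu>\<close> is at least \<open>1 / 2\<close>
      against a denominator below \<open>r\<close>, so \<open>2 * k * k * r\<close> vertices suffice
      for the summand \<open>k * k\<close>.\<close>
    have size: "(real k - 1) * ((1 - \<mu>) * card V) + real (k * k) \<le> card V"
    proof -
      let ?n = "real (card V)" and ?d = "real r - 1 / 2"
      have "real (2 * k * k * r) \<le> ?n" using V(2) by (intro of_nat_mono) simp
      then have "2 * (real k * real k) * real r \<le> ?n" by simp
      moreover have "(real k * real k) * ?d \<le> (real k * real k) * real r" by (intro mult_left_mono) auto
      moreover have "(real k - 1) * ?n \<le> (?d - 1 / 2) * ?n" using k by (intro mult_right_mono) auto
      ultimately have "(real k - 1) * ?n + (real k * real k) * ?d \<le> ?d * ?n"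
        by (simp add: left_diff_distrib)
      then show ?thesis unfolding \<mu>_def using r by (simp add: field_simps)
    qed
    have "card (cliques V B k) + card R \<le> card (cliques V (B \<union> R) k)"
    proof (rule weight_le_cliques[OF V(1)])
      show "finite R" using rb by (intro card_pairs_le(1)[OF V(1)]) (auto simp: red_blue_def)
      show "B \<inter> R = {}" "\<And>e. e \<in> R \<Longrightarrow> card e = 2" using rb by (auto simp: red_blue_def)
      show "k * k \<le> card {Q \<in> cliques V (B \<union> R) k. e \<subseteq> Q}" if "e \<in> R" for e
        using that rb
        by (intro many_cliques_through_edge[OF V(1) red_blue_loopless(1)[OF rb] _ deg _ _ k(1) \<mu>(3) size])
          (auto simp: red_blue_def)
    qed (use k in simp)
    moreover have "red_blue F V (B \<union> R) {}" using rb by (simp add: red_blue_def)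
    ultimately show "\<exists>E. red_blue F V E {} \<and> weight k V B0 R0 \<le> card (cliques V E k)"
      using w by (intro exI[of _ "B \<union> R"]) (auto simp: weight_def)
  qed
qed

end

section \<open>Comparison of the two extremal numbers\<close>

theorem theorem1p4:
  fixes k :: nat and F :: "'a hypergraph"
  assumes "k \<ge> 3"
    and "graph F"
    and "chromatic_number F > k"
    and "\<exists>v. color_critical_vertex F v"
  shows "\<exists>n0. \<forall>n\<ge>n0. ex_berge k n F = ex_count n (complete_graph k) F"
proof -
  note graph_F = assms(2)
  obtain v where v: "color_critical_vertex F v" using assms(4) by blast
  define r where "r = chromatic_number F - 1"
  have r: "k \<le> r" "\<not> colorable F r" using assms(3) not_colorable[of r F] by (auto simp: r_def)
  interpret critical_graph F "card (verts F)" r v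
    by unfold_locales
      (use graph_F v color_critical_colorable[OF graph_F v] in \<open>auto simp: r_def color_critical_vertex_def\<close>)
  obtain n0 where n0: "\<And>(V :: nat set) B R. finite V \<Longrightarrow> n0 \<le> card V \<Longrightarrow> red_blue F V B R \<Longrightarrow>
    (\<exists>E. red_blue F V E {} \<and> weight k V B R \<le> card (cliques V E k))"
    using weight_le_max_cliques[OF r(2) assms(1) r(1)] by (elim exE) blast
  show ?thesis
  proof (intro exI[of _ "max n0 (r * r)"] allI impI)
    fix n assume n: "max n0 (r * r) \<le> n"
    have n_pos: "n > 0" using n r assms(1) by (cases n) auto
    define HB where "HB = {card (edges H) | H :: nat hypergraph.
      uniform k H \<and> card (verts H) = n \<and> berge_free F H}"
    define GC where "GC = {copies (complete_graph k) G | G :: nat hypergraph.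
      graph G \<and> card (verts G) = n \<and> graph_free F G}"
    have GC_mem: "card (cliques V E k) \<in> GC"
      if V: "finite V" "card V = n" and rb: "red_blue F V E {}" for V :: "nat set" and E
    proof -
      have E: "e \<subseteq> V" "card e = 2" if "e \<in> E" for e using rb that by (auto simp: red_blue_def)
      have "graph (V, E)" using V(1) E by (auto simp: graph_def uniform_def hypergraph_def)
      moreover have "graph_free F (V, E)"
        using graph_free_iff_embeds[OF graph_F V(1) E(1)] rb by (simp add: red_blue_def)
      ultimately show ?thesis
        unfolding GC_def using copies_complete_graph[OF V(1), of k E, symmetric] V(2)
        by (intro CollectI exI[of _ "(V, E)"]) simp
    qed
    \<comment> \<open>Inclusion in one direction and domination in the other make the maxima equal;
      the Turan graph ensures that \<open>GC\<close> is nonempty, so that \<open>Max\<close> is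
      meaningful.\<close>
    have "GC \<subseteq> HB"
    proof
      fix x assume "x \<in> GC"
      then obtain G :: "nat hypergraph" where G: "x = copies (complete_graph k) G" "graph G"
        "card (verts G) = n" "graph_free F G" by (auto simp: GC_def)
      obtain V E where VE: "G = (V, E)" by (cases G)
      have V: "finite V" and E: "\<And>e. e \<in> E \<Longrightarrow> e \<subseteq> V"
        using G(2) VE by (auto simp: graph_def uniform_def hypergraph_def)
      have free: "\<not> embeds F V E" using graph_free_iff_embeds[OF graph_F V E] G(4) VE by simp
      show "x \<in> HB" unfolding HB_def
        using berge_free_cliques[OF graph_F V E free, of k] copies_complete_graph[OF V, of k E] G VE
        by (intro CollectI exI[of _ "(V, cliques V E k)"]) auto
    qed
    moreover have "GC \<noteq> {}"
    proof -
      have "finite {..<n}" "card {..<n} = n" by auto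
      moreover from this obtain E where "red_blue F {..<n} E {}"
        using red_blue_turan[of "{..<n}" F r k] r n assms(1) by auto
      ultimately show ?thesis using GC_mem by blast
    qed
    moreover have "finite HB"
    proof (rule finite_subset)
      show "HB \<subseteq> {..n ^ k}"
      proof
        fix x assume "x \<in> HB"
        then obtain H :: "nat hypergraph" where H: "x = card (edges H)" "uniform k H" "card (verts H) = n"
          by (auto simp: HB_def)
        have fV: "finite (verts H)" using H(3) n_pos by (metis card.infinite less_irrefl)
        have "card (edges H) \<le> card {Q. Q \<subseteq> verts H \<and> card Q = k}"
          using H(2) fV by (intro card_mono) (auto simp: uniform_def hypergraph_def)
        then show "x \<in> {..n ^ k}" using card_subsets_le[OF fV, of k] H by simp
      qed
    qed simp
    moreover have "\<exists>y\<in>GC. x \<le> y" if x_HB: "x \<in> HB" for x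
    proof -
      obtain H :: "nat hypergraph" where H: "x = card (edges H)" "uniform k H" "card (verts H) = n" "berge_free F H"
        using x_HB unfolding HB_def by blast
      have fV: "finite (verts H)" using H(3) n_pos by (metis card.infinite less_irrefl)
      obtain B R where "red_blue F (verts H) B R" and x: "x \<le> weight k (verts H) B R"
        using berge_free_red_blue[OF graph_F H(2,4)] H(1) by (auto simp: red_blue_def weight_def)
      then obtain E where "red_blue F (verts H) E {}" "weight k (verts H) B R \<le> card (cliques (verts H) E k)"
        using n0[OF fV] H(3) n by auto
      then show ?thesis using GC_mem[OF fV H(3)] x by (meson le_trans)
    qed
    ultimately have "Max HB = Max GC"
      by (intro antisym Max_mono Max.boundedI)
        (auto intro: order_trans[OF _ Max_ge] finite_subset)
    then show "ex_berge k n F = ex_count n (complete_graph k) F"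
      by (simp add: ex_berge_def ex_count_def HB_def GC_def)
  qed
qed

end
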